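(* Consider the Singleton Inverse Linear Feasibility Problem with the LP in natural form and fixed right-hand side (i.e., $B=0$): given $A\in\mathbb{Q}^{m\times n}$, $b\in\mathbb{Q}^m$, $C\in\mathbb{Q}^{n\times k}$, $c\in\mathbb{Q}^n$, a polyhedron $X=\{x\in\mathbb{R}^k \mid Dx\le d\}$ with $D\in\mathbb{Q}^{g\times k}$, $d\in\mathbb{Q}^g$, and a target solution $\bar y\in\mathbb{Q}^n$, decide (optimistic scenario) whether there exists $x\in X$ such that $\bar y\in\arg\min\{(Cx+c)^\top y \mid Ay\le b,\ y\in\mathbb{R}^n\}$; (pessimistic scenario) whether there exists $x\in X$ such that $\arg\min\{(Cx+c)^\top y \mid Ay\le b,\ y\in\mathbb{R}^n\}=\{\bar y\}$. Both of these decision problems are solvable in polynomial time.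
   Context: All input data are rational and given in the usual binary encoding; polynomial time means polynomial in the encoding length of the input. For each fixed parameter $x$, $\arg\min$ denotes the set of optimal solutions of the LP (empty if the LP is infeasible or unbounded). *)

theory Defs
  imports
    Complex_Main
    "HOL-Library.Log_Nat"
    "HOL-Computational_Algebra.Polynomial"
    "Jordan_Normal_Form.Matrix"
begin

section \<open>Polynomial-time decidability\<close>

text \<open>
  The machine model is a random access machine with the logarithmic cost criterion, in structured
  form: while programs over integer cells, where \<open>s a i\<close> is the content of cell \<open>i\<close> of the
  \<open>a\<close>-th array in the state \<open>s\<close>.  A program is a finite syntactic object and uses only the fixed
  array numbers occurring in it; cells within an array are addressed by computed indices.
  Every operation is charged the number of bits of the integers (including cell addresses) it
  handles, so polynomial time in this model is polynomial time on Turing machines.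
\<close>

type_synonym state = "nat \<Rightarrow> int \<Rightarrow> int"

datatype aexp =
    Const int
  | Cell nat aexp
  | Plus aexp aexp
  | Minus aexp aexp
  | Times aexp aexp
  | Div aexp aexp

datatype bexp =
    Less aexp aexp
  | Not bexp
  | And bexp bexp

datatype com =
    Skip
  | Assign nat aexp aexp
  | Seq com com
  | If bexp com com
  | While bexp com

fun aval :: "aexp \<Rightarrow> state \<Rightarrow> int" where
  "aval (Const c) s = c"
| "aval (Cell a e) s = s a (aval e s)"
| "aval (Plus e1 e2) s = aval e1 s + aval e2 s"
| "aval (Minus e1 e2) s = aval e1 s - aval e2 s"
| "aval (Times e1 e2) s = aval e1 s * aval e2 s"
| "aval (Div e1 e2) s = aval e1 s div aval e2 s"

fun bval :: "bexp \<Rightarrow> state \<Rightarrow> bool" where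
  "bval (Less e1 e2) s = (aval e1 s < aval e2 s)"
| "bval (Not b) s = (\<not> bval b s)"
| "bval (And b1 b2) s = (bval b1 s \<and> bval b2 s)"

text \<open>One sign bit plus the length of the binary representation of the absolute value.\<close>

definition int_size :: "int \<Rightarrow> nat" where
  "int_size z = 1 + floorlog 2 (nat \<bar>z\<bar>)"

fun acost :: "aexp \<Rightarrow> state \<Rightarrow> nat" where
  "acost (Const c) s = int_size c"
| "acost (Cell a e) s = acost e s + int_size (aval e s) + int_size (s a (aval e s))"
| "acost (Plus e1 e2) s = acost e1 s + acost e2 s + int_size (aval e1 s) + int_size (aval e2 s)"
| "acost (Minus e1 e2) s = acost e1 s + acost e2 s + int_size (aval e1 s) + int_size (aval e2 s)"
| "acost (Times e1 e2) s = acost e1 s + acost e2 s + int_size (aval e1 s) + int_size (aval e2 s)"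
| "acost (Div e1 e2) s = acost e1 s + acost e2 s + int_size (aval e1 s) + int_size (aval e2 s)"

fun bcost :: "bexp \<Rightarrow> state \<Rightarrow> nat" where
  "bcost (Less e1 e2) s = acost e1 s + acost e2 s + int_size (aval e1 s) + int_size (aval e2 s)"
| "bcost (Not b) s = 1 + bcost b s"
| "bcost (And b1 b2) s = 1 + bcost b1 s + bcost b2 s"

text \<open>\<open>exec c s t s'\<close>: started in \<open>s\<close>, the program \<open>c\<close> halts in \<open>s'\<close> after time \<open>t\<close>.\<close>

inductive exec :: "com \<Rightarrow> state \<Rightarrow> nat \<Rightarrow> state \<Rightarrow> bool" where
  Skip: "exec Skip s 1 s"
| Assign: "exec (Assign a e1 e2) s
    (1 + acost e1 s + acost e2 s + int_size (aval e1 s) + int_size (aval e2 s))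
    (s(a := (s a)(aval e1 s := aval e2 s)))"
| Seq: "exec c1 s1 t1 s2 \<Longrightarrow> exec c2 s2 t2 s3 \<Longrightarrow> exec (Seq c1 c2) s1 (1 + t1 + t2) s3"
| IfTrue: "bval b s \<Longrightarrow> exec c1 s t s' \<Longrightarrow> exec (If b c1 c2) s (1 + bcost b s + t) s'"
| IfFalse: "\<not> bval b s \<Longrightarrow> exec c2 s t s' \<Longrightarrow> exec (If b c1 c2) s (1 + bcost b s + t) s'"
| WhileFalse: "\<not> bval b s \<Longrightarrow> exec (While b c) s (1 + bcost b s) s"
| WhileTrue: "bval b s1 \<Longrightarrow> exec c s1 t1 s2 \<Longrightarrow> exec (While b c) s2 t2 s3 \<Longrightarrow>
    exec (While b c) s1 (1 + bcost b s1 + t1 + t2) s3"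

inductive_cases SkipE: "exec Skip s t s'"
inductive_cases AssignE: "exec (Assign a e1 e2) s t s'"
inductive_cases SeqE: "exec (Seq c1 c2) s t s'"
inductive_cases IfE: "exec (If b c1 c2) s t s'"
inductive_cases WhileE: "exec (While b c) s t s'"

lemma exec_deterministic:
  assumes "exec c s t s'" and "exec c s u s''"
  shows "u = t \<and> s'' = s'"
  using assms
proof (induction arbitrary: u s'' rule: exec.induct)
  case (Skip s)
  then show ?case by (auto elim: SkipE)
next
  case (Assign a e1 e2 s)
  then show ?case by (auto elim: AssignE)
next
  case (Seq c1 s1 t1 s2 c2 t2 s3)
  from Seq.prems show ?case
    by (rule SeqE) (auto dest!: Seq.IH)
next
  case (IfTrue b s c1 t s' c2)
  from IfTrue.prems show ?case
    by (rule IfE) (use IfTrue.hyps(1) in \<open>auto dest!: IfTrue.IH\<close>)+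
next
  case (IfFalse b s c2 t s' c1)
  from IfFalse.prems show ?case
    by (rule IfE) (use IfFalse.hyps(1) in \<open>auto dest!: IfFalse.IH\<close>)+
next
  case (WhileFalse b s c)
  from WhileFalse.prems show ?case
    by (rule WhileE) (use WhileFalse.hyps in \<open>auto\<close>)+
next
  case (WhileTrue b s1 c t1 s2 t2 s3)
  from WhileTrue.prems show ?case
    by (rule WhileE) (use WhileTrue.hyps(1) in \<open>auto dest!: WhileTrue.IH\<close>)+
qed

text \<open>The input is a list of integers, stored in array 0; all other cells are initially zero.\<close>

definition init_state :: "int list \<Rightarrow> state" where
  "init_state xs = (\<lambda>a i. if a = 0 \<and> 0 \<le> i \<and> i < int (length xs) then xs ! nat i else 0)"

definition input_size :: "int list \<Rightarrow> nat" where
  "input_size xs = (\<Sum>z\<leftarrow>xs. int_size z)"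

text \<open>The answer is returned in cell 0 of array 1.\<close>

definition poly_time_decidable :: "'i set \<Rightarrow> ('i \<Rightarrow> int list) \<Rightarrow> ('i \<Rightarrow> bool) \<Rightarrow> bool" where
  "poly_time_decidable I enc Q \<longleftrightarrow>
    (\<exists>(c :: com) (p :: nat poly). \<forall>x\<in>I. \<exists>t s'.
       exec c (init_state (enc x)) t s' \<and>
       t \<le> poly p (input_size (enc x)) \<and>
       s' 1 0 = (if Q x then 1 else 0))"


section \<open>Singleton inverse linear feasibility\<close>

record instance_data =
  matA :: "rat mat"
  vecb :: "rat vec"
  matC :: "rat mat"
  vecc :: "rat vec"
  matD :: "rat mat"
  vecd :: "rat vec"
  target :: "rat vec"

definition instances :: "instance_data set" where
  "instances = {I. \<exists>m n k g.
     matA I \<in> carrier_mat m n \<and> vecb I \<in> carrier_vec m \<and>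
     matC I \<in> carrier_mat n k \<and> vecc I \<in> carrier_vec n \<and>
     matD I \<in> carrier_mat g k \<and> vecd I \<in> carrier_vec g \<and>
     target I \<in> carrier_vec n}"

definition encode_rat :: "rat \<Rightarrow> int list" where
  "encode_rat q = [fst (quotient_of q), snd (quotient_of q)]"

definition encode_vec :: "rat vec \<Rightarrow> int list" where
  "encode_vec v = concat (map encode_rat (list_of_vec v))"

definition encode_mat :: "rat mat \<Rightarrow> int list" where
  "encode_mat M = concat (map encode_rat (concat (mat_to_list M)))"

definition encode :: "instance_data \<Rightarrow> int list" where
  "encode I =
     [int (dim_row (matA I)), int (dim_col (matA I)),
      int (dim_col (matD I)), int (dim_row (matD I))] @
     encode_mat (matA I) @ encode_vec (vecb I) @
     encode_mat (matC I) @ encode_vec (vecc I) @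
     encode_mat (matD I) @ encode_vec (vecd I) @
     encode_vec (target I)"

abbreviation real_mat :: "rat mat \<Rightarrow> real mat" where
  "real_mat \<equiv> map_mat of_rat"

abbreviation real_vec :: "rat vec \<Rightarrow> real vec" where
  "real_vec \<equiv> map_vec of_rat"

definition polyhedron :: "real mat \<Rightarrow> real vec \<Rightarrow> real vec set" where
  "polyhedron M r = {z \<in> carrier_vec (dim_col M). M *\<^sub>v z \<le> r}"

text \<open>The set of optimal solutions of minimising \<open>q \<bullet> y\<close> subject to \<open>M *\<^sub>v y \<le> r\<close>; it is empty if the
  linear program is infeasible or unbounded.\<close>

definition lp_argmin :: "real vec \<Rightarrow> real mat \<Rightarrow> real vec \<Rightarrow> real vec set" where
  "lp_argmin q M r = {y \<in> polyhedron M r. \<forall>z\<in>polyhedron M r. q \<bullet> y \<le> q \<bullet> z}"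

definition param_set :: "instance_data \<Rightarrow> real vec set" where
  "param_set I = polyhedron (real_mat (matD I)) (real_vec (vecd I))"

definition lp_solutions :: "instance_data \<Rightarrow> real vec \<Rightarrow> real vec set" where
  "lp_solutions I x =
     lp_argmin (real_mat (matC I) *\<^sub>v x + real_vec (vecc I))
       (real_mat (matA I)) (real_vec (vecb I))"

definition optimistic :: "instance_data \<Rightarrow> bool" where
  "optimistic I \<longleftrightarrow> (\<exists>x\<in>param_set I. real_vec (target I) \<in> lp_solutions I x)"

definition pessimistic :: "instance_data \<Rightarrow> bool" where
  "pessimistic I \<longleftrightarrow> (\<exists>x\<in>param_set I. lp_solutions I x = {real_vec (target I)})"

end

theory Submission
  imports Defs "Jordan_Normal_Form.Determinant"
begin

text \<open>
  By LP duality, a feasible target is optimal for the cost \<open>C x + c\<close> iff the negated cost lies in the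
  cone generated by the constraint rows that are tight at the target, and it is the unique optimum iff
  the cost can moreover be moved a little in each of the \<open>2 n\<close> coordinate directions.  After
  homogenisation both questions ask whether a system \<open>H z \<ge> 0, z\<^sub>0 > 0\<close> is solvable.  Basic solutions
  have entries bounded by determinants, so this is equivalent to the solvability of a strict system
  \<open>B z > 0\<close> with \<open>b\<^sub>k = E h\<^sub>k + (1, 0, \<dots>, 0)\<close> for a large power of two \<open>E\<close>, and if there is a solution then there is
  one in the unit box with all \<open>b\<^sub>k z\<close> in \<open>[2\<^bsup>-t\<^esup>, 1]\<close> for a polynomially bounded \<open>t\<close>.

  The strict system is decided by Chubanov's coordinate scaling method.  With scaling factors \<open>S\<^sub>k\<close>
  (powers of two, such that \<open>S\<^sub>k b\<^sub>k z \<le> 1\<close> for all solutions in the box) put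
  \<open>Q = I + \<Sum> S\<^sub>k\<^sup>2 b\<^sub>k b\<^sub>k\<^sup>T\<close>.  A perceptron starts with \<open>z = 0\<close> and adds \<open>Q\<^sup>-\<^sup>1 S\<^sub>k b\<^sub>k\<close> as long as there is a row \<open>k\<close> with
  \<open>b\<^sub>k z \<le> 0\<close>.  Each step increases \<open>z\<^sup>T Q z\<close> by at most \<open>1\<close>, so after polynomially many steps the
  Cauchy-Schwarz inequality shows that the most frequently used row satisfies \<open>2 S\<^sub>k b\<^sub>k z \<le> 1\<close> for all
  solutions in the box, and \<open>S\<^sub>k\<close> can be doubled.  Since \<open>S\<^sub>k\<close> cannot exceed \<open>2\<^sup>t\<close> in the solvable case, the
  method stops after polynomially many rounds.  All numbers are integers: instead of the inverse
  of \<open>Q\<close> the adjugate and the determinant are updated.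
\<close>

section \<open>Adjugates under rank-one updates\<close>

text \<open>Because the right-hand side b is fixed, the rows that are tight at the target do not
  depend on x, so membership of the negated cost in their cone is a linear condition on x and the
  multipliers together; no products of unknowns occur. The obstacle is to solve the resulting linear
  system in polynomial time with exact integers. The scaling method suits this: it needs no square
  roots and no rounding, and its numbers are controlled by one quantity, the determinant d of Q. As
  Q dominates the identity, every entry of the adjugate is at most d in absolute value, and d grows
  by a bounded factor per update. The perturbation by (1, 0, ..., 0) is there because the method
  needs an open cone, and one that is not too thin inside the box. The cost analysis uses one width
  w for all cells and one bound N for the rounds of every loop: for a fixed program the running time
  is then a polynomial in N and w, so only stored values and loop counts have to be
  estimated.\<close>

text \<open>Two eliminations in the bordered matrix \<open>K\<close> with blocks A, -U, V, 1:
  clearing V by column operations gives det (A + U V), clearing it by row operations with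
  \<open>N\<close> gives det A times (d + V N U), at the price of the factor d = det R. Using
  \<open>N * A = d \<cdot>\<^sub>m 1\<^sub>m n\<close> instead of an inverse keeps the statement
  inside an integral domain.\<close>

lemma det_rank_one_update:
  fixes A N U V :: "'a :: idom mat"
  assumes A: "A \<in> carrier_mat n n" and N: "N \<in> carrier_mat n n"
    and U: "U \<in> carrier_mat n 1" and V: "V \<in> carrier_mat 1 n"
    and NA: "N * A = d \<cdot>\<^sub>m 1\<^sub>m n"
  shows "d * det (A + U * V) = det A * (d + (V * N * U) $$ (0, 0))"
proof -
  define K where "K = four_block_mat A (- U) V (1\<^sub>m 1)"
  have K: "K \<in> carrier_mat (n + 1) (n + 1)"
    unfolding K_def by (rule four_block_carrier_mat) (use A in auto)
  have mU: "- U \<in> carrier_mat n 1" and mV: "- V \<in> carrier_mat 1 n" using U V by auto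
  define L where "L = four_block_mat (1\<^sub>m n) (0\<^sub>m n 1) (- V) (1\<^sub>m 1 :: 'a mat)"
  have L: "L \<in> carrier_mat (n + 1) (n + 1)"
    unfolding L_def by (rule four_block_carrier_mat) auto
  have "K * L = four_block_mat (A + U * V) (- U) (0\<^sub>m 1 n) (1\<^sub>m 1)"
    unfolding K_def L_def
    by (subst mult_four_block_mat[OF A mU V one_carrier_mat one_carrier_mat zero_carrier_mat mV one_carrier_mat])
      (use A U V in \<open>auto intro!: eq_matI simp: scalar_prod_def\<close>)
  then have "det (K * L) = det (A + U * V) * det (1\<^sub>m 1 :: 'a mat)"
    by (simp only:) (rule det_four_block_mat_lower_left_zero[OF _ _ refl], use A U V in auto)
  moreover have "det L = 1"
    unfolding L_def by (subst det_four_block_mat_upper_right_zero[of _ n _ 1]) (use mV in auto)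
  ultimately have 1: "det K = det (A + U * V)"
    by (simp add: det_mult[OF K L])
  define R where "R = four_block_mat (1\<^sub>m n) (0\<^sub>m n 1) (- (V * N)) (d \<cdot>\<^sub>m 1\<^sub>m 1)"
  have R: "R \<in> carrier_mat (n + 1) (n + 1)"
    unfolding R_def by (rule four_block_carrier_mat) auto
  have VN: "- (V * N) \<in> carrier_mat 1 n" using V N by auto
  have VNA: "- (V * N) * A = - (d \<cdot>\<^sub>m V)"
  proof -
    have "V * N * A = V * (N * A)" using V N A by (simp add: assoc_mult_mat)
    also have "\<dots> = d \<cdot>\<^sub>m V" unfolding NA using V
      by (metis mult_smult_distrib one_carrier_mat right_mult_one_mat)
    finally show ?thesis using V N A by (metis mult_carrier_mat uminus_mult_left_mat carrier_matD)
  qed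
  have 2: "R * K = four_block_mat A (- U) (0\<^sub>m 1 n) (d \<cdot>\<^sub>m 1\<^sub>m 1 + V * N * U)"
    unfolding K_def R_def
    apply (subst mult_four_block_mat[OF one_carrier_mat zero_carrier_mat VN _ A mU V one_carrier_mat])
     apply simp
    apply (subst VNA)
    apply (rule arg_cong4[of _ _ _ _ _ _ _ _ four_block_mat])
    using A U V N apply (auto intro!: eq_matI simp: scalar_prod_def)
    done
  have "det (R * K) = det A * det (d \<cdot>\<^sub>m 1\<^sub>m 1 + V * N * U)"
    unfolding 2 by (rule det_four_block_mat_lower_left_zero[OF _ _ refl]) (use A U V N in auto)
  also have "det (d \<cdot>\<^sub>m 1\<^sub>m 1 + V * N * U) = d + (V * N * U) $$ (0, 0)"
    by (subst det_single) (use V N U in auto)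
  finally have "det (R * K) = det A * (d + (V * N * U) $$ (0, 0))" .
  moreover have "det R = d"
    unfolding R_def by (subst det_four_block_mat_upper_right_zero[of _ n _ 1]) (use VN in auto)
  ultimately show ?thesis using 1 det_mult[OF R K] by simp
qed

text \<open>Matrices are index functions, so that the cells of a program array can be read as a
  matrix without conversion.\<close>

definition is_adjugate :: "nat \<Rightarrow> (nat \<Rightarrow> nat \<Rightarrow> int) \<Rightarrow> (nat \<Rightarrow> nat \<Rightarrow> int) \<Rightarrow> int \<Rightarrow> bool" where
  "is_adjugate n Q N d \<longleftrightarrow>
    mat n n (\<lambda>(i, j). N i j) = adj_mat (mat n n (\<lambda>(i, j). Q i j)) \<and>
    d = det (mat n n (\<lambda>(i, j). Q i j))"

lemma is_adjugate_cong:
  assumes "is_adjugate n Q N d" "\<And>i j. i < n \<Longrightarrow> j < n \<Longrightarrow> Q' i j = Q i j"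
    "\<And>i j. i < n \<Longrightarrow> j < n \<Longrightarrow> N' i j = N i j"
  shows "is_adjugate n Q' N' d"
proof -
  have "mat n n (\<lambda>(i, j). N' i j) = mat n n (\<lambda>(i, j). N i j)"
    "mat n n (\<lambda>(i, j). Q' i j) = mat n n (\<lambda>(i, j). Q i j)"
    by (auto intro!: eq_matI simp: assms)
  with assms(1) show ?thesis unfolding is_adjugate_def by metis
qed

lemma mat_mult_eq_smult_one_iff:
  fixes Q N :: "nat \<Rightarrow> nat \<Rightarrow> 'a :: comm_ring_1"
  shows "mat n n (\<lambda>(i, j). Q i j) * mat n n (\<lambda>(i, j). N i j) = d \<cdot>\<^sub>m 1\<^sub>m n \<longleftrightarrow>
    (\<forall>i<n. \<forall>j<n. (\<Sum>l<n. Q i l * N l j) = (if i = j then d else 0))"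
  (is "?L = ?R \<longleftrightarrow> ?P")
proof
  assume eq: "?L = ?R"
  show ?P
  proof (intro allI impI)
    fix i j assume "i < n" "j < n"
    then show "(\<Sum>l<n. Q i l * N l j) = (if i = j then d else 0)"
      using arg_cong[OF eq, of "\<lambda>M. M $$ (i, j)"] by (simp add: scalar_prod_def lessThan_atLeast0)
  qed
next
  assume ?P
  then show "?L = ?R"
    by (intro eq_matI) (auto simp: scalar_prod_def lessThan_atLeast0)
qed

lemma is_adjugate_mult:
  assumes "is_adjugate n Q N d"
  shows "\<forall>i<n. \<forall>j<n. (\<Sum>l<n. Q i l * N l j) = (if i = j then d else 0)"
    "\<forall>i<n. \<forall>j<n. (\<Sum>l<n. N i l * Q l j) = (if i = j then d else 0)"
  unfolding mat_mult_eq_smult_one_iff[symmetric]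
  using assms adj_mat(2,3)[of "mat n n (\<lambda>(i, j). Q i j)" n]
  by (auto simp: is_adjugate_def)

lemma is_adjugate_unit: "is_adjugate n (\<lambda>i j. of_bool (i = j)) (\<lambda>i j. of_bool (i = j)) 1"
proof -
  have 1: "mat n n (\<lambda>(i, j). of_bool (i = j)) = (1\<^sub>m n :: int mat)"
    by (auto intro!: eq_matI)
  have "1\<^sub>m n * adj_mat (1\<^sub>m n :: int mat) = 1 \<cdot>\<^sub>m 1\<^sub>m n"
    using adj_mat(2)[of "1\<^sub>m n :: int mat" n] by simp
  then have "adj_mat (1\<^sub>m n :: int mat) = 1\<^sub>m n"
    using adj_mat(1)[of "1\<^sub>m n :: int mat" n] by (auto intro!: eq_matI simp: smult_one)
  then show ?thesis unfolding is_adjugate_def 1 by simp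
qed

text \<open>Exactness of the division keeps all numbers integral: the quotient is again an adjugate.\<close>

lemma is_adjugate_rank_one_update:
  assumes adj: "is_adjugate n Q N d" and d: "d \<noteq> 0"
    and sym: "\<And>i j. i < n \<Longrightarrow> j < n \<Longrightarrow> N i j = N j i"
    and w: "\<And>i. i < n \<Longrightarrow> w i = (\<Sum>j<n. N i j * u j)"
    and r: "r = d + mu * (\<Sum>i<n. u i * w i)" and r0: "r \<noteq> 0"
  shows "is_adjugate n (\<lambda>i j. Q i j + mu * u i * u j)
      (\<lambda>i j. (r * N i j - mu * w i * w j) div d) r"
proof -
  define A where "A = mat n n (\<lambda>(i, j). Q i j)"
  define M where "M = mat n n (\<lambda>(i, j). N i j)"
  have A: "A \<in> carrier_mat n n" and M: "M \<in> carrier_mat n n" by (auto simp: A_def M_def)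
  have MA: "M = adj_mat A" and dA: "d = det A" using adj by (auto simp: is_adjugate_def A_def M_def)
  define U where "U = mat n 1 (\<lambda>(i, j). mu * u i)"
  define V where "V = mat 1 n (\<lambda>(i, j). u j)"
  define C where "C = mat n n (\<lambda>(i, j). Q i j + mu * u i * u j)"
  have C: "C \<in> carrier_mat n n" by (simp add: C_def)
  have "C = A + U * V"
    by (auto intro!: eq_matI simp: C_def A_def U_def V_def scalar_prod_def)
  moreover have "(V * M * U) $$ (0, 0) = (\<Sum>j<n. (\<Sum>i<n. u i * N i j) * (mu * u j))"
    by (simp add: V_def M_def U_def scalar_prod_def lessThan_atLeast0)
  moreover have "\<dots> = mu * (\<Sum>i<n. u i * w i)"
  proof -
    have "(\<Sum>j<n. (\<Sum>i<n. u i * N i j) * (mu * u j)) = mu * (\<Sum>j<n. w j * u j)"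
      unfolding sum_distrib_left
      by (rule sum.cong[OF refl], subst w) (auto simp: sum_distrib_left sum_distrib_right sym mult_ac intro!: sum.cong)
    then show ?thesis by (simp add: mult_ac)
  qed
  ultimately have "d * det C = d * r"
    using det_rank_one_update[OF A M, of U V d] adj_mat(3)[OF A] MA dA r
    by (simp add: U_def V_def)
  then have dC: "det C = r" using d by simp
  define X where "X = mat n n (\<lambda>(i, j). r * N i j - mu * w i * w j)"
  have X: "X \<in> carrier_mat n n" by (simp add: X_def)
  have Qw: "(\<Sum>l<n. Q i l * w l) = d * u i" if "i < n" for i
  proof -
    have "(\<Sum>l<n. Q i l * w l) = (\<Sum>l<n. \<Sum>j<n. Q i l * N l j * u j)"
      by (rule sum.cong[OF refl], subst w) (auto simp: sum_distrib_left mult_ac)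
    also have "\<dots> = (\<Sum>j<n. (\<Sum>l<n. Q i l * N l j) * u j)"
      by (subst sum.swap) (simp add: sum_distrib_right)
    also have "\<dots> = (\<Sum>j<n. (if i = j then d else 0) * u j)"
      by (rule sum.cong[OF refl], subst is_adjugate_mult(1)[OF adj, rule_format]) (auto simp: that)
    also have "\<dots> = (\<Sum>j<n. if j = i then d * u j else 0)" by (rule sum.cong) auto
    also have "\<dots> = d * u i" using that by simp
    finally show ?thesis .
  qed
  \<comment> \<open>Sherman-Morrison with denominators cleared: \<open>X\<close> is r d times the
    inverse of \<open>C\<close>.\<close>
  have "C * X = (r * d) \<cdot>\<^sub>m 1\<^sub>m n"
    unfolding C_def X_def mat_mult_eq_smult_one_iff
  proof (intro allI impI)
    fix i j assume ij: "i < n" "j < n"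
    have uN: "(\<Sum>l<n. u l * N l j) = w j"
      by (subst w) (auto simp: ij sym mult_ac intro!: sum.cong)
    have "(\<Sum>l<n. (Q i l + mu * u i * u l) * (r * N l j - mu * w l * w j)) =
      (\<Sum>l<n. r * (Q i l * N l j) - mu * w j * (Q i l * w l) + mu * u i * r * (u l * N l j)
         - mu * u i * mu * w j * (u l * w l))"
      by (rule sum.cong) (auto simp: algebra_simps)
    also have "\<dots> = r * (\<Sum>l<n. Q i l * N l j) - mu * w j * (\<Sum>l<n. Q i l * w l)
         + mu * u i * r * (\<Sum>l<n. u l * N l j) - mu * u i * mu * w j * (\<Sum>l<n. u l * w l)"
      by (simp add: sum.distrib sum_subtractf sum_distrib_left)
    also have "\<dots> = r * (if i = j then d else 0) - mu * w j * (d * u i)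
         + mu * u i * r * w j - mu * u i * w j * (r - d)"
      by (subst is_adjugate_mult(1)[OF adj, rule_format, OF ij], subst Qw[OF ij(1)], subst uN)
        (simp add: r algebra_simps)
    also have "\<dots> = (if i = j then r * d else 0)" by (simp add: algebra_simps)
    finally show "(\<Sum>l<n. (Q i l + mu * u i * u l) * (r * N l j - mu * w l * w j)) =
      (if i = j then r * d else 0)" .
  qed
  \<comment> \<open>Multiplying by the adjugate of \<open>C\<close>, whose determinant is r, and
    cancelling r shows that \<open>X\<close> is d times an integral matrix; hence the division by d
    leaves no remainder.\<close>
  moreover have "adj_mat C * (C * X) = r \<cdot>\<^sub>m X"
    by (subst assoc_mult_mat[symmetric, of _ n n _ n _ n]) (use C X adj_mat[OF C] in \<open>auto simp: dC mult_smult_assoc_mat[of _ n n _ n]\<close>)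
  ultimately have "r \<cdot>\<^sub>m X = (r * d) \<cdot>\<^sub>m adj_mat C"
    using adj_mat(1)[OF C] by (simp add: mult_smult_distrib[of _ n n _ n])
  note rX = this
  have X_eq: "r * N i j - mu * w i * w j = d * adj_mat C $$ (i, j)" if ij: "i < n" "j < n" for i j
  proof -
    have "r * (r * N i j - mu * w i * w j) = (r \<cdot>\<^sub>m X) $$ (i, j)" using ij by (simp add: X_def)
    also have "\<dots> = r * (d * adj_mat C $$ (i, j))" unfolding rX using ij adj_mat(1)[OF C] by simp
    finally show ?thesis using r0 by simp
  qed
  have "mat n n (\<lambda>(i, j). (r * N i j - mu * w i * w j) div d) = adj_mat C"
    by (rule eq_matI) (use adj_mat(1)[OF C] d in \<open>auto simp: X_eq\<close>)
  then show ?thesis unfolding is_adjugate_def using dC by (simp add: C_def)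
qed

text \<open>Leibniz formula: n! products of absolute value at most V^n. Only the logarithm of the
  bound enters later, so this crude estimate is good enough.\<close>

lemma det_abs_le:
  fixes A :: "int mat"
  assumes A: "A \<in> carrier_mat n n" and le: "\<And>i j. i < n \<Longrightarrow> j < n \<Longrightarrow> \<bar>A $$ (i, j)\<bar> \<le> V"
  shows "\<bar>det A\<bar> \<le> fact n * V ^ n"
proof -
  have "\<bar>det A\<bar> \<le> (\<Sum>p\<in>{p. p permutes {0..<n}}. \<bar>signof p * (\<Prod>i = 0..<n. A $$ (i, p i))\<bar>)"
    unfolding det_def'[OF A] by (rule sum_abs)
  also have "\<dots> \<le> (\<Sum>p\<in>{p. p permutes {0..<n}}. V ^ n)"
  proof (rule sum_mono)
    fix p assume "p \<in> {p. p permutes {0..<n}}"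
    then have p: "p permutes {0..<n}" by simp
    have "\<bar>signof p * (\<Prod>i = 0..<n. A $$ (i, p i))\<bar> = (\<Prod>i = 0..<n. \<bar>A $$ (i, p i)\<bar>)"
      by (simp add: abs_mult abs_prod sign_def)
    also have "\<dots> \<le> (\<Prod>i = 0..<n. V)"
      by (rule prod_mono) (use p in \<open>auto intro!: le simp: permutes_in_image\<close>)
    finally show "\<bar>signof p * (\<Prod>i = 0..<n. A $$ (i, p i))\<bar> \<le> V ^ n" by simp
  qed
  also have "\<dots> = fact n * V ^ n"
    by (simp add: card_permutations)
  finally show ?thesis .
qed

lemma adj_mat_abs_le:
  fixes A :: "int mat"
  assumes A: "A \<in> carrier_mat n n" and le: "\<And>i j. i < n \<Longrightarrow> j < n \<Longrightarrow> \<bar>A $$ (i, j)\<bar> \<le> V"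
    and ij: "i < n" "j < n"
  shows "\<bar>adj_mat A $$ (i, j)\<bar> \<le> fact (n - 1) * V ^ (n - 1)"
proof -
  have "\<bar>adj_mat A $$ (i, j)\<bar> = \<bar>det (mat_delete A j i)\<bar>"
    using A ij by (simp add: adj_mat_def cofactor_def abs_mult)
  also have "\<dots> \<le> fact (n - 1) * V ^ (n - 1)"
  proof (rule det_abs_le)
    show "mat_delete A j i \<in> carrier_mat (n - 1) (n - 1)" using A by (auto simp: mat_delete_def)
    fix i' j' assume "i' < n - 1" "j' < n - 1"
    then show "\<bar>mat_delete A j i $$ (i', j')\<bar> \<le> V" using A by (auto simp: mat_delete_def intro!: le)
  qed
  finally show ?thesis .
qed

section \<open>Farkas' lemma and small solutions of linear systems\<close>

lemma farkas:
  fixes a :: "nat \<Rightarrow> nat \<Rightarrow> real" and q :: "nat \<Rightarrow> real"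
  assumes "\<And>x. (\<And>i. i < m \<Longrightarrow> (\<Sum>j<n. a i j * x j) \<le> 0) \<Longrightarrow> (\<Sum>j<n. q j * x j) \<le> 0"
  shows "\<exists>l. (\<forall>i<m. 0 \<le> l i) \<and> (\<forall>j<n. q j = (\<Sum>i<m. l i * a i j))"
  using assms
proof (induction m arbitrary: a q)
  case 0
  have "(\<Sum>j<n. q j * q j) \<le> 0" using 0 by simp
  then have "(\<Sum>j<n. q j * q j) = 0" by (intro antisym sum_nonneg) auto
  then have "\<forall>j<n. q j = 0" by (simp add: sum_nonneg_eq_0_iff)
  then show ?case by simp
next
  case (Suc m)
  let ?d = "\<lambda>f x. \<Sum>j<n. f j * x j :: real"
  show ?case
  proof (cases "\<forall>x. (\<forall>i<m. ?d (a i) x \<le> 0) \<longrightarrow> ?d q x \<le> 0")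
    case True
    then obtain l where l: "\<forall>i<m. 0 \<le> l i" "\<forall>j<n. q j = (\<Sum>i<m. l i * a i j)"
      using Suc.IH[of a q] by auto
    then show ?thesis
      by (intro exI[of _ "l(m := 0)"]) (auto simp: less_Suc_eq)
  next
    case False
    then obtain x0 where x0: "\<forall>i<m. ?d (a i) x0 \<le> 0" "?d q x0 > 0" by force
    define s where "s = ?d (a m) x0"
    have s: "s > 0" using Suc.prems[of x0] x0 unfolding s_def by (force simp: less_Suc_eq)
    define a' where "a' i j = a i j - ?d (a i) x0 / s * a m j" for i j
    define q' where "q' j = q j - ?d q x0 / s * a m j" for j
    \<comment> \<open>A projected functional at x is the original one at the point where the line
      through x in direction x0 meets the hyperplane a_m x = 0.\<close>
    have proj: "(\<Sum>j<n. (f j - ?d f x0 / s * a m j) * x j) = ?d f (\<lambda>j. x j - ?d (a m) x / s * x0 j)" for f x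
    proof -
      have l: "(\<Sum>j<n. (f j - k * a m j) * x j) = ?d f x - k * ?d (a m) x" for k
        by (simp add: left_diff_distrib sum_subtractf sum_distrib_left mult.assoc)
      have r: "?d f (\<lambda>j. x j - k * x0 j) = ?d f x - k * ?d f x0" for k
        by (simp add: right_diff_distrib sum_subtractf sum_distrib_left mult.left_commute)
      show ?thesis unfolding l r by simp
    qed
    have "?d q' x \<le> 0" if "\<And>i. i < m \<Longrightarrow> ?d (a' i) x \<le> 0" for x
    proof -
      have "?d (a m) (\<lambda>j. x j - ?d (a m) x / s * x0 j) = 0"
        unfolding proj[symmetric] using s by (simp add: s_def[symmetric])
      then have "?d q (\<lambda>j. x j - ?d (a m) x / s * x0 j) \<le> 0"
        using that unfolding a'_def proj by (intro Suc.prems) (metis less_Suc_eq order_refl)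
      then show ?thesis unfolding q'_def proj .
    qed
    from Suc.IH[OF this] obtain l where l: "\<forall>i<m. 0 \<le> l i" "\<forall>j<n. q' j = (\<Sum>i<m. l i * a' i j)"
      by blast
    define lm where "lm = ?d q x0 / s - (\<Sum>i<m. l i * (?d (a i) x0 / s))"
    \<comment> \<open>\<open>x0\<close> is nonpositive on the first m rows and positive on q and on
      a_m.\<close>
    have "lm \<ge> 0"
    proof -
      have "(\<Sum>i<m. l i * (?d (a i) x0 / s)) \<le> 0"
        by (rule sum_nonpos) (use l x0 s in \<open>auto simp: mult_nonneg_nonpos divide_nonpos_pos\<close>)
      moreover have "?d q x0 / s \<ge> 0" using x0 s by simp
      ultimately show ?thesis unfolding lm_def by linarith
    qed
    moreover have "q j = (\<Sum>i<m. l i * a i j) + lm * a m j" if "j < n" for j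
    proof -
      have "q j = q' j + ?d q x0 / s * a m j" by (simp add: q'_def)
      also have "q' j = (\<Sum>i<m. l i * a i j) - (\<Sum>i<m. l i * (?d (a i) x0 / s)) * a m j"
      proof -
        define k where "k i = ?d (a i) x0 / s" for i
        show ?thesis using l(2) that unfolding a'_def k_def[symmetric]
          by (simp add: right_diff_distrib sum_subtractf sum_distrib_left sum_distrib_right mult_ac)
      qed
      finally show ?thesis by (simp add: lm_def algebra_simps)
    qed
    ultimately show ?thesis using l(1)
      by (intro exI[of _ "l(m := lm)"]) (auto simp: less_Suc_eq)
  qed
qed

section \<open>Cauchy-Schwarz inequality and size of basic solutions\<close>

lemma cauchy_schwarz_sum:
  fixes f g :: "'a \<Rightarrow> 'b :: linordered_idom"
  shows "(\<Sum>i\<in>A. f i * g i)\<^sup>2 \<le> (\<Sum>i\<in>A. (f i)\<^sup>2) * (\<Sum>i\<in>A. (g i)\<^sup>2)"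
proof -
  have "0 \<le> (\<Sum>i\<in>A. \<Sum>j\<in>A. (f i * g j - f j * g i)\<^sup>2)" by (intro sum_nonneg) simp
  also have "\<dots> = (\<Sum>i\<in>A. \<Sum>j\<in>A. (f i)\<^sup>2 * (g j)\<^sup>2 + (g i)\<^sup>2 * (f j)\<^sup>2 - 2 * ((f i * g i) * (f j * g j)))"
    by (intro sum.cong refl) (simp add: power2_eq_square algebra_simps)
  also have "\<dots> = (\<Sum>i\<in>A. \<Sum>j\<in>A. (f i)\<^sup>2 * (g j)\<^sup>2) + (\<Sum>i\<in>A. \<Sum>j\<in>A. (g i)\<^sup>2 * (f j)\<^sup>2)
      - 2 * (\<Sum>i\<in>A. \<Sum>j\<in>A. (f i * g i) * (f j * g j))"
    by (simp only: sum.distrib sum_subtractf sum_distrib_left)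
  also have "\<dots> = (\<Sum>i\<in>A. (f i)\<^sup>2) * (\<Sum>i\<in>A. (g i)\<^sup>2) + (\<Sum>i\<in>A. (g i)\<^sup>2) * (\<Sum>i\<in>A. (f i)\<^sup>2)
      - 2 * ((\<Sum>i\<in>A. f i * g i) * (\<Sum>i\<in>A. f i * g i))"
    by (simp only: sum_product)
  finally show ?thesis by (simp add: power2_eq_square mult.commute)
qed

lemma abs_sum_mult_le:
  fixes f g :: "'a \<Rightarrow> int"
  assumes "(\<Sum>i\<in>A. (f i)\<^sup>2) \<le> V" "(\<Sum>i\<in>A. (g i)\<^sup>2) \<le> V"
  shows "\<bar>\<Sum>i\<in>A. f i * g i\<bar> \<le> V"
proof -
  have "0 \<le> (\<Sum>i\<in>A. (f i)\<^sup>2)" "0 \<le> (\<Sum>i\<in>A. (g i)\<^sup>2)" by (auto intro: sum_nonneg)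
  then have "(\<Sum>i\<in>A. f i * g i)\<^sup>2 \<le> V\<^sup>2"
    using cauchy_schwarz_sum[of f g A] mult_mono[OF assms] assms unfolding power2_eq_square by linarith
  then show ?thesis using abs_le_square_iff[of "\<Sum>i\<in>A. f i * g i" V] assms(1) \<open>0 \<le> (\<Sum>i\<in>A. (f i)\<^sup>2)\<close> by simp
qed

text \<open>Ratio test of the simplex method: if w had a positive entry, moving from x along -w as
  far as nonnegativity allows would make one more coordinate vanish, against the minimality of the
  support. Applied to w and to -w, this says that the columns in the support are linearly
  independent.\<close>

lemma minimal_support_independent:
  fixes A :: "nat \<Rightarrow> nat \<Rightarrow> real" and x w :: "nat \<Rightarrow> real"
  assumes x: "\<forall>j<c. 0 \<le> x j" "\<forall>i<r. (\<Sum>j<c. A i j * x j) = b i"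
    and min: "\<And>y. \<forall>j<c. 0 \<le> y j \<Longrightarrow> \<forall>i<r. (\<Sum>j<c. A i j * y j) = b i \<Longrightarrow>
      card {j. j < c \<and> x j \<noteq> 0} \<le> card {j. j < c \<and> y j \<noteq> 0}"
    and w: "\<And>j. j < c \<Longrightarrow> x j = 0 \<Longrightarrow> w j = 0" "\<forall>i<r. (\<Sum>j<c. A i j * w j) = 0"
  shows "\<forall>j<c. w j \<le> 0"
proof (rule ccontr)
  assume "\<not> (\<forall>j<c. w j \<le> 0)"
  then have ne: "{j. j < c \<and> w j > 0} \<noteq> {}" by force
  define t where "t = Min ((\<lambda>j. x j / w j) ` {j. j < c \<and> w j > 0})"
  have "t \<in> (\<lambda>j. x j / w j) ` {j. j < c \<and> w j > 0}"
    unfolding t_def by (rule Min_in) (use ne in auto)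
  then obtain k where k: "k < c" "w k > 0" "t = x k / w k" by auto
  have t: "t \<le> x j / w j" if "j < c" "w j > 0" for j
    unfolding t_def by (rule Min_le) (use that in auto)
  have "t \<ge> 0" using k x by simp
  define y where "y j = x j - t * w j" for j
  have "y j \<ge> 0" if "j < c" for j
  proof (cases "w j > 0")
    case True
    then show ?thesis using t[OF that True] by (simp add: y_def field_simps)
  next
    case False
    then have "t * w j \<le> 0" using \<open>t \<ge> 0\<close> by (simp add: mult_nonneg_nonpos)
    then show ?thesis using x(1) that unfolding y_def by force
  qed
  moreover have "\<forall>i<r. (\<Sum>j<c. A i j * y j) = b i"
  proof (intro allI impI)
    fix i assume i: "i < r"
    have "(\<Sum>j<c. A i j * y j) = (\<Sum>j<c. A i j * x j) - t * (\<Sum>j<c. A i j * w j)"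
      by (simp add: y_def algebra_simps sum_subtractf sum_distrib_left)
    then show "(\<Sum>j<c. A i j * y j) = b i" using i x w by simp
  qed
  ultimately have "card {j. j < c \<and> x j \<noteq> 0} \<le> card {j. j < c \<and> y j \<noteq> 0}" using min by blast
  moreover have "{j. j < c \<and> y j \<noteq> 0} \<subset> {j. j < c \<and> x j \<noteq> 0}"
  proof (rule psubsetI)
    show "{j. j < c \<and> y j \<noteq> 0} \<subseteq> {j. j < c \<and> x j \<noteq> 0}" using w by (auto simp: y_def)
    have "x k \<noteq> 0" using w(1)[OF k(1)] k(2) by auto
    moreover have "y k = 0" using k by (simp add: y_def)
    ultimately show "{j. j < c \<and> y j \<noteq> 0} \<noteq> {j. j < c \<and> x j \<noteq> 0}" using k(1) by blast
  qed
  then have "card {j. j < c \<and> y j \<noteq> 0} < card {j. j < c \<and> x j \<noteq> 0}" by (intro psubset_card_mono) auto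
  ultimately show False by simp
qed

text \<open>A solution of least support uses independent columns, so the Gram matrix of these
  columns is invertible and Cramer's rule bounds the entries. Passing to the Gram matrix avoids the
  choice of a maximal set of independent rows; its entries and those of the new right-hand side are
  inner products of columns, hence at most V by Cauchy-Schwarz.\<close>

lemma small_nonneg_solution:
  fixes A :: "nat \<Rightarrow> nat \<Rightarrow> int" and b :: "nat \<Rightarrow> int" and x :: "nat \<Rightarrow> real"
  assumes x: "\<forall>j<c. 0 \<le> x j" "\<forall>i<r. (\<Sum>j<c. real_of_int (A i j) * x j) = real_of_int (b i)"
    and V: "(\<Sum>i<r. (\<Sum>j<c. (A i j)\<^sup>2) + (b i)\<^sup>2) \<le> V" "1 \<le> V"
  shows "\<exists>y. (\<forall>j<c. 0 \<le> y j) \<and> (\<forall>i<r. (\<Sum>j<c. real_of_int (A i j) * y j) = real_of_int (b i)) \<and>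
    (\<forall>j<c. y j \<le> (real c * real_of_int V) ^ c)"
proof -
  define sol where "sol y \<longleftrightarrow> (\<forall>j<c. 0 \<le> y j) \<and> (\<forall>i<r. (\<Sum>j<c. real_of_int (A i j) * y j) = real_of_int (b i))"
    for y :: "nat \<Rightarrow> real"
  define supp where "supp y = card {j. j < c \<and> y j \<noteq> 0}" for y :: "nat \<Rightarrow> real"
  have "sol x" using x by (simp add: sol_def)
  then obtain y where y: "sol y" and ymin: "\<And>z. sol z \<Longrightarrow> supp y \<le> supp z"
    using ex_has_least_nat[of sol x supp] by blast
  define S where "S = {j. j < c \<and> y j \<noteq> 0}"
  define p where "p = card S"
  have fS: "finite S" by (simp add: S_def)
  obtain e where e: "bij_betw e {..<p} S"
    using ex_bij_betw_nat_finite[OF fS] by (auto simp: p_def lessThan_atLeast0)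
  have eS: "e a \<in> S" "e a < c" if "a < p" for a
    using e that by (auto simp: bij_betw_def S_def)
  have sum_supp: "(\<Sum>j<c. f j) = (\<Sum>a<p. f (e a))" if "\<And>j. j < c \<Longrightarrow> j \<notin> S \<Longrightarrow> f j = 0" for f :: "nat \<Rightarrow> real"
  proof -
    have "(\<Sum>a<p. f (e a)) = (\<Sum>j\<in>S. f j)" by (rule sum.reindex_bij_betw[OF e])
    also have "\<dots> = (\<Sum>j<c. f j)"
      by (rule sum.mono_neutral_left) (use that in \<open>auto simp: S_def\<close>)
    finally show ?thesis by simp
  qed
  have indep: "\<forall>j<c. w j = 0" if "\<And>j. j < c \<Longrightarrow> y j = 0 \<Longrightarrow> w j = 0"
    "\<forall>i<r. (\<Sum>j<c. real_of_int (A i j) * w j) = 0" for w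
  proof -
    have "\<forall>j<c. w j \<le> 0"
      by (rule minimal_support_independent[of c y r "\<lambda>i j. real_of_int (A i j)" "\<lambda>i. real_of_int (b i)"])
        (use y ymin that in \<open>auto simp: sol_def supp_def\<close>)
    moreover have "\<forall>j<c. - w j \<le> 0"
      by (rule minimal_support_independent[of c y r "\<lambda>i j. real_of_int (A i j)" "\<lambda>i. real_of_int (b i)"])
        (use y ymin that in \<open>auto simp: sol_def supp_def sum_negf\<close>)
    ultimately show ?thesis by force
  qed
  define Q where "Q a a' = (\<Sum>i<r. A i (e a) * A i (e a'))" for a a'
  define G where "G = mat p p (\<lambda>(a, a'). Q a a')"
  have G: "G \<in> carrier_mat p p" by (simp add: G_def)
  have colV: "(\<Sum>i<r. (A i (e a))\<^sup>2) \<le> V" if "a < p" for a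
  proof -
    have "(\<Sum>i<r. (A i (e a))\<^sup>2) \<le> (\<Sum>i<r. (\<Sum>j<c. (A i j)\<^sup>2) + (b i)\<^sup>2)"
      by (intro sum_mono add_increasing2 member_le_sum) (use eS[OF that] in auto)
    then show ?thesis using V by simp
  qed
  have bV: "(\<Sum>i<r. (b i)\<^sup>2) \<le> V"
  proof -
    have "(\<Sum>i<r. (b i)\<^sup>2) \<le> (\<Sum>i<r. (\<Sum>j<c. (A i j)\<^sup>2) + (b i)\<^sup>2)"
      by (intro sum_mono) (auto intro: sum_nonneg)
    then show ?thesis using V by simp
  qed
  have QV: "\<bar>Q a a'\<bar> \<le> V" if "a < p" "a' < p" for a a'
    unfolding Q_def by (rule abs_sum_mult_le) (use colV that in auto)
  \<comment> \<open>A kernel vector v of \<open>G\<close> gives a vector w with w w = v G v = 0, so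
    v is a linear dependence between the columns of the support.\<close>
  have "det G \<noteq> 0"
  proof
    assume "det G = 0"
    then obtain v where v: "v \<in> carrier_vec p" "v \<noteq> 0\<^sub>v p" "G *\<^sub>v v = 0\<^sub>v p"
      using det_0_iff_vec_prod_zero[OF G] by blast
    have Qv: "(\<Sum>a'<p. Q a a' * v $ a') = 0" if "a < p" for a
      using arg_cong[OF v(3), of "\<lambda>u. u $ a"] that v(1)
      by (simp add: G_def scalar_prod_def lessThan_atLeast0)
    define w where "w i = (\<Sum>a<p. A i (e a) * v $ a)" for i
    have "(\<Sum>i<r. w i * w i) = (\<Sum>i<r. \<Sum>a<p. \<Sum>a'<p. v $ a * (A i (e a) * A i (e a') * v $ a'))"
      unfolding w_def sum_product by (intro sum.cong refl) (simp add: mult_ac)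
    also have "\<dots> = (\<Sum>a<p. \<Sum>i<r. \<Sum>a'<p. v $ a * (A i (e a) * A i (e a') * v $ a'))"
      by (rule sum.swap)
    also have "\<dots> = (\<Sum>a<p. v $ a * (\<Sum>a'<p. Q a a' * v $ a'))"
    proof (rule sum.cong[OF refl])
      fix a
      have "(\<Sum>i<r. \<Sum>a'<p. v $ a * (A i (e a) * A i (e a') * v $ a')) = (\<Sum>a'<p. \<Sum>i<r. v $ a * (A i (e a) * A i (e a') * v $ a'))"
        by (rule sum.swap)
      then show "(\<Sum>i<r. \<Sum>a'<p. v $ a * (A i (e a) * A i (e a') * v $ a')) = v $ a * (\<Sum>a'<p. Q a a' * v $ a')"
        by (simp add: Q_def sum_distrib_right sum_distrib_left)
    qed
    also have "\<dots> = 0" using Qv by simp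
    finally have w0: "w i = 0" if "i < r" for i
      using that by (simp add: sum_nonneg_eq_0_iff)
    define u where "u j = (if j \<in> S then real_of_int (v $ (inv_into {..<p} e j)) else 0)" for j
    have ue: "u (e a) = real_of_int (v $ a)" if "a < p" for a
      using eS[OF that] that e by (simp add: u_def bij_betw_def)
    have "(\<Sum>j<c. real_of_int (A i j) * u j) = 0" if "i < r" for i
    proof -
      have "(\<Sum>j<c. real_of_int (A i j) * u j) = (\<Sum>a<p. real_of_int (A i (e a)) * u (e a))"
        by (rule sum_supp) (simp add: u_def)
      also have "\<dots> = real_of_int (w i)" by (simp add: ue w_def)
      finally show ?thesis using w0[OF that] by simp
    qed
    then have u0: "\<forall>j<c. u j = 0" by (intro indep) (auto simp: u_def S_def)
    have "v = 0\<^sub>v p"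
      by (rule eq_vecI) (use v(1) u0 eS ue in force)+
    with v(2) show False by simp
  qed
  have bound: "y j \<le> (real c * real_of_int V) ^ c" if "j < c" for j
  proof (cases "j \<in> S")
    case False
    then show ?thesis using that V by (simp add: S_def)
  next
    case True
    then obtain a where a: "a < p" "j = e a" using e by (force simp: bij_betw_def)
    define N where "N a' b' = adj_mat G $$ (a', b')" for a' b'
    define h where "h a' = (\<Sum>i<r. A i (e a') * b i)" for a'
    have N: "mat p p (\<lambda>(i, j). N i j) = adj_mat G"
      using adj_mat(1)[OF G] by (auto intro!: eq_matI simp: N_def)
    have NQ: "(\<Sum>l<p. N a l * Q l a') = (if a = a' then det G else 0)" if "a' < p" for a'
      using is_adjugate_mult(2)[of p Q N "det G"] N a that by (auto simp: is_adjugate_def G_def)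
    have Qy: "(\<Sum>a'<p. real_of_int (Q l a') * y (e a')) = real_of_int (h l)" if "l < p" for l
    proof -
      have "(\<Sum>a'<p. real_of_int (Q l a') * y (e a')) =
          (\<Sum>i<r. real_of_int (A i (e l)) * (\<Sum>a'<p. real_of_int (A i (e a')) * y (e a')))"
        unfolding Q_def of_int_sum sum_distrib_right sum_distrib_left
        by (subst sum.swap) (simp add: mult_ac)
      also have "\<dots> = (\<Sum>i<r. real_of_int (A i (e l)) * (\<Sum>j<c. real_of_int (A i j) * y j))"
        by (subst sum_supp) (auto simp: S_def)
      also have "\<dots> = real_of_int (h l)" using y by (simp add: sol_def h_def)
      finally show ?thesis .
    qed
    \<comment> \<open>Cramer's rule: row a of the adjugate is applied to the normal
      equations.\<close>
    have "real_of_int (det G) * y j = (\<Sum>a'<p. (if a = a' then real_of_int (det G) * y (e a') else 0))"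
      using a by simp
    also have "\<dots> = (\<Sum>a'<p. real_of_int (\<Sum>l<p. N a l * Q l a') * y (e a'))"
      by (rule sum.cong) (auto simp: NQ simp del: of_int_sum)
    also have "\<dots> = (\<Sum>l<p. real_of_int (N a l) * (\<Sum>a'<p. real_of_int (Q l a') * y (e a')))"
      unfolding of_int_sum sum_distrib_right sum_distrib_left
      by (subst sum.swap) (simp add: mult_ac)
    also have "\<dots> = real_of_int (\<Sum>l<p. N a l * h l)" by (simp add: Qy)
    finally have dy: "real_of_int (det G) * y j = real_of_int (\<Sum>l<p. N a l * h l)" .
    have "\<bar>\<Sum>l<p. N a l * h l\<bar> \<le> (\<Sum>l<p. \<bar>N a l * h l\<bar>)" by (rule sum_abs)
    also have "\<dots> \<le> (\<Sum>l<p. (fact (p - 1) * V ^ (p - 1)) * V)"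
    proof (rule sum_mono)
      fix l assume "l \<in> {..<p}"
      then have l: "l < p" by simp
      have "\<bar>N a l\<bar> \<le> fact (p - 1) * V ^ (p - 1)"
        unfolding N_def by (rule adj_mat_abs_le[OF G]) (use a l QV in \<open>auto simp: G_def\<close>)
      moreover have "\<bar>h l\<bar> \<le> V" unfolding h_def
        by (rule abs_sum_mult_le) (use colV[OF l] bV in auto)
      ultimately show "\<bar>N a l * h l\<bar> \<le> (fact (p - 1) * V ^ (p - 1)) * V"
        unfolding abs_mult by (intro mult_mono) auto
    qed
    also have "\<dots> = fact p * V ^ p"
      using a by (cases p) (auto simp: algebra_simps)
    also have "\<dots> \<le> int p ^ p * V ^ p"
      using V fact_le_power[of p, where 'a=int] by (intro mult_right_mono) auto
    also have "\<dots> = (int p * V) ^ p" by (simp add: power_mult_distrib)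
    also have "\<dots> \<le> (int c * V) ^ c"
    proof -
      have pc: "p \<le> c" unfolding p_def S_def using card_mono[of "{..<c}" "{j. j < c \<and> y j \<noteq> 0}"] by auto
      have "(int p * V) ^ p \<le> (int c * V) ^ p" using pc V by (intro power_mono mult_right_mono) auto
      also have "\<dots> \<le> (int c * V) ^ c"
      proof (rule power_increasing[OF pc])
        have "1 * 1 \<le> int c * V" using a pc V by (intro mult_mono) auto
        then show "1 \<le> int c * V" by simp
      qed
      finally show ?thesis .
    qed
    finally have "real_of_int \<bar>\<Sum>l<p. N a l * h l\<bar> \<le> real_of_int ((int c * V) ^ c)"
      by (simp only: of_int_le_iff)
    then have le: "\<bar>real_of_int (\<Sum>l<p. N a l * h l)\<bar> \<le> (real c * real_of_int V) ^ c"
      by (simp only: of_int_abs of_int_mult of_int_power of_int_of_nat_eq)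
    have yj: "0 \<le> y j" using y that by (simp add: sol_def)
    have "1 * y j \<le> \<bar>real_of_int (det G)\<bar> * y j"
      by (rule mult_right_mono[OF _ yj]) (use \<open>det G \<noteq> 0\<close> in simp)
    also have "\<dots> = \<bar>real_of_int (det G) * y j\<bar>" using yj by (simp add: abs_mult)
    finally show ?thesis using le unfolding dy by simp
  qed
  then show ?thesis using y unfolding sol_def by blast
qed

section \<open>Cost bounds and weakest preconditions for programs\<close>

text \<open>A single width for all cells lets the cost of an expression be bounded from its syntax
  alone.\<close>

definition bounded :: "nat \<Rightarrow> state \<Rightarrow> bool" where
  "bounded w s \<longleftrightarrow> (\<forall>a i. \<bar>s a i\<bar> < 2 ^ w)"

lemma int_size_le_iff: "int_size z \<le> Suc k \<longleftrightarrow> \<bar>z\<bar> < 2 ^ k"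
proof -
  have "floorlog 2 (nat \<bar>z\<bar>) \<le> k \<longleftrightarrow> nat \<bar>z\<bar> < 2 ^ k"
    by (auto simp: floorlog_le_iff)
  also have "\<dots> \<longleftrightarrow> \<bar>z\<bar> < 2 ^ k"
    by (simp add: nat_less_iff)
  finally show ?thesis by (simp add: int_size_def)
qed

lemma int_size_ex: obtains k where "int_size z = Suc k" "\<bar>z\<bar> < 2 ^ k"
  using int_size_le_iff[of z "int_size z - 1"] by (auto simp: int_size_def)

lemma int_size_add: "int_size (x + y) \<le> int_size x + int_size y"
proof -
  obtain k l where k: "int_size x = Suc k" "\<bar>x\<bar> < 2 ^ k" and l: "int_size y = Suc l" "\<bar>y\<bar> < 2 ^ l"
    by (metis int_size_ex)
  have "\<bar>x + y\<bar> < 2 ^ k + 2 ^ l" using k l by linarith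
  also have "\<dots> \<le> 2 ^ (k + l) + 2 ^ (k + l)"
    by (intro add_mono power_increasing) auto
  finally show ?thesis using int_size_le_iff[of "x + y" "Suc (k + l)"] k l by simp
qed

lemma int_size_diff: "int_size (x - y) \<le> int_size x + int_size y"
  using int_size_add[of x "- y"] by (simp add: int_size_def)

lemma int_size_mult: "int_size (x * y) \<le> int_size x + int_size y"
proof -
  obtain k l where k: "int_size x = Suc k" "\<bar>x\<bar> < 2 ^ k" and l: "int_size y = Suc l" "\<bar>y\<bar> < 2 ^ l"
    by (metis int_size_ex)
  have "\<bar>x * y\<bar> < 2 ^ k * 2 ^ l" using k l unfolding abs_mult by (intro mult_strict_mono) auto
  then show ?thesis using int_size_le_iff[of "x * y" "k + l"] k l by (simp add: power_add)
qed

text \<open>\<open>div\<close> rounds down, so for a negative quotient the result can move away from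
  0; it still does not exceed |x|, and division by 0 yields 0.\<close>

lemma abs_div_le: "\<bar>x div y\<bar> \<le> \<bar>x\<bar>" for x y :: int
proof -
  have pos: "\<bar>x div y\<bar> \<le> \<bar>x\<bar>" if "y > 0" for x y :: int
  proof (cases "x \<ge> 0")
    case True
    then show ?thesis using that zdiv_mono2[of x 1 y] pos_imp_zdiv_nonneg_iff[OF that, of x] by simp
  next
    case False
    then show ?thesis using that zdiv_mono2_neg[of x 1 y] pos_imp_zdiv_nonneg_iff[OF that, of x] by simp
  qed
  consider "y > 0" | "y = 0" | "- y > 0" by linarith
  then show ?thesis using pos[of y x] pos[of "- y" "- x"] by cases (simp_all add: div_minus_minus)
qed

lemma int_size_div: "int_size (x div y) \<le> int_size x"
proof -
  obtain k where k: "int_size x = Suc k" "\<bar>x\<bar> < 2 ^ k" by (metis int_size_ex)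
  then show ?thesis using int_size_le_iff[of "x div y" k] abs_div_le[of x y] by simp
qed

section \<open>Syntactic bounds for sizes and costs\<close>

fun aexp_size :: "nat \<Rightarrow> aexp \<Rightarrow> nat" where
  "aexp_size w (Const c) = int_size c"
| "aexp_size w (Cell a e) = Suc w"
| "aexp_size w (Plus e1 e2) = aexp_size w e1 + aexp_size w e2"
| "aexp_size w (Minus e1 e2) = aexp_size w e1 + aexp_size w e2"
| "aexp_size w (Times e1 e2) = aexp_size w e1 + aexp_size w e2"
| "aexp_size w (Div e1 e2) = aexp_size w e1"

fun aexp_time :: "nat \<Rightarrow> aexp \<Rightarrow> nat" where
  "aexp_time w (Const c) = int_size c"
| "aexp_time w (Cell a e) = aexp_time w e + aexp_size w e + Suc w"
| "aexp_time w (Plus e1 e2) = aexp_time w e1 + aexp_time w e2 + aexp_size w e1 + aexp_size w e2"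
| "aexp_time w (Minus e1 e2) = aexp_time w e1 + aexp_time w e2 + aexp_size w e1 + aexp_size w e2"
| "aexp_time w (Times e1 e2) = aexp_time w e1 + aexp_time w e2 + aexp_size w e1 + aexp_size w e2"
| "aexp_time w (Div e1 e2) = aexp_time w e1 + aexp_time w e2 + aexp_size w e1 + aexp_size w e2"

fun bexp_time :: "nat \<Rightarrow> bexp \<Rightarrow> nat" where
  "bexp_time w (Less e1 e2) = aexp_time w e1 + aexp_time w e2 + aexp_size w e1 + aexp_size w e2"
| "bexp_time w (Not b) = 1 + bexp_time w b"
| "bexp_time w (And b1 b2) = 1 + bexp_time w b1 + bexp_time w b2"

text \<open>Charging every loop N rounds and a final test gives, for a fixed program, a polynomial
  in N and w whose degree grows with the nesting depth only.\<close>

fun com_time :: "nat \<Rightarrow> nat \<Rightarrow> com \<Rightarrow> nat" where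
  "com_time N w Skip = 1"
| "com_time N w (Assign a e1 e2) =
    1 + aexp_time w e1 + aexp_time w e2 + aexp_size w e1 + aexp_size w e2"
| "com_time N w (Seq c1 c2) = 1 + com_time N w c1 + com_time N w c2"
| "com_time N w (If b c1 c2) = 1 + bexp_time w b + com_time N w c1 + com_time N w c2"
| "com_time N w (While b c) = (N + 1) * (1 + bexp_time w b + com_time N w c)"

lemma int_size_aval: "bounded w s \<Longrightarrow> int_size (aval e s) \<le> aexp_size w e"
proof (induction e)
  case (Cell a e)
  then show ?case by (simp add: int_size_le_iff bounded_def)
next
  case (Plus e1 e2)
  then show ?case using int_size_add[of "aval e1 s" "aval e2 s"] by simp
next
  case (Minus e1 e2)
  then show ?case using int_size_diff[of "aval e1 s" "aval e2 s"] by simp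
next
  case (Times e1 e2)
  then show ?case using int_size_mult[of "aval e1 s" "aval e2 s"] by simp
next
  case (Div e1 e2)
  then show ?case using int_size_div[of "aval e1 s" "aval e2 s"] by simp
qed simp

lemma acost_le: "bounded w s \<Longrightarrow> acost e s \<le> aexp_time w e"
proof (induction e)
  case (Cell a e)
  then show ?case using int_size_aval[of w s e] int_size_aval[of w s "Cell a e"] by simp
next
  case (Plus e1 e2)
  then show ?case using int_size_aval[of w s e1] int_size_aval[of w s e2] by simp
next
  case (Minus e1 e2)
  then show ?case using int_size_aval[of w s e1] int_size_aval[of w s e2] by simp
next
  case (Times e1 e2)
  then show ?case using int_size_aval[of w s e1] int_size_aval[of w s e2] by simp
next
  case (Div e1 e2)
  then show ?case using int_size_aval[of w s e1] int_size_aval[of w s e2] by simp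
qed simp

lemma bcost_le: "bounded w s \<Longrightarrow> bcost b s \<le> bexp_time w b"
proof (induction b)
  case (Less e1 e2)
  then show ?case
    using int_size_aval[of w s e1] int_size_aval[of w s e2] acost_le[of w s e1] acost_le[of w s e2]
    by simp
qed simp_all

fun writes :: "com \<Rightarrow> nat set" where
  "writes Skip = {}"
| "writes (Assign a e1 e2) = {a}"
| "writes (Seq c1 c2) = writes c1 \<union> writes c2"
| "writes (If b c1 c2) = writes c1 \<union> writes c2"
| "writes (While b c) = writes c"

text \<open>Together with the syntactic write set this spares loop invariants any mention of arrays
  that the body leaves alone.\<close>

definition frame :: "nat set \<Rightarrow> state \<Rightarrow> state \<Rightarrow> bool" where
  "frame X s s' \<longleftrightarrow> (\<forall>a. a \<notin> X \<longrightarrow> s' a = s a)"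

lemma frame_refl [simp]: "frame X s s"
  by (simp add: frame_def)

lemma frame_trans: "frame X s s' \<Longrightarrow> frame Y s' s'' \<Longrightarrow> X \<union> Y \<subseteq> Z \<Longrightarrow> frame Z s s''"
  by (fastforce simp: frame_def)

lemma frame_upd: "frame X s s' \<Longrightarrow> a \<in> X \<Longrightarrow> frame X s (s'(a := f))"
  by (auto simp: frame_def)

lemma exec_frame: "exec c s t s' \<Longrightarrow> frame (writes c) s s'"
  by (induction rule: exec.induct) (auto simp: frame_def)

text \<open>Total correctness with a time bound. The width condition is assumed before and
  guaranteed after the run, so it passes through all rules and leaves a proof obligation only at
  assignments.\<close>

definition wp :: "nat \<Rightarrow> nat \<Rightarrow> com \<Rightarrow> (state \<Rightarrow> bool) \<Rightarrow> state \<Rightarrow> bool" where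
  "wp N w c Q s \<longleftrightarrow> (bounded w s \<longrightarrow>
    (\<exists>t s'. exec c s t s' \<and> t \<le> com_time N w c \<and> bounded w s' \<and> Q s'))"

lemma wp_mono: "wp N w c Q s \<Longrightarrow> (\<And>s'. frame (writes c) s s' \<Longrightarrow> Q s' \<Longrightarrow> R s') \<Longrightarrow> wp N w c R s"
  unfolding wp_def using exec_frame by blast

lemma wp_Skip: "Q s \<Longrightarrow> wp N w Skip Q s"
  unfolding wp_def using exec.Skip[of s] by force

lemma wp_Assign:
  assumes "\<bar>aval e2 s\<bar> < 2 ^ w" "Q (s(a := (s a)(aval e1 s := aval e2 s)))"
  shows "wp N w (Assign a e1 e2) Q s"
  unfolding wp_def
proof
  assume b: "bounded w s"
  then have "bounded w (s(a := (s a)(aval e1 s := aval e2 s)))"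
    using assms(1) by (auto simp: bounded_def)
  then show "\<exists>t s'. exec (Assign a e1 e2) s t s' \<and> t \<le> com_time N w (Assign a e1 e2) \<and> bounded w s' \<and> Q s'"
    using assms(2) acost_le[OF b, of e1] acost_le[OF b, of e2] int_size_aval[OF b, of e1] int_size_aval[OF b, of e2]
    by - (rule exI, rule exI, rule conjI, rule exec.Assign, auto)
qed

lemma wp_Seq: "wp N w c1 (wp N w c2 Q) s \<Longrightarrow> wp N w (Seq c1 c2) Q s"
  unfolding wp_def by (fastforce intro: exec.Seq)

lemma wp_If:
  assumes "bval b s \<Longrightarrow> wp N w c1 Q s" "\<not> bval b s \<Longrightarrow> wp N w c2 Q s"
  shows "wp N w (If b c1 c2) Q s"
  unfolding wp_def
proof
  assume b: "bounded w s"
  show "\<exists>t s'. exec (If b c1 c2) s t s' \<and> t \<le> com_time N w (If b c1 c2) \<and> bounded w s' \<and> Q s'"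
  proof (cases "bval b s")
    case True
    with assms(1) b obtain t s' where "exec c1 s t s'" "t \<le> com_time N w c1" "bounded w s'" "Q s'"
      by (auto simp: wp_def)
    then show ?thesis using bcost_le[OF b, of b] exec.IfTrue[OF True, of c1 t s' c2]
      by (intro exI[of _ "1 + bcost b s + t"] exI[of _ s']) auto
  next
    case False
    with assms(2) b obtain t s' where "exec c2 s t s'" "t \<le> com_time N w c2" "bounded w s'" "Q s'"
      by (auto simp: wp_def)
    then show ?thesis using bcost_le[OF b, of b] exec.IfFalse[OF False, of c2 t s' c1]
      by (intro exI[of _ "1 + bcost b s + t"] exI[of _ s']) auto
  qed
qed

text \<open>The invariant is indexed by the number of completed rounds, and the guard may hold only
  while this number is below N; the induction is on the rounds that are left. Step and exit may use
  the frame relative to the state before the loop.\<close>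

lemma wp_While:
  assumes init: "I (0 :: nat) s"
    and step: "\<And>k s'. frame (writes c) s s' \<Longrightarrow> I k s' \<Longrightarrow> bval b s' \<Longrightarrow> k < N \<and> wp N w c (I (Suc k)) s'"
    and post: "\<And>k s'. frame (writes c) s s' \<Longrightarrow> I k s' \<Longrightarrow> \<not> bval b s' \<Longrightarrow> Q s'"
  shows "wp N w (While b c) Q s"
  unfolding wp_def
proof
  assume "bounded w s"
  define T where "T = 1 + bexp_time w b + com_time N w c"
  have "\<exists>t s''. exec (While b c) s' t s'' \<and> t \<le> (N - k + 1) * T \<and> bounded w s'' \<and> Q s''"
    if "frame (writes c) s s'" "I k s'" "bounded w s'" for k s'
    using that
  proof (induction "N - k" arbitrary: k s' rule: less_induct)
    case less
    show ?case
    proof (cases "bval b s'")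
      case False
      have "1 + bcost b s' \<le> (N - k + 1) * T"
        using bcost_le[OF less.prems(3), of b] by (simp add: T_def)
      then show ?thesis using exec.WhileFalse[OF False] post[OF less.prems(1,2) False] less.prems(3) by blast
    next
      case True
      from step[OF less.prems(1,2) True] less.prems(3)
      obtain t1 s1 where k: "k < N" and 1: "exec c s' t1 s1" "t1 \<le> com_time N w c" "bounded w s1" "I (Suc k) s1"
        by (auto simp: wp_def)
      have "frame (writes c) s s1"
        using frame_trans[OF less.prems(1) exec_frame[OF 1(1)]] by simp
      from less.hyps[OF _ this 1(4) 1(3)] k
      obtain t2 s2 where 2: "exec (While b c) s1 t2 s2" "t2 \<le> (N - Suc k + 1) * T" "bounded w s2" "Q s2"
        using diff_less_mono2[OF lessI k] by blast
      have "N - k + 1 = Suc (N - Suc k + 1)" using k by simp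
      then have "1 + bcost b s' + t1 + t2 \<le> (N - k + 1) * T"
        using 2(2) 1(2) bcost_le[OF less.prems(3), of b] by (simp add: T_def)
      then show ?thesis using exec.WhileTrue[OF True 1(1) 2(1)] 2(3,4) by blast
    qed
  qed
  from this[OF frame_refl init \<open>bounded w s\<close>]
  show "\<exists>t s'. exec (While b c) s t s' \<and> t \<le> com_time N w (While b c) \<and> bounded w s' \<and> Q s'"
    by (simp add: T_def)
qed

abbreviation Var :: "nat \<Rightarrow> aexp" where "Var x \<equiv> Cell x (Const 0)"

abbreviation Set :: "nat \<Rightarrow> aexp \<Rightarrow> com" where "Set x e \<equiv> Assign x (Const 0) e"

definition For :: "nat \<Rightarrow> aexp \<Rightarrow> com \<Rightarrow> com" where
  "For x e c = Seq (Set x (Const 0)) (While (Less (Var x) e) (Seq c (Set x (Plus (Var x) (Const 1)))))"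

lemma writes_For [simp]: "writes (For x e c) = insert x (writes c)"
  by (auto simp: For_def)

text \<open>The bound e is evaluated anew before each round, so it has to keep its value under every
  change that the loop may make. The step establishes the invariant for the state in which the
  counter has already moved on.\<close>

lemma wp_For:
  fixes n :: nat
  assumes n: "\<And>s'. frame (insert x (writes c)) s s' \<Longrightarrow> aval e s' = int n"
    and x: "x \<notin> writes c" and nN: "n \<le> N" and nw: "n < 2 ^ w"
    and init: "I 0 (s(x := (s x)(0 := 0)))"
    and step: "\<And>k s'. k < n \<Longrightarrow> frame (insert x (writes c)) s s' \<Longrightarrow> s' x 0 = int k \<Longrightarrow> I k s' \<Longrightarrow>
      wp N w c (\<lambda>s''. I (Suc k) (s''(x := (s'' x)(0 := 1 + int k)))) s'"
    and post: "\<And>s'. frame (insert x (writes c)) s s' \<Longrightarrow> s' x 0 = int n \<Longrightarrow> I n s' \<Longrightarrow> Q s'"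
  shows "wp N w (For x e c) Q s"
  unfolding For_def
proof (rule wp_Seq, rule wp_Assign)
  let ?s = "s(x := (s x)(aval (Const 0) s := aval (Const 0) s))"
  have fr: "frame (insert x (writes c)) s s'"
    if "frame (writes (Seq c (Set x (Plus (Var x) (Const 1))))) ?s s'" for s'
    using that by (auto simp: frame_def)
  show "wp N w (While (Less (Var x) e) (Seq c (Set x (Plus (Var x) (Const 1))))) Q ?s"
  proof (rule wp_While[where I = "\<lambda>k s'. k \<le> n \<and> s' x 0 = int k \<and> I k s'"])
    show "0 \<le> n \<and> ?s x 0 = int 0 \<and> I 0 ?s" using init by simp
  next
    fix k s'
    assume f: "frame (writes (Seq c (Set x (Plus (Var x) (Const 1))))) ?s s'"
      and I: "k \<le> n \<and> s' x 0 = int k \<and> I k s'" and b: "bval (Less (Var x) e) s'"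
    have k: "k < n" using b I n[OF fr[OF f]] by simp
    have "Suc k < 2 ^ w" using k nw by linarith
    then have kw: "1 + int k < 2 ^ w"
      by (metis of_nat_Suc of_nat_less_iff of_nat_numeral of_nat_power)
    have "wp N w (Seq c (Set x (Plus (Var x) (Const 1))))
      (\<lambda>s'. Suc k \<le> n \<and> s' x 0 = int (Suc k) \<and> I (Suc k) s') s'"
    proof (rule wp_Seq, rule wp_mono[OF step[OF k fr[OF f]]])
      fix s'' assume f2: "frame (writes c) s' s''" and I2: "I (Suc k) (s''(x := (s'' x)(0 := 1 + int k)))"
      have "s'' x 0 = int k" using f2 x I by (simp add: frame_def)
      then show "wp N w (Set x (Plus (Var x) (Const 1)))
         (\<lambda>s'. Suc k \<le> n \<and> s' x 0 = int (Suc k) \<and> I (Suc k) s') s''"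
        using k kw I2 by (intro wp_Assign) (auto simp: add.commute)
    qed (use I in auto)
    then show "k < N \<and> wp N w (Seq c (Set x (Plus (Var x) (Const 1))))
      (\<lambda>s'. Suc k \<le> n \<and> s' x 0 = int (Suc k) \<and> I (Suc k) s') s'" using k nN by simp
  next
    fix k s'
    assume f: "frame (writes (Seq c (Set x (Plus (Var x) (Const 1))))) ?s s'"
      and I: "k \<le> n \<and> s' x 0 = int k \<and> I k s'" and b: "\<not> bval (Less (Var x) e) s'"
    then have "k = n" using n[OF fr[OF f]] by simp
    then show "Q s'" using post[OF fr[OF f]] I by simp
  qed
qed simp

definition Sum :: "nat \<Rightarrow> nat \<Rightarrow> aexp \<Rightarrow> aexp \<Rightarrow> com" where
  "Sum y x e1 e2 = Seq (Set y (Const 0)) (For x e1 (Set y (Plus (Var y) e2)))"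

lemma writes_Sum [simp]: "writes (Sum y x e1 e2) = {x, y}"
  by (auto simp: Sum_def)

text \<open>The accumulator holds each partial sum at some time, which is why all of them must fit
  the width.\<close>

lemma wp_Sum:
  fixes n :: nat and f :: "nat \<Rightarrow> int"
  assumes n: "\<And>s'. frame {x, y} s s' \<Longrightarrow> aval e1 s' = int n"
    and f: "\<And>k s'. k < n \<Longrightarrow> frame {x, y} s s' \<Longrightarrow> s' x 0 = int k \<Longrightarrow> aval e2 s' = f k"
    and xy: "x \<noteq> y" and nN: "n \<le> N" and nw: "n < 2 ^ w"
    and bnd: "\<And>k. k \<le> n \<Longrightarrow> \<bar>\<Sum>i<k. f i\<bar> < 2 ^ w"
    and post: "\<And>s'. frame {x, y} s s' \<Longrightarrow> s' y 0 = (\<Sum>i<n. f i) \<Longrightarrow> Q s'"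
  shows "wp N w (Sum y x e1 e2) Q s"
  unfolding Sum_def
proof (rule wp_Seq, rule wp_Assign)
  let ?s = "s(y := (s y)(aval (Const 0) s := aval (Const 0) s))"
  have fr: "frame {x, y} s s'" if "frame (insert x (writes (Set y (Plus (Var y) e2)))) ?s s'" for s'
    using that by (auto simp: frame_def)
  show "wp N w (For x e1 (Set y (Plus (Var y) e2))) Q ?s"
  proof (rule wp_For[where n = n and I = "\<lambda>k s'. s' y 0 = (\<Sum>i<k. f i)"])
    fix k s'
    assume k: "k < n" and fr': "frame (insert x (writes (Set y (Plus (Var y) e2)))) ?s s'"
      and x': "s' x 0 = int k" and I: "s' y 0 = (\<Sum>i<k. f i)"
    show "wp N w (Set y (Plus (Var y) e2)) (\<lambda>s''. (s''(x := (s'' x)(0 := 1 + int k))) y 0 = (\<Sum>i<Suc k. f i)) s'"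
      using bnd[of "Suc k"] k f[OF k fr[OF fr'] x'] I xy by (intro wp_Assign) auto
  qed (use n fr xy nN nw post in auto)
qed simp

section \<open>Polynomially bounded functions\<close>

definition poly_bounded :: "(nat \<Rightarrow> nat) \<Rightarrow> bool" where
  "poly_bounded f \<longleftrightarrow> (\<exists>p :: nat poly. \<forall>x. f x \<le> poly p x)"

lemma poly_bounded_const: "poly_bounded (\<lambda>x. c)"
  unfolding poly_bounded_def by (rule exI[of _ "[:c:]"]) simp

lemma poly_bounded_id: "poly_bounded (\<lambda>x. x)"
  unfolding poly_bounded_def by (rule exI[of _ "[:0, 1:]"]) simp

lemma poly_bounded_add: "poly_bounded f \<Longrightarrow> poly_bounded g \<Longrightarrow> poly_bounded (\<lambda>x. f x + g x)"
  unfolding poly_bounded_def by (metis add_mono poly_add)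

lemma poly_bounded_mult: "poly_bounded f \<Longrightarrow> poly_bounded g \<Longrightarrow> poly_bounded (\<lambda>x. f x * g x)"
  unfolding poly_bounded_def by (metis mult_le_mono poly_mult)

lemma poly_bounded_Suc: "poly_bounded f \<Longrightarrow> poly_bounded (\<lambda>x. Suc (f x))"
  using poly_bounded_add[OF poly_bounded_const[of 1]] by simp

lemma poly_bounded_power: "poly_bounded f \<Longrightarrow> poly_bounded (\<lambda>x. f x ^ k)"
  by (induction k) (auto intro: poly_bounded_const poly_bounded_mult)

lemmas poly_bounded_intros =
  poly_bounded_const poly_bounded_id poly_bounded_add poly_bounded_mult poly_bounded_Suc poly_bounded_power

lemma poly_bounded_aexp_size: "poly_bounded w \<Longrightarrow> poly_bounded (\<lambda>x. aexp_size (w x) e)"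
  by (induction e) (auto intro!: poly_bounded_intros)

lemma poly_bounded_aexp_time: "poly_bounded w \<Longrightarrow> poly_bounded (\<lambda>x. aexp_time (w x) e)"
  by (induction e) (auto intro!: poly_bounded_intros poly_bounded_aexp_size)

lemma poly_bounded_bexp_time: "poly_bounded w \<Longrightarrow> poly_bounded (\<lambda>x. bexp_time (w x) b)"
  by (induction b) (auto intro!: poly_bounded_intros poly_bounded_aexp_size poly_bounded_aexp_time)

lemma poly_bounded_com_time:
  "poly_bounded N \<Longrightarrow> poly_bounded w \<Longrightarrow> poly_bounded (\<lambda>x. com_time (N x) (w x) c)"
  by (induction c)
    (auto intro!: poly_bounded_intros poly_bounded_aexp_size poly_bounded_aexp_time poly_bounded_bexp_time)

text \<open>Hypothesis \<open>le\<close> makes the initial state bounded, since no input number is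
  longer than the whole input. The running time is then at most \<open>com_time\<close>, a
  polynomial in the input size because the program is fixed.\<close>

lemma poly_time_decidableI:
  assumes N: "poly_bounded N" and w: "poly_bounded w"
    and wp: "\<And>x. x \<in> I \<Longrightarrow> wp (N (input_size (enc x))) (w (input_size (enc x))) c
      (\<lambda>s. s 1 0 = (if Q x then 1 else 0)) (init_state (enc x))"
    and le: "\<And>n. n \<le> w n"
  shows "poly_time_decidable I enc Q"
proof -
  obtain p :: "nat poly" where p: "\<And>n. com_time (N n) (w n) c \<le> poly p n"
    using poly_bounded_com_time[OF N w, of c] by (auto simp: poly_bounded_def)
  have "bounded (w (input_size xs)) (init_state xs)" for xs
    unfolding bounded_def
  proof (intro allI)
    fix a i
    show "\<bar>init_state xs a i\<bar> < 2 ^ w (input_size xs)"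
    proof (cases "a = 0 \<and> 0 \<le> i \<and> i < int (length xs)")
      case True
      then have "nat i < length xs" by (simp add: nat_less_iff)
      then have "int_size (xs ! nat i) \<le> input_size xs"
        unfolding input_size_def by (intro member_le_sum_list) auto
      also have "\<dots> \<le> Suc (w (input_size xs))" using le[of "input_size xs"] by simp
      finally show ?thesis using True unfolding int_size_le_iff by (simp add: init_state_def)
    qed (auto simp: init_state_def)
  qed
  then have "\<exists>t s'. exec c (init_state (enc x)) t s' \<and> t \<le> poly p (input_size (enc x)) \<and>
      s' 1 0 = (if Q x then 1 else 0)" if "x \<in> I" for x
    using wp[OF that] p[of "input_size (enc x)"] order_trans unfolding wp_def by blast
  then show ?thesis unfolding poly_time_decidable_def by blast
qed

section \<open>Gram matrices and the perceptron step\<close>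

abbreviation dot :: "nat \<Rightarrow> (nat \<Rightarrow> 'a) \<Rightarrow> (nat \<Rightarrow> 'a) \<Rightarrow> 'a :: comm_ring_1" where
  "dot n f g \<equiv> (\<Sum>j<n. f j * g j)"

lemma sum_mult_left_cong:
  fixes x :: "nat \<Rightarrow> 'a :: comm_ring_1"
  assumes "\<And>i. i < n \<Longrightarrow> f i = c * g i"
  shows "(\<Sum>i<n. x i * f i) = c * dot n x g"
proof -
  have "(\<Sum>i<n. x i * f i) = (\<Sum>i<n. x i * (c * g i))" by (rule sum.cong) (auto simp: assms)
  then show ?thesis by (simp add: sum_distrib_left mult.left_commute)
qed

definition gram :: "(nat \<Rightarrow> nat \<Rightarrow> int) \<Rightarrow> nat \<Rightarrow> (nat \<Rightarrow> int) \<Rightarrow> nat \<Rightarrow> nat \<Rightarrow> int" where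
  "gram B M S i j = of_bool (i = j) + (\<Sum>r<M. (S r)\<^sup>2 * B r i * B r j)"

text \<open>Stated over any commutative ring, because it serves for the integer vectors of the
  program and for the real solutions with which they are compared.\<close>

lemma gram_bilinear:
  fixes x y :: "nat \<Rightarrow> 'a :: comm_ring_1"
  shows "(\<Sum>i<n. x i * (\<Sum>j<n. of_int (gram B M S i j) * y j)) =
    dot n x y + (\<Sum>r<M. of_int ((S r)\<^sup>2) * dot n (\<lambda>j. of_int (B r j)) x * dot n (\<lambda>j. of_int (B r j)) y)"
proof -
  have 1: "(\<Sum>j<n. of_int (gram B M S i j) * y j) =
      y i + (\<Sum>r<M. of_int ((S r)\<^sup>2) * of_int (B r i) * dot n (\<lambda>j. of_int (B r j)) y)" if "i < n" for i
  proof -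
    have "(\<Sum>j<n. of_int (gram B M S i j) * y j) = (\<Sum>j<n. of_bool (i = j) * y j) +
        (\<Sum>j<n. \<Sum>r<M. of_int ((S r)\<^sup>2) * of_int (B r i) * (of_int (B r j) * y j))"
      by (simp add: gram_def distrib_right sum.distrib sum_distrib_right mult.assoc)
    also have "(\<Sum>j<n. of_bool (i = j) * y j) = (\<Sum>j<n. if j = i then y j else 0)"
      by (rule sum.cong) auto
    also have "\<dots> = y i" using that by simp
    also have "(\<Sum>j<n. \<Sum>r<M. of_int ((S r)\<^sup>2) * of_int (B r i) * (of_int (B r j) * y j)) =
        (\<Sum>r<M. of_int ((S r)\<^sup>2) * of_int (B r i) * dot n (\<lambda>j. of_int (B r j)) y)"
      by (subst sum.swap) (simp add: sum_distrib_left)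
    finally show ?thesis .
  qed
  have "(\<Sum>i<n. x i * (\<Sum>j<n. of_int (gram B M S i j) * y j)) = (\<Sum>i<n. x i * y i +
      (\<Sum>r<M. of_int ((S r)\<^sup>2) * (of_int (B r i) * x i) * dot n (\<lambda>j. of_int (B r j)) y))"
  proof (rule sum.cong[OF refl])
    fix i assume "i \<in> {..<n}"
    then show "x i * (\<Sum>j<n. of_int (gram B M S i j) * y j) = x i * y i +
      (\<Sum>r<M. of_int ((S r)\<^sup>2) * (of_int (B r i) * x i) * dot n (\<lambda>j. of_int (B r j)) y)"
      by (subst 1) (auto simp only: lessThan_iff distrib_left sum_distrib_left mult_ac)
  qed
  also have "\<dots> = dot n x y + (\<Sum>r<M. \<Sum>i<n. of_int ((S r)\<^sup>2) * (of_int (B r i) * x i) * dot n (\<lambda>j. of_int (B r j)) y)"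
    unfolding sum.distrib by (subst sum.swap) simp
  also have "(\<Sum>r<M. \<Sum>i<n. of_int ((S r)\<^sup>2) * (of_int (B r i) * x i) * dot n (\<lambda>j. of_int (B r j)) y) =
      (\<Sum>r<M. of_int ((S r)\<^sup>2) * dot n (\<lambda>j. of_int (B r j)) x * dot n (\<lambda>j. of_int (B r j)) y)"
    by (simp only: sum_distrib_left[symmetric] sum_distrib_right[symmetric])
  finally show ?thesis .
qed

lemma gram_bilinear_int:
  fixes x y :: "nat \<Rightarrow> int"
  shows "(\<Sum>i<n. x i * (\<Sum>j<n. gram B M S i j * y j)) =
    dot n x y + (\<Sum>r<M. (S r)\<^sup>2 * dot n (B r) x * dot n (B r) y)"
  using gram_bilinear[where x = x and y = y and B = B and M = M and S = S and n = n] by simp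

text \<open>\<open>N\<close> is the adjugate and \<open>d\<close> the determinant, hence
  \<open>N\<close> is d times the inverse of the Gram matrix.\<close>

definition gram_inverse ::
  "(nat \<Rightarrow> nat \<Rightarrow> int) \<Rightarrow> nat \<Rightarrow> nat \<Rightarrow> (nat \<Rightarrow> int) \<Rightarrow> (nat \<Rightarrow> nat \<Rightarrow> int) \<Rightarrow> int \<Rightarrow> bool" where
  "gram_inverse B M n S N d \<longleftrightarrow> is_adjugate n (gram B M S) N d \<and> 0 < d \<and> (\<forall>i<n. \<forall>j<n. N i j = N j i)"

lemma gram_inverse_cong:
  assumes "gram_inverse B M n S N d" "\<And>i j. i < n \<Longrightarrow> j < n \<Longrightarrow> N' i j = N i j" "\<And>r. r < M \<Longrightarrow> S' r = S r"
  shows "gram_inverse B M n S' N' d"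
proof -
  have "gram B M S' i j = gram B M S i j" for i j
    using assms(3) by (simp add: gram_def)
  then show ?thesis using assms is_adjugate_cong[of n "gram B M S" N d "gram B M S'" N']
    by (simp add: gram_inverse_def)
qed

lemma gram_inverse_unit:
  assumes "\<And>r. r < M \<Longrightarrow> S r = 0"
  shows "gram_inverse B M n S (\<lambda>i j. of_bool (i = j)) 1"
proof -
  have "gram B M S i j = of_bool (i = j)" for i j using assms by (simp add: gram_def)
  then show ?thesis using is_adjugate_cong[OF is_adjugate_unit[of n], of "gram B M S"]
    by (auto simp: gram_inverse_def)
qed

context
  fixes B :: "nat \<Rightarrow> nat \<Rightarrow> int" and M n :: nat and S :: "nat \<Rightarrow> int" and N :: "nat \<Rightarrow> nat \<Rightarrow> int" and d :: int
  assumes inv: "gram_inverse B M n S N d"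
begin

lemma gram_inverse_solves:
  assumes w: "\<And>i. i < n \<Longrightarrow> w i = dot n (N i) u" and i: "i < n"
  shows "(\<Sum>j<n. gram B M S i j * w j) = d * u i"
proof -
  have "(\<Sum>j<n. gram B M S i j * w j) = (\<Sum>j<n. \<Sum>l<n. gram B M S i j * N j l * u l)"
    by (rule sum.cong) (auto simp: w sum_distrib_left mult.assoc)
  also have "\<dots> = (\<Sum>l<n. (\<Sum>j<n. gram B M S i j * N j l) * u l)"
    by (subst sum.swap) (simp add: sum_distrib_right)
  also have "\<dots> = (\<Sum>l<n. (if l = i then d * u l else 0))"
    using is_adjugate_mult(1)[of n "gram B M S" N d] inv i
    by (intro sum.cong) (auto simp: gram_inverse_def)
  also have "\<dots> = d * u i" using i by simp
  finally show ?thesis .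
qed

text \<open>Both sides are w^T Q w, computed from Q w = d u and from the bilinear formula. Dropping
  summands on the right yields the estimates for the inverse.\<close>

lemma gram_inverse_form:
  assumes w: "\<And>i. i < n \<Longrightarrow> w i = dot n (N i) u"
  shows "d * dot n u w = dot n w w + (\<Sum>r<M. (S r)\<^sup>2 * (dot n (B r) w)\<^sup>2)"
proof -
  have "(\<Sum>i<n. w i * (\<Sum>j<n. gram B M S i j * w j)) = d * dot n w u"
    by (rule sum_mult_left_cong) (rule gram_inverse_solves[OF w])
  then show ?thesis unfolding gram_bilinear_int by (simp add: power2_eq_square mult_ac)
qed

lemma gram_inverse_form_ge:
  assumes w: "\<And>i. i < n \<Longrightarrow> w i = dot n (N i) u"
  shows "dot n w w \<le> d * dot n u w" "r < M \<Longrightarrow> (S r)\<^sup>2 * (dot n (B r) w)\<^sup>2 \<le> d * dot n u w"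
    "0 \<le> dot n u w"
proof -
  have nn: "0 \<le> (\<Sum>r<M. (S r)\<^sup>2 * (dot n (B r) w)\<^sup>2)" "0 \<le> dot n w w"
    by (auto intro!: sum_nonneg)
  note form = gram_inverse_form[OF w]
  show 1: "dot n w w \<le> d * dot n u w" using form nn by linarith
  show "(S r)\<^sup>2 * (dot n (B r) w)\<^sup>2 \<le> d * dot n u w" if "r < M"
  proof -
    have "(S r)\<^sup>2 * (dot n (B r) w)\<^sup>2 \<le> (\<Sum>r<M. (S r)\<^sup>2 * (dot n (B r) w)\<^sup>2)"
      by (rule member_le_sum) (use that in auto)
    then show ?thesis using form nn by linarith
  qed
  have "0 \<le> d * dot n u w" using 1 nn by linarith
  then show "0 \<le> dot n u w" using inv by (simp add: gram_inverse_def zero_le_mult_iff)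
qed

text \<open>Q dominates the identity, so its inverse is dominated by the identity: for the j-th unit
  vector, \<open>gram_inverse_form_ge\<close> gives N_ij^2 \<le> d N_jj, used with i = j and then
  with i arbitrary. A bound for the determinant therefore bounds the whole adjugate.\<close>

lemma gram_inverse_entry_le:
  assumes ij: "i < n" "j < n"
  shows "\<bar>N i j\<bar> \<le> d"
proof -
  have d: "d > 0" using inv by (simp add: gram_inverse_def)
  let ?u = "\<lambda>l. of_bool (l = j) :: int"
  have del: "dot n f ?u = f j" for f :: "nat \<Rightarrow> int"
  proof -
    have "dot n f ?u = (\<Sum>l<n. if l = j then f l else 0)" by (rule sum.cong) auto
    then show ?thesis using ij by simp
  qed
  have le: "dot n (\<lambda>i. N i j) (\<lambda>i. N i j) \<le> d * dot n ?u (\<lambda>i. N i j)"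
    by (rule gram_inverse_form_ge(1)) (simp add: del)
  have "dot n ?u (\<lambda>i. N i j) = dot n (\<lambda>i. N i j) ?u" by (simp add: mult.commute)
  then have le: "dot n (\<lambda>i. N i j) (\<lambda>i. N i j) \<le> d * N j j" using le del by simp
  have mem: "N i j * N i j \<le> d * N j j" if "i < n" for i
  proof -
    have "N i j * N i j \<le> dot n (\<lambda>i. N i j) (\<lambda>i. N i j)"
      by (rule member_le_sum) (use that in auto)
    then show ?thesis using le by simp
  qed
  have "N j j \<le> d"
    using mem[OF ij(2)] d by (cases "N j j > 0") auto
  then have "N i j * N i j \<le> d * d"
    using mem[OF ij(1)] d mult_left_mono[of "N j j" d d] by linarith
  then show ?thesis using d abs_le_square_iff[of "N i j" d] by (simp add: power2_eq_square)
qed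

lemma gram_inverse_form_le_norm:
  assumes w: "\<And>i. i < n \<Longrightarrow> w i = dot n (N i) u"
  shows "dot n u w \<le> d * dot n u u"
proof (cases "dot n u w = 0")
  case True
  moreover have "0 \<le> dot n u u" by (rule sum_nonneg) simp
  ultimately show ?thesis using inv by (simp add: gram_inverse_def)
next
  case False
  then have pos: "dot n u w > 0" using gram_inverse_form_ge(3)[OF w] by simp
  have "dot n u w * dot n u w \<le> dot n u u * dot n w w"
    using cauchy_schwarz_sum[of u w "{..<n}"] by (simp add: power2_eq_square)
  also have "\<dots> \<le> dot n u u * (d * dot n u w)"
    by (intro mult_left_mono gram_inverse_form_ge(1)[OF w] sum_nonneg) auto
  finally have "dot n u w * dot n u w \<le> (d * dot n u u) * dot n u w" by (simp only: mult_ac)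
  then show ?thesis using pos by simp
qed

text \<open>Q dominates S_k^2 b_k b_k^T. This caps the growth of the potential in a perceptron
  step.\<close>

lemma gram_inverse_row_le:
  assumes w: "\<And>i. i < n \<Longrightarrow> w i = dot n (N i) (B k)" and k: "k < M"
  shows "(S k)\<^sup>2 * dot n (B k) w \<le> d"
proof (cases "dot n (B k) w = 0")
  case True
  then show ?thesis using inv by (simp add: gram_inverse_def)
next
  case False
  then have pos: "dot n (B k) w > 0" using gram_inverse_form_ge(3)[OF w] by simp
  have "((S k)\<^sup>2 * dot n (B k) w) * dot n (B k) w \<le> d * dot n (B k) w"
    using gram_inverse_form_ge(2)[OF w k] by (simp add: power2_eq_square mult.assoc)
  then show ?thesis using pos by simp
qed

text \<open>Replacing S_k by t multiplies the determinant by 1 + mu b_k^T Q^-1 b_k, and Q^-1 is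
  dominated by the identity; this is the source of the bound on the growth of d.\<close>

lemma gram_inverse_update:
  assumes w: "\<And>i. i < n \<Longrightarrow> w i = dot n (N i) (B k)" and k: "k < M"
    and mu: "mu = t\<^sup>2 - (S k)\<^sup>2" "0 \<le> mu" and r: "r = d + mu * dot n (B k) w"
  shows "gram_inverse B M n (S(k := t)) (\<lambda>i j. (r * N i j - mu * w i * w j) div d) r"
    and "r \<le> d * (1 + mu * dot n (B k) (B k))"
proof -
  have d: "d > 0" and sym: "\<And>i j. i < n \<Longrightarrow> j < n \<Longrightarrow> N i j = N j i"
    and adj: "is_adjugate n (gram B M S) N d"
    using inv by (auto simp: gram_inverse_def)
  have p: "0 \<le> mu * dot n (B k) w" using mu gram_inverse_form_ge(3)[OF w] by simp
  then have r0: "r > 0" using r d by simp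
  have gram_eq: "gram B M (S(k := t)) = (\<lambda>i j. gram B M S i j + mu * B k i * B k j)"
  proof (intro ext)
    fix i j
    have "(\<Sum>r<M. ((S(k := t)) r)\<^sup>2 * B r i * B r j) =
        (\<Sum>r<M. (S r)\<^sup>2 * B r i * B r j + (if r = k then mu * B k i * B k j else 0))"
      by (rule sum.cong) (auto simp: mu algebra_simps)
    also have "\<dots> = (\<Sum>r<M. (S r)\<^sup>2 * B r i * B r j) + mu * B k i * B k j"
      using k by (simp add: sum.distrib)
    finally show "gram B M (S(k := t)) i j = gram B M S i j + mu * B k i * B k j" by (simp add: gram_def)
  qed
  have "is_adjugate n (gram B M (S(k := t))) (\<lambda>i j. (r * N i j - mu * w i * w j) div d) r"
    unfolding gram_eq using is_adjugate_rank_one_update[OF adj _ sym w r] d r0 by simp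
  then show "gram_inverse B M n (S(k := t)) (\<lambda>i j. (r * N i j - mu * w i * w j) div d) r"
    using r0 sym by (auto simp: gram_inverse_def mult_ac)
  have "mu * dot n (B k) w \<le> mu * (d * dot n (B k) (B k))"
    by (rule mult_left_mono[OF gram_inverse_form_le_norm[OF w] mu(2)]) auto
  then show "r \<le> d * (1 + mu * dot n (B k) (B k))" by (simp add: r algebra_simps)
qed

end

text \<open>State of the perceptron phase: \<open>z\<close> is \<open>d\<close> times the solution of the Gram system whose right-hand
  side is the combination of the scaled rows with the weights \<open>Y\<close>, which sum up to \<open>t\<close>.\<close>

definition perceptron ::
  "(nat \<Rightarrow> nat \<Rightarrow> int) \<Rightarrow> nat \<Rightarrow> nat \<Rightarrow> (nat \<Rightarrow> int) \<Rightarrow> int \<Rightarrow> nat \<Rightarrow> (nat \<Rightarrow> int) \<Rightarrow> (nat \<Rightarrow> int) \<Rightarrow> bool" where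
  "perceptron B M n S d t Y z \<longleftrightarrow> (\<forall>i<M. 0 \<le> Y i) \<and> (\<Sum>i<M. Y i) = int t \<and>
    (\<forall>i<n. (\<Sum>j<n. gram B M S i j * z j) = d * (\<Sum>r<M. Y r * S r * B r i)) \<and>
    (\<Sum>i<n. z i * (\<Sum>r<M. Y r * S r * B r i)) \<le> d * int t"

lemma perceptron_cong:
  assumes "perceptron B M n S d t Y z" "\<And>i. i < M \<Longrightarrow> Y' i = Y i" "\<And>j. j < n \<Longrightarrow> z' j = z j"
  shows "perceptron B M n S d t Y' z'"
proof -
  have "(\<Sum>r<M. Y' r * S r * B r i) = (\<Sum>r<M. Y r * S r * B r i)" for i
    using assms by (intro sum.cong) auto
  moreover have "(\<Sum>r<M. Y' r) = (\<Sum>r<M. Y r)" using assms by (intro sum.cong) auto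
  ultimately show ?thesis using assms unfolding perceptron_def by simp
qed

lemma perceptron_init: "perceptron B M n S d 0 (\<lambda>i. 0) (\<lambda>i. 0)"
  by (simp add: perceptron_def)

text \<open>The potential is z g with g the weighted sum of the scaled rows. By symmetry of Q both
  cross terms equal S_k b_k z, which is nonpositive for a violated row; the square term is at most d
  by \<open>gram_inverse_row_le\<close>.\<close>

lemma perceptron_step:
  assumes inv: "gram_inverse B M n S N d" and per: "perceptron B M n S d t Y z"
    and w: "\<And>i. i < n \<Longrightarrow> w i = dot n (N i) (B k)" and k: "k < M" and S: "0 \<le> S k"
    and neg: "dot n (B k) z \<le> 0"
  shows "perceptron B M n S d (Suc t) (Y(k := Y k + 1)) (\<lambda>j. z j + S k * w j)"
proof -
  have d: "d > 0" using inv by (simp add: gram_inverse_def)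
  define g where "g i = (\<Sum>r<M. Y r * S r * B r i)" for i
  have g': "(\<Sum>r<M. (Y(k := Y k + 1)) r * S r * B r i) = g i + S k * B k i" for i
  proof -
    have "(\<Sum>r<M. (Y(k := Y k + 1)) r * S r * B r i) =
        (\<Sum>r<M. Y r * S r * B r i + (if r = k then S k * B k i else 0))"
      by (rule sum.cong) (auto simp: algebra_simps)
    then show ?thesis using k by (simp add: sum.distrib g_def)
  qed
  have Qw: "(\<Sum>j<n. gram B M S i j * w j) = d * B k i" if "i < n" for i
    by (rule gram_inverse_solves[OF inv w that])
  have Qz: "(\<Sum>j<n. gram B M S i j * z j) = d * g i" if "i < n" for i
    using per that by (simp add: perceptron_def g_def)
  have "d * dot n w g = (\<Sum>i<n. w i * (\<Sum>j<n. gram B M S i j * z j))"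
    by (rule sum_mult_left_cong[symmetric]) (rule Qz)
  also have "\<dots> = (\<Sum>i<n. z i * (\<Sum>j<n. gram B M S i j * w j))"
    unfolding gram_bilinear_int by (simp add: mult_ac)
  also have "\<dots> = d * dot n z (B k)"
    by (rule sum_mult_left_cong) (rule Qw)
  finally have wg: "dot n w g = dot n (B k) z" using d by (simp add: mult.commute)
  have "dot n (\<lambda>j. z j + S k * w j) (\<lambda>i. g i + S k * B k i) =
      dot n z g + S k * dot n (B k) z + S k * dot n w g + (S k)\<^sup>2 * dot n (B k) w"
    by (simp add: algebra_simps sum.distrib sum_distrib_left power2_eq_square)
  also have "\<dots> = dot n z g + 2 * (S k * dot n (B k) z) + (S k)\<^sup>2 * dot n (B k) w"
    unfolding wg by simp
  also have "\<dots> \<le> d * int t + 2 * 0 + d"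
    using gram_inverse_row_le[OF inv w k] per S neg
    by (intro add_mono mult_left_mono) (auto simp: perceptron_def g_def mult_nonneg_nonpos)
  finally have pot: "dot n (\<lambda>j. z j + S k * w j) (\<lambda>i. g i + S k * B k i) \<le> d * int (Suc t)"
    by (simp add: algebra_simps)
  have "(\<Sum>i<M. (Y(k := Y k + 1)) i) = (\<Sum>i<M. Y i + (if i = k then 1 else 0))"
    by (rule sum.cong) auto
  then have "(\<Sum>i<M. (Y(k := Y k + 1)) i) = int (Suc t)"
    using k per by (simp add: sum.distrib perceptron_def)
  moreover have "(\<Sum>j<n. gram B M S i j * (z j + S k * w j)) = d * (g i + S k * B k i)" if "i < n" for i
  proof -
    have "(\<Sum>j<n. gram B M S i j * (z j + S k * w j)) =
        (\<Sum>j<n. gram B M S i j * z j) + S k * (\<Sum>j<n. gram B M S i j * w j)"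
      by (simp add: algebra_simps sum.distrib sum_distrib_left)
    then show ?thesis unfolding Qw[OF that] Qz[OF that] by (simp add: algebra_simps)
  qed
  ultimately show ?thesis using per pot unfolding perceptron_def g' by auto
qed

text \<open>Cauchy-Schwarz for two blocks of coordinates, from the estimate for each block; the
  mixed term is handled by the inequality of arithmetic and geometric means.\<close>

lemma sum_power2_le:
  fixes a b A1 A2 B1 B2 :: real
  assumes "a\<^sup>2 \<le> A1 * B1" "b\<^sup>2 \<le> A2 * B2" "0 \<le> A1" "0 \<le> A2" "0 \<le> B1" "0 \<le> B2"
  shows "(a + b)\<^sup>2 \<le> (A1 + A2) * (B1 + B2)"
proof -
  have "(a * b)\<^sup>2 \<le> (A1 * B1) * (A2 * B2)"
    unfolding power_mult_distrib using assms by (intro mult_mono) auto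
  also have "\<dots> = (A1 * B2) * (A2 * B1)" by simp
  also have "\<dots> \<le> ((A1 * B2 + A2 * B1) / 2)\<^sup>2"
  proof -
    have "0 \<le> (A1 * B2 - A2 * B1)\<^sup>2" by simp
    then show ?thesis by (simp add: power2_eq_square algebra_simps)
  qed
  finally have "\<bar>a * b\<bar> \<le> \<bar>(A1 * B2 + A2 * B1) / 2\<bar>" by (simp only: abs_le_square_iff)
  moreover have "\<bar>(A1 * B2 + A2 * B1) / 2\<bar> = (A1 * B2 + A2 * B1) / 2"
    by (rule abs_of_nonneg) (use assms in simp)
  ultimately have "a * b \<le> (A1 * B2 + A2 * B1) / 2" by (metis abs_le_D1)
  then have "2 * (a * b) \<le> A1 * B2 + A2 * B1" by simp
  then show ?thesis using assms(1,2) by (simp add: power2_eq_square algebra_simps)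
qed

text \<open>Cauchy-Schwarz for x and z in the inner product given by Q. A solution x in the box has
  x^T Q x \<le> M + n because each S_i b_i x is at most 1, while z^T Q z \<le> d^2 t by the
  potential. Hence (x g)^2 is at most (M + n) t, although row k alone contributes at least (t / M)
  S_k b_k x to x g. The step count 4 M^2 (M + n) is what turns this into S_k b_k x \<le>
  1/2.\<close>

lemma perceptron_cut:
  fixes x :: "nat \<Rightarrow> real"
  assumes d: "0 < d" and per: "perceptron B M n S d t Y z"
    and t: "4 * M\<^sup>2 * (M + n) \<le> t" and k: "k < M" "int t \<le> Y k * int M"
    and S: "\<And>i. i < M \<Longrightarrow> 0 < S i"
    and x: "\<And>i. i < M \<Longrightarrow> 0 < dot n (\<lambda>j. real_of_int (B i j)) x"
      "\<And>i. i < M \<Longrightarrow> real_of_int (S i) * dot n (\<lambda>j. real_of_int (B i j)) x \<le> 1"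
      "\<And>j. j < n \<Longrightarrow> \<bar>x j\<bar> \<le> 1"
  shows "2 * real_of_int (S k) * dot n (\<lambda>j. real_of_int (B k j)) x \<le> 1"
proof -
  define b where "b i = dot n (\<lambda>j. real_of_int (B i j)) x" for i
  define c where "c i = real_of_int (dot n (B i) z)" for i
  define g where "g i = (\<Sum>r<M. Y r * S r * B r i)" for i
  have M: "M > 0" using k by simp
  then have t0: "t > 0" using t by (metis add_gr_0 gr0I mult_is_0 not_le power_not_zero zero_neq_numeral neq0_conv)
  have gz: "(\<Sum>j<n. gram B M S i j * z j) = d * g i" if "i < n" for i
    using per that by (simp add: perceptron_def g_def)
  have gx: "(\<Sum>i<n. x i * real_of_int (g i)) = (\<Sum>r<M. real_of_int (Y r) * (real_of_int (S r) * b r))"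
    unfolding g_def b_def of_int_sum sum_distrib_left
    by (subst sum.swap) (simp add: mult_ac)
  have "real_of_int d * (\<Sum>i<n. x i * real_of_int (g i)) = (\<Sum>i<n. x i * real_of_int (\<Sum>j<n. gram B M S i j * z j))"
    by (rule sum_mult_left_cong[symmetric]) (simp only: gz of_int_mult)
  also have "\<dots> = (\<Sum>i<n. x i * (\<Sum>j<n. of_int (gram B M S i j) * real_of_int (z j)))" by simp
  also have "\<dots> = dot n x (\<lambda>j. real_of_int (z j)) +
      (\<Sum>r<M. (real_of_int (S r) * b r) * (real_of_int (S r) * c r))"
    unfolding gram_bilinear by (simp add: b_def c_def power2_eq_square mult_ac)
  finally have dgx: "real_of_int d * (\<Sum>i<n. x i * real_of_int (g i)) = dot n x (\<lambda>j. real_of_int (z j)) +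
      (\<Sum>r<M. (real_of_int (S r) * b r) * (real_of_int (S r) * c r))" .
  have "(\<Sum>i<n. z i * (\<Sum>j<n. gram B M S i j * z j)) = d * (\<Sum>i<n. z i * g i)"
    by (rule sum_mult_left_cong) (rule gz)
  also have "\<dots> \<le> d * (d * int t)"
    by (rule mult_left_mono) (use per d in \<open>auto simp: perceptron_def g_def\<close>)
  finally have "real_of_int (dot n z z + (\<Sum>r<M. (S r)\<^sup>2 * dot n (B r) z * dot n (B r) z)) \<le>
      real_of_int (d * (d * int t))"
    unfolding gram_bilinear_int by (simp only: of_int_le_iff)
  then have zz: "(\<Sum>j<n. (real_of_int (z j))\<^sup>2) + (\<Sum>r<M. (real_of_int (S r) * c r)\<^sup>2) \<le> (real_of_int d)\<^sup>2 * real t"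
    by (simp add: c_def power2_eq_square mult_ac)
  have sb: "0 < real_of_int (S r) * b r" "real_of_int (S r) * b r \<le> 1" if "r < M" for r
    using S[OF that] x(1,2)[OF that] by (auto simp: b_def)
  have "(\<Sum>j<n. (x j)\<^sup>2) \<le> (\<Sum>j<n. 1)"
    by (rule sum_mono) (use x(3) in \<open>auto simp: abs_square_le_1\<close>)
  moreover have "(\<Sum>r<M. (real_of_int (S r) * b r)\<^sup>2) \<le> (\<Sum>r<M. 1)"
  proof (rule sum_mono)
    fix r assume "r \<in> {..<M}"
    then show "(real_of_int (S r) * b r)\<^sup>2 \<le> 1"
      using sb[of r] by (subst abs_square_le_1) auto
  qed
  ultimately have xx: "(\<Sum>j<n. (x j)\<^sup>2) + (\<Sum>r<M. (real_of_int (S r) * b r)\<^sup>2) \<le> real (M + n)" by simp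
  \<comment> \<open>The two blocks are the coordinates of the vectors and the values of the scaled
    rows on them.\<close>
  have "(real_of_int d * (\<Sum>i<n. x i * real_of_int (g i)))\<^sup>2 \<le>
      ((\<Sum>j<n. (x j)\<^sup>2) + (\<Sum>r<M. (real_of_int (S r) * b r)\<^sup>2)) *
      ((\<Sum>j<n. (real_of_int (z j))\<^sup>2) + (\<Sum>r<M. (real_of_int (S r) * c r)\<^sup>2))"
    unfolding dgx by (rule sum_power2_le) (auto intro!: sum_nonneg cauchy_schwarz_sum)
  also have "\<dots> \<le> real (M + n) * ((real_of_int d)\<^sup>2 * real t)"
    using xx zz by (intro mult_mono) (auto intro!: add_nonneg_nonneg sum_nonneg)
  finally have "(real_of_int d)\<^sup>2 * (\<Sum>i<n. x i * real_of_int (g i))\<^sup>2 \<le> (real_of_int d)\<^sup>2 * (real (M + n) * real t)"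
    by (simp only: power_mult_distrib mult_ac)
  then have g2: "(\<Sum>i<n. x i * real_of_int (g i))\<^sup>2 \<le> real (M + n) * real t"
    using d by simp
  have "real_of_int (Y k) * (real_of_int (S k) * b k) \<le> (\<Sum>i<n. x i * real_of_int (g i))"
    unfolding gx by (rule member_le_sum) (use k per sb in \<open>auto simp: perceptron_def less_imp_le\<close>)
  moreover have "real t \<le> real_of_int (Y k) * real M"
    using k(2) by (metis of_int_le_iff of_int_mult of_int_of_nat_eq)
  then have "real t * (real_of_int (S k) * b k) \<le> (real_of_int (Y k) * real M) * (real_of_int (S k) * b k)"
    using sb[OF k(1)] by (intro mult_right_mono) auto
  ultimately have le: "real t * (real_of_int (S k) * b k) \<le> real M * (\<Sum>i<n. x i * real_of_int (g i))"
    using mult_left_mono[of "real_of_int (Y k) * (real_of_int (S k) * b k)" "\<Sum>i<n. x i * real_of_int (g i)" "real M"]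
    by (simp add: mult_ac)
  have "(real t * (real_of_int (S k) * b k))\<^sup>2 \<le> (real M * (\<Sum>i<n. x i * real_of_int (g i)))\<^sup>2"
    by (rule power_mono[OF le]) (use sb[OF k(1)] in auto)
  also have "\<dots> \<le> (real M)\<^sup>2 * (real (M + n) * real t)"
    unfolding power_mult_distrib by (rule mult_left_mono[OF g2]) simp
  finally have le4: "(real t * (real_of_int (S k) * b k))\<^sup>2 \<le> (real M)\<^sup>2 * (real (M + n) * real t)" .
  have "real t * (4 * (real t * (real_of_int (S k) * b k)\<^sup>2)) = 4 * (real t * (real_of_int (S k) * b k))\<^sup>2"
    by (simp add: power2_eq_square)
  also have "\<dots> \<le> 4 * ((real M)\<^sup>2 * (real (M + n) * real t))" using le4 by simp
  also have "\<dots> = real t * real (4 * M\<^sup>2 * (M + n))" by simp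
  finally have "real t * (4 * (real t * (real_of_int (S k) * b k)\<^sup>2)) \<le> real t * real (4 * M\<^sup>2 * (M + n))" .
  then have "4 * (real t * (real_of_int (S k) * b k)\<^sup>2) \<le> real (4 * M\<^sup>2 * (M + n))"
    using t0 by (simp only: mult_le_cancel_left_pos of_nat_0_less_iff)
  also have "\<dots> \<le> real t" using t by (simp only: of_nat_le_iff)
  finally have "real t * (4 * (real_of_int (S k) * b k)\<^sup>2) \<le> real t * 1" by (simp add: mult_ac)
  then have "4 * (real_of_int (S k) * b k)\<^sup>2 \<le> 1"
    using t0 by (simp only: mult_le_cancel_left_pos of_nat_0_less_iff)
  then have "(2 * real_of_int (S k) * b k)\<^sup>2 \<le> 1" by (simp add: power_mult_distrib power2_eq_square mult_ac)
  then show ?thesis unfolding b_def[symmetric] abs_square_le_1 by linarith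
qed

text \<open>The weights sum up to t, so one of the M rows reaches the average.\<close>

lemma perceptron_heavy_weight:
  assumes "perceptron B M n S d t Y z" and "M > 0"
  shows "\<exists>k<M. int t \<le> Y k * int M"
proof (rule ccontr)
  assume "\<not> ?thesis"
  then have "(\<Sum>k<M. Y k * int M) < (\<Sum>k<M. int t)"
    using assms(2) by (intro sum_strict_mono) auto
  then show False using assms(1) by (simp add: perceptron_def sum_distrib_right[symmetric])
qed

section \<open>The scaling algorithm as a program\<close>

abbreviation seq (infixr ";;" 60) where "c1 ;; c2 \<equiv> Seq c1 c2"

text \<open>Rule for loops whose round k writes cell k of one array; the function g of final values
  determines the invariant.\<close>

lemma wp_Fill:
  fixes n :: nat
  assumes n: "\<And>s'. frame (insert x (writes c)) s s' \<Longrightarrow> aval e s' = int n"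
    and x: "x \<notin> writes c" "a \<noteq> x" and nN: "n \<le> N" and nw: "n < 2 ^ w"
    and step: "\<And>k s'. k < n \<Longrightarrow> frame (insert x (writes c)) s s' \<Longrightarrow> s' x 0 = int k \<Longrightarrow>
      (\<And>y. s' a y = (if 0 \<le> y \<and> y < int k then g (nat y) else s a y)) \<Longrightarrow>
      wp N w c (\<lambda>s''. s'' a = (s' a)(int k := g k)) s'"
    and post: "\<And>s'. frame (insert x (writes c)) s s' \<Longrightarrow>
      (\<And>y. s' a y = (if 0 \<le> y \<and> y < int n then g (nat y) else s a y)) \<Longrightarrow> Q s'"
  shows "wp N w (For x e c) Q s"
proof (rule wp_For[where n = n and I = "\<lambda>k s'. \<forall>y. s' a y = (if 0 \<le> y \<and> y < int k then g (nat y) else s a y)"])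
  fix k s'
  assume k: "k < n" and f: "frame (insert x (writes c)) s s'" "s' x 0 = int k"
    and I: "\<forall>y. s' a y = (if 0 \<le> y \<and> y < int k then g (nat y) else s a y)"
  show "wp N w c (\<lambda>s''. \<forall>y. (s''(x := (s'' x)(0 := 1 + int k))) a y =
      (if 0 \<le> y \<and> y < int (Suc k) then g (nat y) else s a y)) s'"
    by (rule wp_mono[OF step[OF k f]]) (use I x in auto)
qed (use n x nN nw post in auto)

definition entry :: "nat \<Rightarrow> (int \<Rightarrow> int) \<Rightarrow> nat \<Rightarrow> nat \<Rightarrow> int" where
  "entry n f i j = f (int i * int n + int j)"

definition cell :: "(int \<Rightarrow> int) \<Rightarrow> nat \<Rightarrow> int" where
  "cell f i = f (int i)"

lemma int_mult_add_lt: "i < m \<Longrightarrow> j < n \<Longrightarrow> int i * int n + int j < int (m * n)" for i j m n :: nat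
proof -
  assume "i < m" "j < n"
  then have "i * n + j < Suc i * n" "Suc i * n \<le> m * n" by (simp, intro mult_right_mono) auto
  then have "i * n + j < m * n" by linarith
  then show ?thesis by (metis of_nat_add of_nat_less_iff of_nat_mult)
qed

lemma entry_Fill:
  assumes "\<And>y. f y = (if 0 \<le> y \<and> y < int (m * n) then g (nat y) else f0 y)" "i < m" "j < n"
  shows "entry n f i j = g (i * n + j)"
  using int_mult_add_lt[OF assms(2,3)] unfolding entry_def
  by (simp add: assms(1) nat_add_distrib nat_mult_distrib)

lemma idx_div_mod: "j < n \<Longrightarrow> (i * n + j) div n = i" "j < n \<Longrightarrow> (i * n + j) mod n = j" for i j n :: nat
  by auto

text \<open>Names starting with \<open>v\<close> are scalars, kept in cell 0 of their array; names
  starting with \<open>a\<close> are proper arrays. \<open>vFlag\<close> is array 1, so the flag is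
  at the same time the answer of the program.\<close>

abbreviation (input) "vFlag \<equiv> 1 :: nat"
abbreviation (input) "aB \<equiv> 2 :: nat"
abbreviation (input) "aN \<equiv> 4 :: nat"
abbreviation (input) "aS \<equiv> 5 :: nat"
abbreviation (input) "aW \<equiv> 6 :: nat"
abbreviation (input) "aZ \<equiv> 7 :: nat"
abbreviation (input) "aY \<equiv> 8 :: nat"
abbreviation (input) "vM \<equiv> 9 :: nat"
abbreviation (input) "vn \<equiv> 10 :: nat"
abbreviation (input) "vd \<equiv> 11 :: nat"
abbreviation (input) "vmu \<equiv> 12 :: nat"
abbreviation (input) "vk \<equiv> 13 :: nat"
abbreviation (input) "vi \<equiv> 14 :: nat"
abbreviation (input) "vj \<equiv> 15 :: nat"
abbreviation (input) "vacc \<equiv> 16 :: nat"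
abbreviation (input) "vrho \<equiv> 17 :: nat"
abbreviation (input) "vidx \<equiv> 18 :: nat"
abbreviation (input) "vo \<equiv> 19 :: nat"
abbreviation (input) "vp \<equiv> 20 :: nat"
abbreviation (input) "vT \<equiv> 21 :: nat"
abbreviation (input) "vR \<equiv> 22 :: nat"

definition matvec :: com where
  "matvec = For vi (Var vn)
    (Sum vacc vj (Var vn)
      (Times (Cell aN (Plus (Times (Var vi) (Var vn)) (Var vj))) (Cell aB (Plus (Times (Var vk) (Var vn)) (Var vj)))) ;;
     Assign aW (Var vi) (Var vacc))"

text \<open>\<open>matvec\<close> first stores N b_k in \<open>aW\<close>. The loop runs over the
  flat index and recovers row and column by division; the old determinant is its divisor, so
  \<open>vd\<close> is replaced last.\<close>

definition rank_one :: com where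
  "rank_one = matvec ;;
    Sum vacc vj (Var vn) (Times (Cell aB (Plus (Times (Var vk) (Var vn)) (Var vj))) (Cell aW (Var vj))) ;;
    Set vrho (Plus (Var vd) (Times (Var vmu) (Var vacc))) ;;
    For vi (Times (Var vn) (Var vn))
      (Assign aN (Var vi) (Div (Minus (Times (Var vrho) (Cell aN (Var vi)))
        (Times (Times (Var vmu) (Cell aW (Div (Var vi) (Var vn))))
          (Cell aW (Minus (Var vi) (Times (Div (Var vi) (Var vn)) (Var vn)))))) (Var vd))) ;;
    Set vd (Var vrho)"

text \<open>For S = 0 the Gram matrix is the identity, which is its own adjugate; the factors are
  then raised from 0 to 1 one after the other, each by a rank-one update with mu = 1.\<close>

definition init_core :: com where
  "init_core = For vi (Var vn) (Assign aN (Plus (Times (Var vi) (Var vn)) (Var vi)) (Const 1)) ;;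
    Set vd (Const 1) ;; Set vmu (Const 1) ;;
    For vk (Var vM) (rank_one ;; Assign aS (Var vk) (Const 1))"

text \<open>Over the integers \<open>vacc\<close> < 1 means b_i z \<le> 0. The last such row is
  taken, and \<open>vidx\<close> = -1 signals that there is none, so that z is a solution.\<close>

definition perc_step :: com where
  "perc_step = Set vidx (Const (-1)) ;;
    For vi (Var vM)
      (Sum vacc vj (Var vn) (Times (Cell aB (Plus (Times (Var vi) (Var vn)) (Var vj))) (Cell aZ (Var vj))) ;;
       If (Less (Var vacc) (Const 1)) (Set vidx (Var vi)) Skip) ;;
    If (Less (Var vidx) (Const 0)) (Set vFlag (Const 1))
      (Set vk (Var vidx) ;; matvec ;;
       For vj (Var vn) (Assign aZ (Var vj) (Plus (Cell aZ (Var vj)) (Times (Cell aS (Var vk)) (Cell aW (Var vj))))) ;;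
       Assign aY (Var vk) (Plus (Cell aY (Var vk)) (Const 1)))"

text \<open>Doubling S_k raises the coefficient of b_k b_k^T by (2 S_k)^2 - S_k^2 = 3 S_k^2, the
  value given to \<open>vmu\<close>.\<close>

definition rescale :: com where
  "rescale =
    For vi (Var vM) (If (Less (Times (Cell aY (Var vi)) (Var vM)) (Var vT)) Skip (Set vk (Var vi))) ;;
    Set vmu (Times (Const 3) (Times (Cell aS (Var vk)) (Cell aS (Var vk)))) ;;
    rank_one ;;
    Assign aS (Var vk) (Times (Const 2) (Cell aS (Var vk)))"

text \<open>Once the flag is set, all remaining rounds are idle. This keeps the number of rounds of
  every loop known in advance.\<close>

definition outer_step :: com where
  "outer_step = If (Less (Var vFlag) (Const 1))
    (For vj (Var vn) (Assign aZ (Var vj) (Const 0)) ;;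
     For vi (Var vM) (Assign aY (Var vi) (Const 0)) ;;
     For vp (Var vT) (If (Less (Var vFlag) (Const 1)) perc_step Skip) ;;
     If (Less (Var vFlag) (Const 1)) rescale Skip)
    Skip"

definition core :: com where
  "core = init_core ;; For vo (Var vR) outer_step"

lemma writes_matvec [simp]: "writes matvec = {vi, vj, vacc, aW}"
  by (auto simp: matvec_def)

lemma writes_rank_one [simp]: "writes rank_one = {vi, vj, vacc, aW, vrho, aN, vd}"
  by (auto simp: rank_one_def)

lemma writes_init_core [simp]: "writes init_core = {vi, vj, vacc, aW, vrho, aN, vd, vmu, vk, aS}"
  by (auto simp: init_core_def)

lemma writes_perc_step [simp]: "writes perc_step = {vi, vj, vacc, aW, vidx, vFlag, vk, aZ, aY}"
  by (auto simp: perc_step_def)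

lemma writes_rescale [simp]: "writes rescale = {vi, vj, vacc, aW, vrho, aN, vd, vmu, vk, aS}"
  by (auto simp: rescale_def)

lemma writes_outer_step [simp]: "writes outer_step =
    {vi, vj, vacc, aW, vrho, aN, vd, vmu, vk, aS, vidx, vFlag, aZ, aY, vp}"
  by (auto simp: outer_step_def)

section \<open>Correctness and number sizes of the scaling program\<close>

lemma wp_matvec:
  assumes "s vn 0 = int n" "s vk 0 = int k" "n \<le> N" "n < 2 ^ w"
    and bnd: "\<And>i m. i < n \<Longrightarrow> m \<le> n \<Longrightarrow> \<bar>\<Sum>j<m. entry n (s aN) i j * entry n (s aB) k j\<bar> < 2 ^ w"
    and post: "\<And>s'. frame {vi, vj, vacc, aW} s s' \<Longrightarrow>
      (\<And>i. i < n \<Longrightarrow> cell (s' aW) i = dot n (entry n (s aN) i) (entry n (s aB) k)) \<Longrightarrow> Q s'"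
  shows "wp N w matvec Q s"
  unfolding matvec_def
proof (rule wp_Fill[where n = n and a = aW and g = "\<lambda>i. dot n (entry n (s aN) i) (entry n (s aB) k)"], goal_cases)
  case (6 i s')
  let ?f = "\<lambda>j. entry n (s aN) i j * entry n (s aB) k j"
  have fr: "s' vn = s vn" "s' vk = s vk" "s' aN = s aN" "s' aB = s aB"
    using 6(2) by (auto simp: frame_def)
  show ?case
    by (rule wp_Seq, rule wp_Sum[where n = n and f = ?f])
      (use 6 assms fr bnd[of i] in \<open>auto simp: frame_def entry_def intro!: wp_Assign\<close>)
next
  case (7 s')
  have "frame {vi, vj, vacc, aW} s s'" using 7(1) by (auto simp: frame_def)
  moreover have "cell (s' aW) i = dot n (entry n (s aN) i) (entry n (s aB) k)" if "i < n" for i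
    using 7(2)[of "int i"] that by (simp add: cell_def)
  ultimately show ?case using post by blast
qed (use assms in \<open>auto simp: frame_def\<close>)

lemma abs_sum_prod_le:
  fixes f g :: "nat \<Rightarrow> int"
  assumes "\<And>j. j < m \<Longrightarrow> \<bar>f j\<bar> \<le> F" "\<And>j. j < m \<Longrightarrow> \<bar>g j\<bar> \<le> G" "m \<le> n" "0 \<le> F" "0 \<le> G"
  shows "\<bar>\<Sum>j<m. f j * g j\<bar> \<le> int n * (F * G)"
proof -
  have "\<bar>\<Sum>j<m. f j * g j\<bar> \<le> (\<Sum>j<m. \<bar>f j * g j\<bar>)" by (rule sum_abs)
  also have "\<dots> \<le> (\<Sum>j<m. F * G)"
    unfolding abs_mult by (intro sum_mono mult_mono) (use assms in auto)
  also have "\<dots> \<le> int n * (F * G)" using assms by (simp add: mult_right_mono)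
  finally show ?thesis .
qed

lemma idx_eq_iff:
  fixes i j i' j' n :: nat
  assumes "j < n" "j' < n"
  shows "int i * int n + int j = int i' * int n + int j' \<longleftrightarrow> i = i' \<and> j = j'"
proof
  assume "int i * int n + int j = int i' * int n + int j'"
  then have "i * n + j = i' * n + j'" by (metis of_nat_add of_nat_eq_iff of_nat_mult)
  then show "i = i' \<and> j = j'" using assms idx_div_mod by metis
qed auto

lemma power_prod_mono:
  fixes x y :: int
  assumes "1 \<le> x" "1 \<le> y" "a \<le> m" "b \<le> n"
  shows "x ^ a * y ^ b \<le> x ^ m * y ^ n"
  by (intro mult_mono power_increasing assms) (use assms in auto)

text \<open>\<open>U\<close> bounds the entries of B, \<open>T\<close> counts perceptron steps,
  \<open>R\<close> counts rounds. \<open>D\<close> bounds the determinant: each of the M initial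
  updates contributes a factor of at most 1 + n U^2, each of the R rescalings one of at most 1 + 3
  4^R n U^2, because the factors stay below 2^R. Condition \<open>W\<close> leaves room for inner
  products of a row with z: each step adds at most 2^R n U D to an entry of z, and the inner product
  costs a further factor n U.\<close>

locale core_params =
  fixes B :: "nat \<Rightarrow> nat \<Rightarrow> int" and M n T R N w :: nat and U D :: int
  assumes n1: "1 \<le> n" and M1: "1 \<le> M" and U1: "1 \<le> U"
    and BU: "\<And>i j. i < M \<Longrightarrow> j < n \<Longrightarrow> \<bar>B i j\<bar> \<le> U"
    and T: "4 * M\<^sup>2 * (M + n) \<le> T"
    and MN: "M \<le> N" and TN: "T \<le> N" and RN: "R \<le> N" and nnN: "n * n \<le> N" and Nw: "N < 2 ^ w"
    and D: "(1 + int n * U\<^sup>2) ^ M * (1 + 3 * 4 ^ R * (int n * U\<^sup>2)) ^ R \<le> D"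
    and W: "(int T + 1) * (2 ^ R * (int n * U * D)) * (int n * U) < 2 ^ w"
begin

definition static :: "state \<Rightarrow> bool" where
  "static s \<longleftrightarrow> s vM 0 = int M \<and> s vn 0 = int n \<and> s vT 0 = int T \<and> s vR 0 = int R \<and>
    (\<forall>i<M. \<forall>j<n. entry n (s aB) i j = B i j)"

definition feas :: bool where
  "feas \<longleftrightarrow> (\<exists>x::nat \<Rightarrow> real. \<forall>i<M. 0 < dot n (\<lambda>j. real_of_int (B i j)) x)"

text \<open>The upper bound 1 on the rows makes the cuts valid for the initial scaling factors,
  which are all 1.\<close>

definition box :: "(nat \<Rightarrow> real) \<Rightarrow> bool" where
  "box x \<longleftrightarrow> (\<forall>i<M. 0 < dot n (\<lambda>j. real_of_int (B i j)) x \<and> dot n (\<lambda>j. real_of_int (B i j)) x \<le> 1) \<and>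
    (\<forall>j<n. \<bar>x j\<bar> \<le> 1)"

lemma static_frame: "static s \<Longrightarrow> frame X s s' \<Longrightarrow> {vM, vn, vT, vR, aB} \<inter> X = {} \<Longrightarrow> static s'"
  by (auto simp: static_def frame_def)

definition "F1 = 1 + int n * U\<^sup>2"
definition "F2 = 1 + 3 * 4 ^ R * (int n * U\<^sup>2)"
definition "Zb = 2 ^ R * (int n * U * D)"

lemma nU1: "1 \<le> int n * U"
  using mult_mono[of 1 "int n" 1 U] n1 U1 by simp

lemma nU2: "1 \<le> int n * U\<^sup>2"
  using mult_mono[of 1 "int n" 1 "U\<^sup>2"] n1 U1 by simp

lemma F12: "1 \<le> F1" "1 \<le> F2"
proof -
  have "0 \<le> int n * U\<^sup>2" using nU2 by simp
  then show "1 \<le> F1" "1 \<le> F2" by (simp_all add: F1_def F2_def)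
qed

lemma Dle: "a \<le> M \<Longrightarrow> b \<le> R \<Longrightarrow> F1 ^ a * F2 ^ b \<le> D"
  using power_prod_mono[OF F12] D unfolding F1_def[symmetric] F2_def[symmetric] by (rule order_trans)

lemma D1: "1 \<le> D"
  using Dle[of 0 0] by simp

lemma nUD: "1 \<le> int n * U * D"
  using mult_mono[of 1 "int n * U" 1 D] nU1 D1 by simp

lemma Zb_ge: "int n * U * D \<le> Zb"
  using nUD mult_right_mono[of 1 "2 ^ R" "int n * U * D"] by (simp add: Zb_def)

lemma Zb0: "0 \<le> Zb" and ZbU0: "0 \<le> Zb * (int n * U)"
proof -
  show "0 \<le> Zb" using Zb_ge nUD by linarith
  moreover have "0 \<le> int n * U" using nU1 by linarith
  ultimately show "0 \<le> Zb * (int n * U)" by (rule mult_nonneg_nonneg)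
qed

lemma tZ_less: "t \<le> T + 1 \<Longrightarrow> int t * Zb * (int n * U) < 2 ^ w"
proof -
  assume "t \<le> T + 1"
  then have "int t * (Zb * (int n * U)) \<le> (int T + 1) * (Zb * (int n * U))"
    by (intro mult_right_mono ZbU0) simp
  then show ?thesis using W unfolding Zb_def[symmetric] by (simp only: mult.assoc)
qed

lemma tZ_less': "t \<le> T + 1 \<Longrightarrow> int t * Zb < 2 ^ w"
proof -
  assume t: "t \<le> T + 1"
  have "int t * Zb * 1 \<le> int t * Zb * (int n * U)"
    by (rule mult_left_mono[OF nU1]) (intro mult_nonneg_nonneg Zb0, simp)
  then show ?thesis using tZ_less[OF t] by linarith
qed

lemma nUD_less: "int n * U * D * (int n * U) < 2 ^ w"
proof -
  have "int n * U * D * (int n * U) \<le> Zb * (int n * U)"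
    by (rule mult_right_mono[OF Zb_ge]) (use nU1 in linarith)
  then show ?thesis using tZ_less[of 1] by simp
qed

lemma nUD_less': "int n * U * D < 2 ^ w"
  using tZ_less'[of 1] Zb_ge by simp

lemma D_less: "D < 2 ^ w"
proof -
  have "1 * D \<le> int n * U * D" by (rule mult_right_mono[OF nU1]) (use D1 in auto)
  then show ?thesis using nUD_less' by simp
qed

lemma n_less: "n < 2 ^ w" "n \<le> N" "M < 2 ^ w" "T < 2 ^ w" "R < 2 ^ w" "n * n < 2 ^ w"
proof -
  have "n * 1 \<le> n * n" using n1 by (intro mult_left_mono) auto
  then show "n \<le> N" using nnN by linarith
  then show "n < 2 ^ w" using Nw by simp
qed (use MN TN RN nnN Nw in auto)

lemma int_less: "x \<le> N \<Longrightarrow> int x < 2 ^ w"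
proof -
  assume "x \<le> N"
  then have "int x < int (2 ^ w)" using Nw by (simp only: of_nat_less_iff)
  then show ?thesis by simp
qed

lemma dot_BB: "k < M \<Longrightarrow> dot n (B k) (B k) \<le> int n * U\<^sup>2" "0 \<le> dot n (B k) (B k)"
proof -
  assume "k < M"
  then have "\<bar>dot n (B k) (B k)\<bar> \<le> int n * (U * U)"
    by (intro abs_sum_prod_le) (use BU U1 in auto)
  then show "dot n (B k) (B k) \<le> int n * U\<^sup>2" by (simp add: power2_eq_square)
qed (auto intro: sum_nonneg)

lemma row_bound:
  assumes "gram_inverse B M n S Ni d" "d \<le> D" "i < n" "k < M" "m \<le> n"
  shows "\<bar>\<Sum>j<m. Ni i j * B k j\<bar> \<le> int n * U * D"
proof -
  have "\<bar>\<Sum>j<m. Ni i j * B k j\<bar> \<le> int n * (D * U)"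
  proof (rule abs_sum_prod_le)
    show "\<bar>Ni i j\<bar> \<le> D" if "j < m" for j
      using gram_inverse_entry_le[OF assms(1), of i j] assms(2-5) that by linarith
  qed (use assms BU U1 D1 in auto)
  then show ?thesis by (simp add: mult_ac)
qed

lemma wp_matvec_row:
  assumes st: "static s" and k: "k < M" "s vk 0 = int k"
    and inv: "gram_inverse B M n S (entry n (s aN)) d" and d: "d \<le> D"
    and post: "\<And>s'. frame {vi, vj, vacc, aW} s s' \<Longrightarrow>
      (\<And>i. i < n \<Longrightarrow> cell (s' aW) i = dot n (entry n (s aN) i) (B k)) \<Longrightarrow>
      (\<And>i. i < n \<Longrightarrow> \<bar>cell (s' aW) i\<bar> \<le> int n * U * D) \<Longrightarrow> Q s'"
  shows "wp N w matvec Q s"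
proof (rule wp_matvec[where n = n and k = k])
  have eq: "(\<Sum>j<m. entry n (s aN) i j * entry n (s aB) k j) = (\<Sum>j<m. entry n (s aN) i j * B k j)"
    if "m \<le> n" for i m
    by (rule sum.cong) (use that st k in \<open>auto simp: static_def\<close>)
  show "\<bar>\<Sum>j<m. entry n (s aN) i j * entry n (s aB) k j\<bar> < 2 ^ w" if "i < n" "m \<le> n" for i m
    using row_bound[OF inv d that(1) k(1) that(2)] nUD_less' unfolding eq[OF that(2)] by linarith
  fix s' assume f: "frame {vi, vj, vacc, aW} s s'"
    and *: "\<And>i. i < n \<Longrightarrow> cell (s' aW) i = dot n (entry n (s aN) i) (entry n (s aB) k)"
  show "Q s'"
    using row_bound[OF inv d _ k(1) order_refl]
    by (intro post[OF f]) (auto simp: * eq[OF order_refl])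
qed (use st k n_less in \<open>auto simp: static_def\<close>)

lemma wp_rank_one:
  assumes st: "static s" and k: "k < M" "s vk 0 = int k"
    and inv: "gram_inverse B M n S (entry n (s aN)) (s vd 0)"
    and mu: "s vmu 0 = t\<^sup>2 - (S k)\<^sup>2" "0 \<le> s vmu 0"
    and le: "s vd 0 * (1 + s vmu 0 * dot n (B k) (B k)) \<le> D"
    and post: "\<And>s'. frame (writes rank_one) s s' \<Longrightarrow>
      gram_inverse B M n (S(k := t)) (entry n (s' aN)) (s' vd 0) \<Longrightarrow>
      s' vd 0 \<le> s vd 0 * (1 + s vmu 0 * dot n (B k) (B k)) \<Longrightarrow> Q s'"
  shows "wp N w rank_one Q s"
proof -
  have d0: "0 < s vd 0" using inv by (simp add: gram_inverse_def)
  have "s vd 0 * 1 \<le> s vd 0 * (1 + s vmu 0 * dot n (B k) (B k))"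
    by (rule mult_left_mono) (use d0 mu(2) dot_BB in auto)
  then have dD: "s vd 0 \<le> D" using le by simp
  show ?thesis
    unfolding rank_one_def
  proof (rule wp_Seq, rule wp_matvec_row[OF st k inv dD])
    fix s1
    assume f1: "frame {vi, vj, vacc, aW} s s1"
      and w1: "\<And>i. i < n \<Longrightarrow> cell (s1 aW) i = dot n (entry n (s aN) i) (B k)"
      and w1b: "\<And>i. i < n \<Longrightarrow> \<bar>cell (s1 aW) i\<bar> \<le> int n * U * D"
    let ?w = "cell (s1 aW)"
    define r where "r = s vd 0 + s vmu 0 * dot n (B k) ?w"
    define N' where "N' i j = (r * entry n (s aN) i j - s vmu 0 * ?w i * ?w j) div s vd 0" for i j
    have inv': "gram_inverse B M n (S(k := t)) N' r"
      and r_le: "r \<le> s vd 0 * (1 + s vmu 0 * dot n (B k) (B k))"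
      using gram_inverse_update[OF inv w1 k(1) mu r_def] by (auto simp: N'_def[abs_def])
    have r0: "0 < r" using inv' by (simp add: gram_inverse_def)
    have st1: "static s1" by (rule static_frame[OF st f1]) auto
    show "wp N w (Sum vacc vj (Var vn) (Times (Cell aB (Plus (Times (Var vk) (Var vn)) (Var vj))) (Cell aW (Var vj))) ;;
      Set vrho (Plus (Var vd) (Times (Var vmu) (Var vacc))) ;;
      For vi (Times (Var vn) (Var vn))
        (Assign aN (Var vi) (Div (Minus (Times (Var vrho) (Cell aN (Var vi)))
          (Times (Times (Var vmu) (Cell aW (Div (Var vi) (Var vn))))
            (Cell aW (Minus (Var vi) (Times (Div (Var vi) (Var vn)) (Var vn)))))) (Var vd))) ;;
      Set vd (Var vrho)) Q s1"
    proof (rule wp_Seq, rule wp_Sum[where n = n and f = "\<lambda>j. B k j * ?w j"], goal_cases)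
      case (1 s')
      then show ?case using st1 by (auto simp: static_def frame_def)
    next
      case (2 j s')
      have "s1 aB (int k * int n + int j) = B k j"
        using st1 k 2(1) unfolding static_def entry_def by blast
      then show ?case using 2 st1 f1 k by (auto simp: static_def frame_def cell_def)
    next
      case (6 m)
      have "\<bar>\<Sum>j<m. B k j * ?w j\<bar> \<le> int n * (U * (int n * U * D))"
        by (rule abs_sum_prod_le) (use 6 k BU w1b nUD U1 in auto)
      also have "\<dots> < 2 ^ w" using nUD_less by (simp add: mult_ac)
      finally show ?case .
    next
      case (7 s2)
      have eqs: "s2 vd = s vd" "s2 vmu = s vmu" "s2 aN = s aN" "s2 aW = s1 aW" "s2 vn = s vn"
        using 7(1) f1 by (auto simp: frame_def)
      have acc: "s2 vd 0 + s2 vmu 0 * s2 vacc 0 = r" using 7(2) by (simp add: eqs r_def)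
      have n0: "s vn 0 = int n" using st by (simp add: static_def)
      let ?s3 = "s2(vrho := (s2 vrho)(0 := r))"
      show ?case
      proof (rule wp_Seq, rule wp_Assign)
        show "\<bar>aval (Plus (Var vd) (Times (Var vmu) (Var vacc))) s2\<bar> < 2 ^ w"
          using acc r0 r_le le D_less by simp
        show "wp N w (For vi (Times (Var vn) (Var vn))
        (Assign aN (Var vi) (Div (Minus (Times (Var vrho) (Cell aN (Var vi)))
          (Times (Times (Var vmu) (Cell aW (Div (Var vi) (Var vn))))
            (Cell aW (Minus (Var vi) (Times (Div (Var vi) (Var vn)) (Var vn)))))) (Var vd))) ;;
      Set vd (Var vrho)) Q (s2(vrho := (s2 vrho)(aval (Const 0) s2 := aval (Plus (Var vd) (Times (Var vmu) (Var vacc))) s2)))"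
        proof (simp add: acc, rule wp_Seq, rule wp_Fill[where n = "n * n" and a = aN and g = "\<lambda>x. N' (x div n) (x mod n)"], goal_cases)
          case (1 s')
          then show ?case using n0 by (simp add: frame_def eqs)
        next
          case (6 x s')
          have c: "s' vrho 0 = r" "s' vmu = s vmu" "s' aW = s1 aW" "s' vd = s vd" "s' vn = s vn"
            using 6(2) eqs by (auto simp: frame_def)
          have lt: "x div n < n" "x mod n < n"
            using 6(1) n1 by (auto simp: less_mult_imp_div_less)
          have mod: "int x - int (x div n) * int n = int (x mod n)"
            by (metis add_diff_cancel_left' div_mult_mod_eq of_nat_add of_nat_mult)
          have "entry n (s aN) (x div n) (x mod n) = s aN (int x)"
            unfolding entry_def by (metis div_mult_mod_eq of_nat_add of_nat_mult)
          then have N: "s' aN (int x) = entry n (s aN) (x div n) (x mod n)"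
            using 6(4)[of "int x"] eqs by simp
          have div: "int x div int n = int (x div n)" by (simp add: zdiv_int)
          have val: "aval (Div (Minus (Times (Var vrho) (Cell aN (Var vi)))
              (Times (Times (Var vmu) (Cell aW (Div (Var vi) (Var vn))))
              (Cell aW (Minus (Var vi) (Times (Div (Var vi) (Var vn)) (Var vn)))))) (Var vd)) s' = N' (x div n) (x mod n)"
            unfolding aval.simps c N n0 6(3) div mod N'_def cell_def by simp
          \<comment> \<open>Only the stored quotient has to fit the width; the longer numerator is
            an intermediate value, paid for by the cost of the expression.\<close>
          have "\<bar>N' (x div n) (x mod n)\<bar> \<le> r" by (rule gram_inverse_entry_le[OF inv' lt])
          then have "\<bar>N' (x div n) (x mod n)\<bar> < 2 ^ w" using r_le le D_less by linarith
          then show ?case by (intro wp_Assign) (use val 6(3) in auto)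
        next
          case (7 s4)
          have e: "entry n (s4 aN) i j = N' i j" if "i < n" "j < n" for i j
            using entry_Fill[OF 7(2) that] that by simp
          have "gram_inverse B M n (S(k := t)) (entry n (s4 aN)) r"
            by (rule gram_inverse_cong[OF inv' e]) auto
          moreover have "s4 vrho 0 = r" using 7(1) by (simp add: frame_def)
          moreover have "frame (writes rank_one) s (s4(vd := (s4 vd)(0 := r)))"
            using 7(1) f1 \<open>frame {vj, vacc} s1 s2\<close> by (auto simp: frame_def)
          ultimately show ?case
            by (intro wp_Assign) (use r0 r_le le D_less in \<open>auto intro!: post\<close>)
        qed (use nnN n_less in auto)
      qed
    qed (use n_less in auto)
  qed
qed

lemma wp_init_core:
  assumes st: "static s" and zero: "\<And>y. s aN y = 0" "\<And>i. i < M \<Longrightarrow> cell (s aS) i = 0"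
    and post: "\<And>s'. frame (writes init_core) s s' \<Longrightarrow> (\<And>i. i < M \<Longrightarrow> cell (s' aS) i = 1) \<Longrightarrow>
      gram_inverse B M n (cell (s' aS)) (entry n (s' aN)) (s' vd 0) \<Longrightarrow> s' vd 0 \<le> F1 ^ M \<Longrightarrow> Q s'"
  shows "wp N w init_core Q s"
  unfolding init_core_def
proof (rule wp_Seq, rule wp_For[where n = n and I = "\<lambda>k s'. \<forall>i<n. \<forall>j<n. entry n (s' aN) i j = of_bool (i = j \<and> i < k)"], goal_cases)
  case (1 s')
  then show ?case using st by (simp add: static_def frame_def)
next
  case (5)
  then show ?case using zero by (simp add: entry_def)
next
  case (6 k s')
  have n0: "s' vn 0 = int n" using 6(2) st by (simp add: frame_def static_def)
  have "(1 :: int) < 2 ^ w" using D_less D1 by linarith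
  then show ?case
    by (intro wp_Assign) (use 6 n0 in \<open>auto simp: entry_def idx_eq_iff\<close>)
next
  case (7 s1)
  have st1: "static s1" by (rule static_frame[OF st 7(1)]) auto
  have one: "1 < (2 :: int) ^ w" using D_less D1 by linarith
  let ?s2 = "s1(vd := (s1 vd)(0 := 1), vmu := (s1 vmu)(0 := 1))"
  have st2: "static ?s2" using st1 by (simp add: static_def)
  have S1: "cell (s1 aS) i = 0" if "i < M" for i using zero(2)[OF that] 7(1) by (simp add: frame_def cell_def)
  let ?I = "\<lambda>k s'. gram_inverse B M n (\<lambda>r. of_bool (r < k)) (entry n (s' aN)) (s' vd 0) \<and> s' vd 0 \<le> F1 ^ k \<and>
    (\<forall>i<M. cell (s' aS) i = of_bool (i < k)) \<and> s' vmu 0 = 1"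
  have "wp N w (For vk (Var vM) (rank_one ;; Assign aS (Var vk) (Const 1))) Q ?s2"
  proof (rule wp_For[where n = M and I = ?I], goal_cases)
    case (1 s')
    then show ?case using st2 by (simp add: static_def frame_def)
  next
    case 5
    have "gram_inverse B M n (\<lambda>r. of_bool (r < 0)) (entry n (s1 aN)) 1"
      by (rule gram_inverse_cong[OF gram_inverse_unit[of M "\<lambda>r. 0"]]) (use 7(3) in auto)
    then show ?case using S1 by simp
  next
    case (6 k s')
    have st': "static s'" by (rule static_frame[OF st2 6(2)]) auto
    have d0: "0 < s' vd 0" using 6 by (simp add: gram_inverse_def)
    have "s' vd 0 * (1 + s' vmu 0 * dot n (B k) (B k)) \<le> s' vd 0 * F1"
      by (rule mult_left_mono) (use 6(4) dot_BB(1)[OF 6(1)] d0 in \<open>auto simp: F1_def\<close>)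
    also have "\<dots> \<le> F1 ^ k * F1"
      by (rule mult_right_mono) (use 6(4) F12 in auto)
    finally have le: "s' vd 0 * (1 + s' vmu 0 * dot n (B k) (B k)) \<le> F1 ^ Suc k" by (simp add: mult.commute)
    have "F1 ^ Suc k \<le> D" using Dle[of "Suc k" 0] 6(1) by simp
    with le have leD: "s' vd 0 * (1 + s' vmu 0 * dot n (B k) (B k)) \<le> D" by linarith
    show ?case
    proof (rule wp_Seq, rule wp_rank_one[OF st' 6(1) 6(3), where S = "\<lambda>r. of_bool (r < k)" and t = 1])
      fix s'' assume fr: "frame (writes rank_one) s' s''"
        and inv: "gram_inverse B M n ((\<lambda>r. of_bool (r < k))(k := 1)) (entry n (s'' aN)) (s'' vd 0)"
        and d: "s'' vd 0 \<le> s' vd 0 * (1 + s' vmu 0 * dot n (B k) (B k))"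
      have "(\<lambda>r. of_bool (r < k))(k := 1) = (\<lambda>r. of_bool (r < Suc k) :: int)"
        by (auto simp: less_Suc_eq)
      then show "wp N w (Assign aS (Var vk) (Const 1)) (\<lambda>s''. ?I (Suc k) (s''(vk := (s'' vk)(0 := 1 + int k)))) s''"
        using inv d le 6(3,4) fr one by (intro wp_Assign) (auto simp: frame_def cell_def less_Suc_eq)
    qed (use 6 leD in auto)
  next
    case (7 s')
    have "gram_inverse B M n (cell (s' aS)) (entry n (s' aN)) (s' vd 0)"
      by (rule gram_inverse_cong[of _ _ _ "\<lambda>r. of_bool (r < M)"]) (use 7(3) in auto)
    then show ?case
      by (intro post) (use 7 \<open>frame (insert vi (writes (Assign aN (Plus (Times (Var vi) (Var vn)) (Var vi)) (Const 1)))) s s1\<close> in \<open>auto simp: frame_def\<close>)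
  qed (use MN n_less in auto)
  then show ?case
    by (intro wp_Seq wp_Assign) (use one in auto)
qed (use n_less in auto)

lemma wp_perc_step:
  assumes st: "static s" and S: "\<And>i. i < M \<Longrightarrow> 0 \<le> cell (s aS) i \<and> cell (s aS) i \<le> 2 ^ R"
    and inv: "gram_inverse B M n (cell (s aS)) (entry n (s aN)) (s vd 0)" and dD: "s vd 0 \<le> D"
    and per: "perceptron B M n (cell (s aS)) (s vd 0) t (cell (s aY)) (cell (s aZ))" and t: "t < T"
    and Z: "\<And>j. j < n \<Longrightarrow> \<bar>cell (s aZ) j\<bar> \<le> int t * Zb" and fl: "s vFlag 0 = 0"
    and post: "\<And>s'. frame (writes perc_step) s s' \<Longrightarrow> s' vFlag 0 = 1 \<and> feas \<or> s' vFlag 0 = 0 \<and>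
      perceptron B M n (cell (s aS)) (s vd 0) (Suc t) (cell (s' aY)) (cell (s' aZ)) \<and>
      (\<forall>j<n. \<bar>cell (s' aZ) j\<bar> \<le> int (Suc t) * Zb) \<Longrightarrow> Q s'"
  shows "wp N w perc_step Q s"
proof -
  have one: "1 < (2 :: int) ^ w" using D_less D1 by linarith
  let ?z = "cell (s aZ)"
  let ?I = "\<lambda>k s'. s' vidx 0 = -1 \<and> (\<forall>i<k. 0 < dot n (B i) ?z) \<or>
    (\<exists>i<M. s' vidx 0 = int i \<and> dot n (B i) ?z \<le> 0)"
  show ?thesis
    unfolding perc_step_def
  proof (rule wp_Seq, rule wp_Assign, goal_cases)
    case 1
    then show ?case using one by simp
  next
    case 2
    let ?s1 = "s(vidx := (s vidx)(aval (Const 0) s := aval (Const (-1)) s))"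
    have st1: "static ?s1" using st by (simp add: static_def)
    show ?case
    proof (rule wp_Seq, rule wp_For[where n = M and I = ?I], goal_cases)
      case (1 s')
      then show ?case using st1 by (simp add: static_def frame_def)
    next
      case (6 i s')
      have st': "static s'" by (rule static_frame[OF st1 6(2)]) auto
      have Z': "s' aZ = s aZ" using 6(2) by (simp add: frame_def)
      show ?case
      proof (rule wp_Seq, rule wp_Sum[where n = n and f = "\<lambda>j. B i j * ?z j"], goal_cases)
        case (1 s'')
        then show ?case using st' by (simp add: static_def frame_def)
      next
        case (2 j s'')
        have "s' aB (int i * int n + int j) = B i j"
          using st' 6(1) 2(1) unfolding static_def entry_def by blast
        then show ?case using 2 st' Z' 6(3) by (simp add: static_def frame_def cell_def)
      next
        case (6 m)
        have "\<bar>\<Sum>j<m. B i j * ?z j\<bar> \<le> int n * (U * (int t * Zb))"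
          by (rule abs_sum_prod_le) (use 6 \<open>i < M\<close> BU Z U1 Zb0 in auto)
        also have "\<dots> < 2 ^ w" using tZ_less[of t] t by (simp add: mult_ac)
        finally show ?case .
      next
        case (7 s'')
        have "s'' vidx = s' vidx" "s'' vi 0 = int i" using 7(1) 6(3) by (auto simp: frame_def)
        then show ?case using 6(4) 7(2) 6(1) int_less[of i] MN
          by (intro wp_If wp_Assign wp_Skip) (auto simp: less_Suc_eq)
      qed (use n_less in auto)
    next
      case (7 s2)
      have fr2: "frame (insert vidx (insert vi {vacc, vj})) s s2"
        using 7(1) by (auto simp: frame_def)
      have st2: "static s2" by (rule static_frame[OF st fr2]) auto
      have eq2: "s2 aZ = s aZ" "s2 aY = s aY" "s2 aS = s aS" "s2 aN = s aN" "s2 vd = s vd" "s2 vFlag = s vFlag"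
        using fr2 by (auto simp: frame_def)
      show ?case
      proof (rule wp_If, goal_cases)
        case 1
        then have pos: "\<forall>i<M. 0 < dot n (B i) ?z" using 7(3) by auto
        \<comment> \<open>The current integer vector z is itself a solution of the strict
          system.\<close>
        have feas
          unfolding feas_def
        proof (intro exI[of _ "\<lambda>j. real_of_int (?z j)"] allI impI)
          fix i assume "i < M"
          then have "0 < real_of_int (dot n (B i) ?z)" using pos by (simp only: of_int_0_less_iff)
          then show "0 < dot n (\<lambda>j. real_of_int (B i j)) (\<lambda>j. real_of_int (?z j))" by simp
        qed
        then show ?case
          by (intro wp_Assign post) (use one fr2 in \<open>auto simp: frame_def\<close>)
      next
        case 2
        then obtain k where k: "k < M" "s2 vidx 0 = int k" and neg: "dot n (B k) ?z \<le> 0"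
          using 7(3) by auto
        let ?s3 = "s2(vk := (s2 vk)(0 := int k))"
        have st3: "static ?s3" using st2 by (simp add: static_def)
        have "wp N w (matvec ;;
           For vj (Var vn) (Assign aZ (Var vj) (Plus (Cell aZ (Var vj)) (Times (Cell aS (Var vk)) (Cell aW (Var vj))))) ;;
           Assign aY (Var vk) (Plus (Cell aY (Var vk)) (Const 1))) Q ?s3"
        proof (rule wp_Seq, rule wp_matvec_row[OF st3 k(1), where S = "cell (s aS)" and d = "s vd 0"], goal_cases)
          case 1
          show ?case by simp
        next
          case 2
          show ?case using inv eq2 by simp
        next
          case 3
          show ?case by (rule dD)
        next
          case (4 s4)
          have w4: "cell (s4 aW) i = dot n (entry n (s aN) i) (B k)" if "i < n" for i
            using 4(2)[OF that] eq2 by simp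
          have eq4: "s4 aZ = s aZ" "s4 aY = s aY" "s4 aS = s aS" "s4 vFlag = s vFlag" "s4 vk 0 = int k"
            "s4 vn 0 = int n"
            using 4(1) eq2 st3 by (auto simp: frame_def static_def)
          define z' where "z' j = ?z j + cell (s aS) k * cell (s4 aW) j" for j
          have z'b: "\<bar>z' j\<bar> \<le> int (Suc t) * Zb" if "j < n" for j
          proof -
            have "\<bar>cell (s aS) k * cell (s4 aW) j\<bar> \<le> 2 ^ R * (int n * U * D)"
              unfolding abs_mult by (rule mult_mono) (use S[OF k(1)] 4(3)[OF that] in auto)
            then show ?thesis using Z[OF that] by (simp add: z'_def Zb_def algebra_simps)
          qed
          have per': "perceptron B M n (cell (s aS)) (s vd 0) (Suc t) ((cell (s aY))(k := cell (s aY) k + 1)) z'"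
            unfolding z'_def by (rule perceptron_step[OF inv per w4 k(1) _ neg]) (use S[OF k(1)] in auto)
          have Y0: "0 \<le> cell (s aY) i" if "i < M" for i using per that by (simp add: perceptron_def)
          \<comment> \<open>A counter never exceeds the number of steps, so it fits because
            \<open>T\<close> does.\<close>
          have "cell (s aY) k \<le> (\<Sum>i<M. cell (s aY) i)"
            by (rule member_le_sum) (use k(1) Y0 in auto)
          moreover note Y0[OF k(1)]
          ultimately have Yk: "0 \<le> cell (s aY) k" "cell (s aY) k + 1 \<le> int T"
            using per t by (auto simp: perceptron_def)
          show ?case
          proof (rule wp_Seq, rule wp_Fill[where n = n and a = aZ and g = z'], goal_cases)
            case (1 s')
            then show ?case using eq4 by (simp add: frame_def)
          next
            case (6 j s')
            have e: "s' aS = s4 aS" "s' aW = s4 aW" "s' vk = s4 vk" using 6(2) by (auto simp: frame_def)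
            have "aval (Plus (Cell aZ (Var vj)) (Times (Cell aS (Var vk)) (Cell aW (Var vj)))) s' = z' j"
              using 6(3) 6(4)[of "int j"] e eq4 by (simp add: z'_def cell_def)
            moreover have "\<bar>z' j\<bar> < 2 ^ w" using z'b[OF 6(1)] tZ_less'[of "Suc t"] t by simp
            ultimately show ?case using 6(3) by (intro wp_Assign) auto
          next
            case (7 s5)
            have e: "s5 aY = s aY" "s5 vFlag = s vFlag" "s5 vk 0 = int k" using 7(1) eq4 by (auto simp: frame_def)
            have zz: "cell (s5 aZ) j = z' j" if "j < n" for j using 7(2)[of "int j"] that by (simp add: cell_def)
            let ?s6 = "s5(aY := (s5 aY)(int k := cell (s aY) k + 1))"
            have "perceptron B M n (cell (s aS)) (s vd 0) (Suc t) (cell (?s6 aY)) (cell (?s6 aZ))"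
              by (rule perceptron_cong[OF per']) (use zz e in \<open>auto simp: cell_def\<close>)
            moreover have "frame (writes perc_step) s ?s6"
              using 7(1) 4(1) fr2 by (auto simp: frame_def)
            moreover have "\<bar>cell (s aY) k + 1\<bar> < 2 ^ w" using Yk int_less[OF TN] by linarith
            ultimately show ?case using e zz z'b fl
              by (intro wp_Assign) (auto simp: cell_def intro!: post)
          qed (use n_less in auto)
        qed
        note rest = this
        show ?case
          by (rule wp_Seq, rule wp_Assign) (use rest k int_less[of k] MN in auto)
      qed
    qed (use MN n_less in auto)
  qed
qed

lemma wp_rescale:
  assumes st: "static s" and S: "\<And>i. i < M \<Longrightarrow> 0 < cell (s aS) i \<and> 2 * cell (s aS) i \<le> 2 ^ R"
    and inv: "gram_inverse B M n (cell (s aS)) (entry n (s aN)) (s vd 0)" and dD: "s vd 0 * F2 \<le> D"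
    and per: "perceptron B M n (cell (s aS)) (s vd 0) T (cell (s aY)) z"
    and post: "\<And>s' k. frame (writes rescale) s s' \<Longrightarrow> k < M \<Longrightarrow> int T \<le> cell (s aY) k * int M \<Longrightarrow>
      cell (s' aS) = (cell (s aS))(k := 2 * cell (s aS) k) \<Longrightarrow>
      gram_inverse B M n (cell (s' aS)) (entry n (s' aN)) (s' vd 0) \<Longrightarrow> s' vd 0 \<le> s vd 0 * F2 \<Longrightarrow> Q s'"
  shows "wp N w rescale Q s"
  unfolding rescale_def
proof (rule wp_Seq, rule wp_For[where n = M and I = "\<lambda>i s'. (\<forall>l<i. cell (s aY) l * int M < int T) \<or>
    (\<exists>k<M. s' vk 0 = int k \<and> int T \<le> cell (s aY) k * int M)"], goal_cases)
  case (1 s')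
  then show ?case using st by (simp add: static_def frame_def)
next
  case (6 i s')
  have "s' vM 0 = int M" "s' vT 0 = int T" "s' aY = s aY" using 6(2) st by (auto simp: static_def frame_def)
  then show ?case using 6(1,3,4) int_less[of i] MN
    by (intro wp_If wp_Assign wp_Skip) (auto simp: cell_def less_Suc_eq)
next
  case (7 s1)
  have "\<exists>k<M. int T \<le> cell (s aY) k * int M" by (rule perceptron_heavy_weight[OF per]) (use M1 in simp)
  then obtain k where k: "k < M" "s1 vk 0 = int k" "int T \<le> cell (s aY) k * int M"
    using 7(3) by (metis not_le)
  have fr1: "frame {vi, vk} s s1" using 7(1) by (auto simp: frame_def)
  have st1: "static s1" by (rule static_frame[OF st fr1]) auto
  have e1: "s1 aS = s aS" "s1 aN = s aN" "s1 vd = s vd" using fr1 by (auto simp: frame_def)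
  define v where "v = cell (s aS) k"
  have v: "0 < v" "2 * v \<le> 2 ^ R" using S[OF k(1)] by (auto simp: v_def)
  define mu where "mu = 3 * (v * v)"
  have "v * v \<le> 2 ^ R * 2 ^ R" using v by (intro mult_mono) auto
  then have mu4: "mu \<le> 3 * 4 ^ R" by (simp add: mu_def power_mult_distrib[symmetric])
  have mu0: "0 \<le> mu" by (simp add: mu_def)
  have "mu * dot n (B k) (B k) \<le> 3 * 4 ^ R * (int n * U\<^sup>2)"
    by (rule mult_mono) (use mu4 dot_BB(1)[OF k(1)] dot_BB(2) in auto)
  then have F2: "1 + mu * dot n (B k) (B k) \<le> F2" by (simp add: F2_def)
  have d0: "0 < s vd 0" using inv by (simp add: gram_inverse_def)
  have dF2: "s vd 0 * (1 + mu * dot n (B k) (B k)) \<le> s vd 0 * F2"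
    by (rule mult_left_mono[OF F2]) (use d0 in simp)
  \<comment> \<open>Since n U^2 and d are at least 1, mu \<le> F2 \<le> d F2 \<le> D, and the width
    has room for D.\<close>
  have "mu * 1 \<le> 3 * 4 ^ R * (int n * U\<^sup>2)"
    by (rule mult_mono) (use mu4 nU2 in auto)
  then have "mu \<le> F2" by (simp add: F2_def)
  also have "F2 = 1 * F2" by simp
  also have "1 * F2 \<le> s vd 0 * F2" by (rule mult_right_mono) (use d0 F12 in auto)
  finally have muw: "mu < 2 ^ w" using dD D_less by linarith
  let ?s2 = "s1(vmu := (s1 vmu)(0 := mu))"
  have st2: "static ?s2" using st1 by (simp add: static_def)
  have "wp N w (rank_one ;; Assign aS (Var vk) (Times (Const 2) (Cell aS (Var vk)))) Q ?s2"
  proof (rule wp_Seq, rule wp_rank_one[OF st2 k(1), where S = "cell (s aS)" and t = "2 * v"], goal_cases)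
    case (6 s3)
    have e3: "s3 vk 0 = int k" "s3 aS = s aS" using 6(1) k e1 by (auto simp: frame_def)
    have "2 * v < 2 ^ w"
    proof -
      have "(2::int) ^ R \<le> 3 * 4 ^ R * 1" using power_mono[of "2::int" 4 R] zero_le_power[of "4::int" R] by linarith
      also have "\<dots> \<le> 3 * 4 ^ R * (int n * U\<^sup>2)" by (rule mult_left_mono[OF nU2]) simp
      also have "\<dots> \<le> 1 * F2" by (simp add: F2_def)
      also have "1 * F2 \<le> s vd 0 * F2" by (rule mult_right_mono) (use d0 F12 in auto)
      finally show ?thesis using v dD D_less by linarith
    qed
    moreover have vk: "s3 aS (int k) = v" using e3 by (simp add: v_def cell_def)
    moreover have "Q (s3(aS := (s3 aS)(int k := 2 * v)))"
    proof (rule post[OF _ k(1,3)])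
      show vS: "cell ((s3(aS := (s3 aS)(int k := 2 * v))) aS) = (cell (s aS))(k := 2 * cell (s aS) k)"
        by (auto simp: cell_def e3 v_def)
      show "gram_inverse B M n (cell ((s3(aS := (s3 aS)(int k := 2 * v))) aS))
          (entry n ((s3(aS := (s3 aS)(int k := 2 * v))) aN)) ((s3(aS := (s3 aS)(int k := 2 * v))) vd 0)"
        unfolding vS using 6(2) by (simp add: v_def)
      show "(s3(aS := (s3 aS)(int k := 2 * v))) vd 0 \<le> s vd 0 * F2"
        using 6(3) dF2 e1 by simp
      show "frame (writes rescale) s (s3(aS := (s3 aS)(int k := 2 * v)))"
        using 6(1) fr1 by (auto simp: frame_def)
    qed
    ultimately show ?case using v e3
      by (intro wp_Assign) auto
  qed (use k inv e1 mu0 dF2 dD in \<open>auto simp: mu_def v_def power2_eq_square\<close>)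
  note rest = this
  show ?case
    by (rule wp_Seq, rule wp_Assign) (use rest muw mu0 k e1 in \<open>auto simp: mu_def v_def cell_def\<close>)
qed (use MN n_less in auto)

text \<open>A round without success doubles exactly one factor, so the exponents of the factors sum
  up to the number of rounds; this sum is what later conflicts with the gap.\<close>

definition outer_inv :: "nat \<Rightarrow> state \<Rightarrow> bool" where
  "outer_inv k s \<longleftrightarrow> s vFlag 0 = 1 \<and> feas \<or> s vFlag 0 = 0 \<and>
    (\<exists>e. (\<forall>i<M. cell (s aS) i = 2 ^ e i) \<and> (\<Sum>i<M. e i) = k \<and>
      gram_inverse B M n (cell (s aS)) (entry n (s aN)) (s vd 0) \<and> s vd 0 \<le> F1 ^ M * F2 ^ k \<and>
      (\<forall>x. box x \<longrightarrow> (\<forall>i<M. 2 ^ e i * dot n (\<lambda>j. real_of_int (B i j)) x \<le> 1)))"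

lemma wp_outer_step:
  assumes st: "static s" and inv: "outer_inv k s" and k: "k < R"
  shows "wp N w outer_step (outer_inv (Suc k)) s"
  unfolding outer_step_def
proof (rule wp_If)
  assume "\<not> bval (Less (Var vFlag) (Const 1)) s"
  then show "wp N w Skip (outer_inv (Suc k)) s"
    using inv by (intro wp_Skip) (auto simp: outer_inv_def)
next
  assume "bval (Less (Var vFlag) (Const 1)) s"
  then obtain e where fl: "s vFlag 0 = 0" and e: "\<And>i. i < M \<Longrightarrow> cell (s aS) i = 2 ^ e i" "(\<Sum>i<M. e i) = k"
    and gi: "gram_inverse B M n (cell (s aS)) (entry n (s aN)) (s vd 0)"
    and d: "s vd 0 \<le> F1 ^ M * F2 ^ k"
    and cut: "\<And>x i. box x \<Longrightarrow> i < M \<Longrightarrow> 2 ^ e i * dot n (\<lambda>j. real_of_int (B i j)) x \<le> 1"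
    using inv by (auto simp: outer_inv_def)
  have ek: "e i \<le> k" if "i < M" for i
    using member_le_sum[of i "{..<M}" e] that e(2) by simp
  have S: "0 < cell (s aS) i" "cell (s aS) i \<le> 2 ^ R" "2 * cell (s aS) i \<le> 2 ^ R" if "i < M" for i
  proof -
    have "(2::int) * 2 ^ e i \<le> 2 ^ R"
      using power_increasing[of "Suc (e i)" R "2::int"] ek[OF that] k by simp
    then show "0 < cell (s aS) i" "cell (s aS) i \<le> 2 ^ R" "2 * cell (s aS) i \<le> 2 ^ R"
      unfolding e(1)[OF that] using zero_less_power[of "2::int" "e i"] by linarith+
  qed
  have d0: "0 < s vd 0" using gi by (simp add: gram_inverse_def)
  have "s vd 0 * F2 \<le> F1 ^ M * F2 ^ k * F2" by (rule mult_right_mono[OF d]) (use F12 in simp)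
  also have "\<dots> = F1 ^ M * F2 ^ Suc k" by simp
  finally have dF2: "s vd 0 * F2 \<le> F1 ^ M * F2 ^ Suc k" .
  have dD: "s vd 0 \<le> D" using d Dle[of M k] k by simp
  have dF2D: "s vd 0 * F2 \<le> D" using dF2 Dle[of M "Suc k"] k by linarith
  have w0: "(0::int) < 2 ^ w" by simp
  define P where "P s' \<longleftrightarrow> frame {vi, vj, vacc, aW, vidx, vFlag, vk, aZ, aY, vp} s s'" for s'
  have P_eq: "static s'" "cell (s' aS) = cell (s aS)" "entry n (s' aN) = entry n (s aN)" "s' vd = s vd" if "P s'" for s'
  proof -
    show "static s'" by (rule static_frame[OF st that[unfolded P_def]]) auto
  qed (use that in \<open>auto simp: P_def frame_def\<close>)
  let ?I = "\<lambda>t s'. s' vFlag 0 = 1 \<and> feas \<or> s' vFlag 0 = 0 \<and>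
      perceptron B M n (cell (s aS)) (s vd 0) t (cell (s' aY)) (cell (s' aZ)) \<and>
      (\<forall>j<n. \<bar>cell (s' aZ) j\<bar> \<le> int t * Zb)"
  show "wp N w (For vj (Var vn) (Assign aZ (Var vj) (Const 0)) ;;
     For vi (Var vM) (Assign aY (Var vi) (Const 0)) ;;
     For vp (Var vT) (If (Less (Var vFlag) (Const 1)) perc_step Skip) ;;
     If (Less (Var vFlag) (Const 1)) rescale Skip) (outer_inv (Suc k)) s"
  proof (rule wp_Seq, rule wp_Fill[where n = n and a = aZ and g = "\<lambda>_. 0"], goal_cases)
    case (7 s1)
    show ?case
    proof (rule wp_Seq, rule wp_Fill[where n = M and a = aY and g = "\<lambda>_. 0"], goal_cases)
      case (7 s2)
      have z: "cell (s2 aZ) j = 0" if "j < n" for j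
        using \<open>\<And>y. s1 aZ y = _\<close>[of "int j"] 7(1) that by (simp add: frame_def cell_def)
      have y: "cell (s2 aY) i = 0" if "i < M" for i
        using 7(2)[of "int i"] that by (simp add: cell_def)
      have P2: "P s2" using 7(1) \<open>frame _ s s1\<close> by (auto simp: P_def frame_def)
      have f2: "s2 vFlag 0 = 0" using 7(1) \<open>frame _ s s1\<close> fl by (auto simp: frame_def)
      show ?case
      proof (rule wp_Seq, rule wp_For[where n = T and I = ?I], goal_cases)
        case (1 s')
        then show ?case using P_eq(1)[OF P2] by (simp add: frame_def static_def)
      next
        case 5
        show ?case
          using perceptron_cong[OF perceptron_init[of B M n "cell (s aS)" "s vd 0"], of "cell (s2 aY)" "cell (s2 aZ)"]
            z y f2 by simp
      next
        case (6 t s')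
        have P': "P s'" using 6(2) P2 by (auto simp: P_def frame_def)
        show ?case
        proof (rule wp_If)
          assume "\<not> bval (Less (Var vFlag) (Const 1)) s'"
          then show "wp N w Skip (\<lambda>s''. ?I (Suc t) (s''(vp := (s'' vp)(0 := 1 + int t)))) s'"
            using 6(4) by (intro wp_Skip) auto
        next
          assume b: "bval (Less (Var vFlag) (Const 1)) s'"
          show "wp N w perc_step (\<lambda>s''. ?I (Suc t) (s''(vp := (s'' vp)(0 := 1 + int t)))) s'"
            by (rule wp_perc_step[where t = t])
              (use b 6(1,4) P_eq[OF P'] S gi dD in \<open>auto simp: less_imp_le\<close>)
        qed
      next
        case (7 s3)
        have P3: "P s3" using 7(1) P2 by (auto simp: P_def frame_def)
        show ?case
        proof (rule wp_If)
          assume "\<not> bval (Less (Var vFlag) (Const 1)) s3"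
          then show "wp N w Skip (outer_inv (Suc k)) s3"
            using 7(3) by (intro wp_Skip) (auto simp: outer_inv_def)
        next
          assume b: "bval (Less (Var vFlag) (Const 1)) s3"
          then have f3: "s3 vFlag 0 = 0" and
            per: "perceptron B M n (cell (s aS)) (s vd 0) T (cell (s3 aY)) (cell (s3 aZ))" using 7(3) by auto
          show "wp N w rescale (outer_inv (Suc k)) s3"
          proof (rule wp_rescale[where z = "cell (s3 aZ)"], goal_cases)
            case (6 s4 i)
            have "outer_inv (Suc k) s4"
              unfolding outer_inv_def
            proof (intro disjI2 conjI exI[of _ "e(i := Suc (e i))"] allI impI)
              show "s4 vFlag 0 = 0" using 6(1) f3 by (simp add: frame_def)
              show "cell (s4 aS) l = 2 ^ (e(i := Suc (e i))) l" if "l < M" for l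
                using that e(1) 6(2,4) P_eq(2)[OF P3] by simp
              have "(\<Sum>l<M. (e(i := Suc (e i))) l) = (\<Sum>l<M. e l + (if l = i then 1 else 0))"
                by (rule sum.cong) auto
              then show "(\<Sum>l<M. (e(i := Suc (e i))) l) = Suc k"
                using 6(2) e(2) by (simp add: sum.distrib)
              show "s4 vd 0 \<le> F1 ^ M * F2 ^ Suc k"
                using 6(6) dF2 P_eq(4)[OF P3] by simp
              fix x l assume bx: "box x" and l: "l < M"
              show "2 ^ (e(i := Suc (e i))) l * dot n (\<lambda>j. real_of_int (B l j)) x \<le> 1"
              proof (cases "l = i")
                \<comment> \<open>Only the factor of row i has changed; its new cut is what T
                  perceptron steps without success prove.\<close>
                case True
                have "2 * real_of_int (cell (s aS) i) * dot n (\<lambda>j. real_of_int (B i j)) x \<le> 1"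
                proof (rule perceptron_cut[OF d0 per T 6(2)])
                  show "int T \<le> cell (s3 aY) i * int M" by (rule 6(3))
                  show "real_of_int (cell (s aS) r) * dot n (\<lambda>j. real_of_int (B r j)) x \<le> 1" if "r < M" for r
                    using cut[OF bx that] e(1)[OF that] by simp
                qed (use bx S in \<open>auto simp: box_def\<close>)
                then show ?thesis using True e(1)[OF 6(2)] by simp
              next
                case False
                then show ?thesis using cut[OF bx l] by simp
              qed
            qed (rule 6(5))
            then show ?case .
          qed (use P_eq[OF P3] S gi dF2D per in auto)
        qed
      qed (use TN n_less in auto)
    qed (use 7(1) st MN n_less w0 in \<open>auto simp: frame_def static_def intro!: wp_Assign\<close>)
  qed (use st n_less w0 in \<open>auto simp: frame_def static_def intro!: wp_Assign\<close>)
qed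

text \<open>An unset flag is not yet a proof of infeasibility: it comes with exponents of total R
  whose cuts hold for every solution in the box, to be refuted by the gap of a solvable
  system.\<close>

lemma wp_core:
  assumes st: "static s" and zero: "\<And>y. s aN y = 0" "\<And>i. i < M \<Longrightarrow> cell (s aS) i = 0" "s vFlag 0 = 0"
    and post: "\<And>s'. frame (writes core) s s' \<Longrightarrow> s' vFlag 0 = 1 \<and> feas \<or> s' vFlag 0 = 0 \<and>
      (\<exists>e. (\<Sum>i<M. e i) = R \<and>
        (\<forall>x. box x \<longrightarrow> (\<forall>i<M. 2 ^ e i * dot n (\<lambda>j. real_of_int (B i j)) x \<le> 1))) \<Longrightarrow> Q s'"
  shows "wp N w core Q s"
  unfolding core_def
proof (rule wp_Seq, rule wp_init_core[OF st], goal_cases)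
  case (3 s1)
  have st1: "static s1" by (rule static_frame[OF st 3(1)]) auto
  have inv1: "outer_inv 0 s1"
    unfolding outer_inv_def
    by (intro disjI2 conjI exI[of _ "\<lambda>_. 0"]) (use 3 zero in \<open>auto simp: frame_def box_def\<close>)
  show ?case
  proof (rule wp_For[where n = R and I = outer_inv], goal_cases)
    case (1 s')
    then show ?case using st1 by (simp add: frame_def static_def)
  next
    case 5
    show ?case using inv1 by (simp add: outer_inv_def)
  next
    case (6 k s')
    have "static s'" by (rule static_frame[OF st1 6(2)]) auto
    from wp_outer_step[OF this 6(4,1)] show ?case
      by (rule wp_mono) (simp add: outer_inv_def)
  next
    case (7 s')
    then show ?case
      by (intro post) (use 3(1) in \<open>auto simp: frame_def core_def outer_inv_def\<close>)
  qed (use RN n_less in auto)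
qed (use zero in auto)

end

section \<open>Strict perturbation of homogeneous systems\<close>

definition cone_feasible :: "nat \<Rightarrow> nat \<Rightarrow> (nat \<Rightarrow> nat \<Rightarrow> int) \<Rightarrow> bool" where
  "cone_feasible M n H \<longleftrightarrow>
    (\<exists>z::nat \<Rightarrow> real. (\<forall>i<M. 0 \<le> dot n (\<lambda>j. real_of_int (H i j)) z) \<and> 0 < z 0)"

lemma sum_split_offset: "(\<Sum>j<m + n. f j) = (\<Sum>j<m. f j) + (\<Sum>j<n. f (m + j))" for f :: "nat \<Rightarrow> 'a :: comm_monoid_add"
  by (induction n) (simp_all add: add.assoc)

lemma sum_of_bool_eq: "i < n \<Longrightarrow> (\<Sum>j<n. of_bool (j = i) * f j) = f i" for f :: "nat \<Rightarrow> 'a :: comm_ring_1"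
proof -
  assume "i < n"
  have "(\<Sum>j<n. of_bool (j = i) * f j) = (\<Sum>j<n. if j = i then f j else 0)" by (rule sum.cong) auto
  then show ?thesis using \<open>i < n\<close> by simp
qed

text \<open>Row 0 is z_0 itself, so the positivity of z_0 is part of the strict version of the rows.
  In standard form the system has c = 2 n + M columns, for positive parts, negative parts and
  slacks; each entry of H then occurs at most twice and each slack column contributes 1, which
  explains \<open>V\<close> as a bound on the sum of squares.\<close>

locale cone_problem =
  fixes M n :: nat and H :: "nat \<Rightarrow> nat \<Rightarrow> int" and c :: nat and V :: int
  assumes M1: "1 \<le> M" and n1: "1 \<le> n" and row0: "\<And>j. j < n \<Longrightarrow> H 0 j = of_bool (j = 0)"
    and c: "c = 2 * n + M" and V: "V = int c + 2 * (\<Sum>i<M. \<Sum>j<n. (H i j)\<^sup>2)"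
begin

abbreviation "Hr i \<equiv> (\<lambda>j. real_of_int (H i j))"

lemma sq_nonneg: "0 \<le> (\<Sum>i<M. \<Sum>j<n. (H i j)\<^sup>2)"
  by (intro sum_nonneg) simp

lemma V1: "1 \<le> V" "int c \<le> V"
  using sq_nonneg M1 by (simp_all add: V c)

lemma H_less: "i < M \<Longrightarrow> j < n \<Longrightarrow> \<bar>H i j\<bar> < V"
proof -
  assume ij: "i < M" "j < n"
  have "(H i j)\<^sup>2 \<le> (\<Sum>j<n. (H i j)\<^sup>2)" by (rule member_le_sum) (use ij in auto)
  also have "\<dots> \<le> (\<Sum>i<M. \<Sum>j<n. (H i j)\<^sup>2)"
    by (rule member_le_sum[of i "{..<M}" "\<lambda>i. \<Sum>j<n. (H i j)\<^sup>2"]) (use ij in \<open>auto intro: sum_nonneg\<close>)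
  finally have "2 * (H i j)\<^sup>2 + int c \<le> V" by (simp add: V)
  moreover have "\<bar>H i j\<bar> \<le> (H i j)\<^sup>2"
  proof (cases "H i j = 0")
    case False
    then have "1 * \<bar>H i j\<bar> \<le> \<bar>H i j\<bar> * \<bar>H i j\<bar>" by (intro mult_right_mono) auto
    then show ?thesis by (simp add: power2_eq_square)
  qed simp
  ultimately show ?thesis using M1 by (simp add: c)
qed

lemma cone_small_solution:
  assumes "cone_feasible M n H"
  shows "\<exists>z. (\<forall>i<M. 0 \<le> dot n (Hr i) z) \<and> z 0 = 1 \<and> (\<forall>j<n. \<bar>z j\<bar> \<le> (real c * real_of_int V) ^ c)"
proof -
  obtain z0 :: "nat \<Rightarrow> real" where z0: "\<And>i. i < M \<Longrightarrow> 0 \<le> dot n (Hr i) z0" "0 < z0 0"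
    using assms by (auto simp: cone_feasible_def)
  define z where "z j = z0 j / z0 0" for j
  have z1: "z 0 = 1" using z0 by (simp add: z_def)
  have zH: "0 \<le> dot n (Hr i) z" if "i < M" for i
  proof -
    have "dot n (Hr i) z = dot n (Hr i) z0 / z0 0" by (simp add: z_def sum_divide_distrib)
    then show ?thesis using z0 that by simp
  qed
  \<comment> \<open>With z_0 = 1 column 0 becomes the right-hand side; \<open>G\<close> keeps the
    other columns.\<close>
  define G where "G i j = (if j = 0 then 0 else H i j)" for i j
  have G: "dot n (Hr i) y = real_of_int (H i 0) * y 0 + dot n (\<lambda>j. real_of_int (G i j)) y" for i and y :: "nat \<Rightarrow> real"
  proof -
    have "dot n (Hr i) y = (\<Sum>j<n. of_bool (j = 0) * (real_of_int (H i j) * y j) + real_of_int (G i j) * y j)"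
      by (rule sum.cong) (auto simp: G_def)
    then show ?thesis using n1 by (simp add: sum.distrib sum_of_bool_eq)
  qed
  \<comment> \<open>Standard form: positive parts, negative parts and slacks, in this order.\<close>
  define A where "A i j = (if j < n then G i j else if j < n + n then - G i (j - n) else - of_bool (j - (n + n) = i))" for i j
  have c': "c = n + n + M" by (simp add: c)
  have splitA: "(\<Sum>j<c. real_of_int (A i j) * x j) = dot n (\<lambda>j. real_of_int (G i j)) (\<lambda>j. x j - x (n + j)) - x (n + n + i)"
    if "i < M" for i and x :: "nat \<Rightarrow> real"
  proof -
    have "(\<Sum>j<M. real_of_int (A i (n + n + j)) * x (n + n + j)) = - (\<Sum>j<M. of_bool (j = i) * x (n + n + j))"
      by (simp add: A_def sum_negf)
    also have "\<dots> = - x (n + n + i)" using that by (simp add: sum_of_bool_eq)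
    finally have "(\<Sum>j<M. real_of_int (A i (n + n + j)) * x (n + n + j)) = - x (n + n + i)" .
    then show ?thesis
      unfolding c' sum_split_offset by (simp add: A_def right_diff_distrib sum_subtractf sum_negf)
  qed
  have sqA: "(\<Sum>j<c. (A i j)\<^sup>2) = 2 * (\<Sum>j<n. (G i j)\<^sup>2) + 1" if "i < M" for i
  proof -
    have "(\<Sum>j<M. (A i (n + n + j))\<^sup>2) = (\<Sum>j<M. of_bool (j = i) * 1)"
      by (rule sum.cong) (auto simp: A_def)
    also have "\<dots> = 1" using that by (subst sum_of_bool_eq) auto
    finally show ?thesis unfolding c' sum_split_offset by (simp add: A_def)
  qed
  have GH: "(\<Sum>j<n. (G i j)\<^sup>2) + (H i 0)\<^sup>2 = (\<Sum>j<n. (H i j)\<^sup>2)" for i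
  proof -
    have "(\<Sum>j<n. (H i j)\<^sup>2) = (\<Sum>j<n. of_bool (j = 0) * (H i j)\<^sup>2 + (G i j)\<^sup>2)"
      by (rule sum.cong) (auto simp: G_def)
    then show ?thesis using n1 by (simp add: sum.distrib sum_of_bool_eq)
  qed
  have "(\<Sum>i<M. (\<Sum>j<c. (A i j)\<^sup>2) + (- H i 0)\<^sup>2) \<le> (\<Sum>i<M. 2 * (\<Sum>j<n. (H i j)\<^sup>2) + 1)"
  proof (rule sum_mono)
    fix i assume "i \<in> {..<M}"
    then show "(\<Sum>j<c. (A i j)\<^sup>2) + (- H i 0)\<^sup>2 \<le> 2 * (\<Sum>j<n. (H i j)\<^sup>2) + 1"
      unfolding GH[of i, symmetric] using sqA[of i] by simp
  qed
  also have "\<dots> \<le> V" by (simp add: V c sum.distrib sum_distrib_left)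
  finally have sq: "(\<Sum>i<M. (\<Sum>j<c. (A i j)\<^sup>2) + (- H i 0)\<^sup>2) \<le> V" .
  define x where "x j = (if j < n then max (z j) 0 else if j < n + n then max (- z (j - n)) 0 else dot n (Hr (j - (n + n))) z)" for j
  have x0: "\<forall>j<c. 0 \<le> x j" using zH by (auto simp: x_def c')
  have xA: "\<forall>i<M. (\<Sum>j<c. real_of_int (A i j) * x j) = real_of_int (- H i 0)"
  proof (intro allI impI)
    fix i assume i: "i < M"
    have "dot n (\<lambda>j. real_of_int (G i j)) (\<lambda>j. x j - x (n + j)) = dot n (\<lambda>j. real_of_int (G i j)) z"
      by (rule sum.cong) (auto simp: x_def max_def)
    then show "(\<Sum>j<c. real_of_int (A i j) * x j) = real_of_int (- H i 0)"
      unfolding splitA[OF i] using G[of i z] by (simp add: x_def z1)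
  qed
  obtain y where y: "\<And>j. j < c \<Longrightarrow> 0 \<le> y j" "\<And>j. j < c \<Longrightarrow> y j \<le> (real c * real_of_int V) ^ c"
    "\<And>i. i < M \<Longrightarrow> (\<Sum>j<c. real_of_int (A i j) * y j) = real_of_int (- H i 0)"
    using small_nonneg_solution[OF x0 xA sq V1(1)] by blast
  \<comment> \<open>Column 0 of \<open>G\<close> vanishes, so y does not determine z_0; it is put
    back as 1.\<close>
  define z' where "z' j = (if j = 0 then 1 else y j - y (n + j))" for j
  have one: "1 \<le> (real c * real_of_int V) ^ c"
  proof (rule one_le_power)
    have "1 * 1 \<le> real c * real_of_int V" using V1 M1 by (intro mult_mono) (auto simp: c)
    then show "1 \<le> real c * real_of_int V" by simp
  qed
  have "0 \<le> dot n (Hr i) z'" if i: "i < M" for i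
  proof -
    have "dot n (\<lambda>j. real_of_int (G i j)) z' = dot n (\<lambda>j. real_of_int (G i j)) (\<lambda>j. y j - y (n + j))"
      by (rule sum.cong) (auto simp: z'_def G_def)
    then have "dot n (Hr i) z' = y (n + n + i)"
      using G[of i z'] y(3)[OF i] splitA[OF i, of y] by (simp add: z'_def)
    then show ?thesis using y(1)[of "n + n + i"] i by (simp add: c')
  qed
  moreover have "\<bar>z' j\<bar> \<le> (real c * real_of_int V) ^ c" if "j < n" for j
    using y(1,2)[of j] y(1,2)[of "n + j"] that one by (auto simp: z'_def c')
  ultimately show ?thesis by (intro exI[of _ z']) (auto simp: z'_def)
qed

text \<open>Infeasibility means that the rows imply z_0 \<le> 0; Farkas' lemma turns this into
  nonnegative multipliers, and a basic solution of the transposed system provides small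
  ones.\<close>

lemma cone_infeasible_certificate:
  assumes "\<not> cone_feasible M n H"
  shows "\<exists>l::nat \<Rightarrow> real. (\<forall>i<M. 0 \<le> l i \<and> l i \<le> (real c * real_of_int V) ^ c) \<and>
    (\<forall>j<n. (\<Sum>i<M. real_of_int (H i j) * l i) = - of_bool (j = 0))"
proof -
  have "(\<Sum>j<n. of_bool (j = 0) * x j) \<le> 0" if "\<And>i. i < M \<Longrightarrow> (\<Sum>j<n. - real_of_int (H i j) * x j) \<le> 0" for x :: "nat \<Rightarrow> real"
  proof -
    have "(\<Sum>j<n. - real_of_int (H i j) * x j) = - dot n (Hr i) x" for i by (simp add: sum_negf)
    then have "0 \<le> dot n (Hr i) x" if "i < M" for i using \<open>\<And>i. i < M \<Longrightarrow> _ i \<le> 0\<close>[OF that] by simp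
    then have "x 0 \<le> 0" using assms unfolding cone_feasible_def by (meson not_le)
    then show ?thesis using n1 by (simp add: sum_of_bool_eq)
  qed
  from farkas[where m = M and n = n and a = "\<lambda>i j. - real_of_int (H i j)" and q = "\<lambda>j. of_bool (j = 0)", OF this]
  obtain l where l: "\<forall>i<M. 0 \<le> l i" "\<forall>j<n. of_bool (j = 0) = (\<Sum>i<M. l i * - real_of_int (H i j))" by blast
  have eq: "\<forall>j<n. (\<Sum>i<M. real_of_int (H i j) * l i) = real_of_int (- of_bool (j = 0))"
    using l(2) by (simp add: sum_negf mult.commute)
  have "(\<Sum>j<n. (- of_bool (j = 0))\<^sup>2) = (\<Sum>j<n. of_bool (j = 0) * (1 :: int))"
    by (rule sum.cong) auto
  also have "\<dots> = 1" using n1 by (subst sum_of_bool_eq) auto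
  finally have one: "(\<Sum>j<n. (- of_bool (j = 0))\<^sup>2) = (1 :: int)" .
  have "(\<Sum>j<n. (\<Sum>i<M. (H i j)\<^sup>2) + (- of_bool (j = 0))\<^sup>2) = (\<Sum>i<M. \<Sum>j<n. (H i j)\<^sup>2) + 1"
    unfolding sum.distrib one by (subst sum.swap) simp
  also have "\<dots> \<le> V" using n1 sq_nonneg by (simp add: V c)
  finally have sq: "(\<Sum>j<n. (\<Sum>i<M. (H i j)\<^sup>2) + (- of_bool (j = 0))\<^sup>2) \<le> V" .
  obtain y where y: "\<And>i. i < M \<Longrightarrow> 0 \<le> y i" "\<And>i. i < M \<Longrightarrow> y i \<le> (real M * real_of_int V) ^ M"
    "\<And>j. j < n \<Longrightarrow> (\<Sum>i<M. real_of_int (H i j) * y i) = real_of_int (- of_bool (j = 0))"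
    using small_nonneg_solution[OF l(1) eq sq V1(1)] by blast
  have "(real M * real_of_int V) ^ M \<le> (real c * real_of_int V) ^ M"
    using V1 by (intro power_mono mult_right_mono) (auto simp: c)
  also have "\<dots> \<le> (real c * real_of_int V) ^ c"
  proof (rule power_increasing)
    have "1 * 1 \<le> real c * real_of_int V" using V1 M1 by (intro mult_mono) (auto simp: c)
    then show "1 \<le> real c * real_of_int V" by simp
  qed (simp add: c)
  finally have "(real M * real_of_int V) ^ M \<le> (real c * real_of_int V) ^ c" .
  then show ?thesis using y by (intro exI[of _ y]) (force intro: order_trans)
qed

end

text \<open>From V \<le> 2^l and c \<le> 2^c, basic solutions are bounded by (c V)^c \<le> 2^e. The
  factor 2^M in \<open>E\<close> makes E larger than any sum of M certificate multipliers. 2^ts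
  exceeds every b_i z for a small solution z: the terms of \<open>ts\<close> stand for E, for the n
  summands, for the entries of H, for those of z and for the added z_0.\<close>

locale cone_perturbed = cone_problem +
  fixes l e ts :: nat and E :: int and B :: "nat \<Rightarrow> nat \<Rightarrow> int"
  assumes l: "V \<le> 2 ^ l" and e: "e = c * (c + l)" and E: "E = 2 ^ (e + M)"
    and ts: "ts = e + M + n + l + e + 1"
    and B: "\<And>i j. i < M \<Longrightarrow> j < n \<Longrightarrow> B i j = E * H i j + of_bool (j = 0)"
begin

lemma bound_le: "(real c * real_of_int V) ^ c \<le> 2 ^ e"
proof -
  have "real c \<le> 2 ^ c" by (metis less_exp less_imp_le of_nat_le_iff of_nat_numeral of_nat_power)
  moreover have "real_of_int V \<le> 2 ^ l" using l by (metis of_int_le_iff of_int_numeral of_int_power)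
  ultimately have "real c * real_of_int V \<le> 2 ^ c * 2 ^ l" using V1 by (intro mult_mono) auto
  then have "(real c * real_of_int V) ^ c \<le> (2 ^ (c + l)) ^ c"
    using V1 by (intro power_mono) (auto simp: power_add)
  also have "\<dots> = 2 ^ e" by (simp add: e power_mult[symmetric] mult.commute)
  finally show ?thesis .
qed

lemma dot_B: "i < M \<Longrightarrow> dot n (\<lambda>j. real_of_int (B i j)) z = real_of_int E * dot n (Hr i) z + z 0"
proof -
  assume i: "i < M"
  have "dot n (\<lambda>j. real_of_int (B i j)) z = (\<Sum>j<n. real_of_int E * (real_of_int (H i j) * z j) + of_bool (j = 0) * z j)"
    by (rule sum.cong) (auto simp: B i algebra_simps)
  then show ?thesis using n1 by (simp add: sum.distrib sum_of_bool_eq sum_distrib_left)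
qed

text \<open>Row 0 gives z_0 > 0. If the cone were infeasible, combining the rows of B with the
  certificate y would give (sum of y - E) z_0 \<ge> 0, but E is larger than the sum of y.\<close>

lemma perturbed_feasible_imp:
  assumes "\<And>i. i < M \<Longrightarrow> 0 < dot n (\<lambda>j. real_of_int (B i j)) z"
  shows "cone_feasible M n H"
proof (rule ccontr)
  assume "\<not> ?thesis"
  then obtain y where y: "\<And>i. i < M \<Longrightarrow> 0 \<le> y i" "\<And>i. i < M \<Longrightarrow> y i \<le> 2 ^ e"
    "\<And>j. j < n \<Longrightarrow> (\<Sum>i<M. real_of_int (H i j) * y i) = - of_bool (j = 0)"
    using cone_infeasible_certificate bound_le order_trans by blast
  have E0: "0 < real_of_int E" by (simp add: E)
  have M0: "0 < M" using M1 by simp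
  have "dot n (Hr 0) z = (\<Sum>j<n. of_bool (j = 0) * z j)" by (rule sum.cong) (auto simp: row0)
  then have "dot n (Hr 0) z = z 0" using n1 by (simp add: sum_of_bool_eq)
  moreover have "0 < real_of_int E * dot n (Hr 0) z + z 0"
    using assms[of 0] unfolding dot_B[of 0 z, OF M0] using M0 by simp
  ultimately have "0 < (real_of_int E + 1) * z 0" by (simp add: distrib_right)
  then have z0: "0 < z 0" using E0 by (simp add: zero_less_mult_iff)
  have "0 \<le> (\<Sum>i<M. y i * dot n (\<lambda>j. real_of_int (B i j)) z)"
  proof (rule sum_nonneg)
    fix i assume "i \<in> {..<M}"
    then have "0 \<le> y i" "0 \<le> dot n (\<lambda>j. real_of_int (B i j)) z"
      using y(1) assms[of i] less_imp_le by blast+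
    then show "0 \<le> y i * dot n (\<lambda>j. real_of_int (B i j)) z" by (rule mult_nonneg_nonneg)
  qed
  also have "\<dots> = (\<Sum>i<M. real_of_int E * (y i * dot n (Hr i) z) + y i * z 0)"
    by (rule sum.cong[OF refl], subst dot_B) (auto simp only: lessThan_iff distrib_left mult.left_commute)
  also have "\<dots> = real_of_int E * (\<Sum>i<M. y i * dot n (Hr i) z) + (\<Sum>i<M. y i) * z 0"
    by (simp add: sum.distrib sum_distrib_left sum_distrib_right)
  also have "(\<Sum>i<M. y i * dot n (Hr i) z) = (\<Sum>j<n. (\<Sum>i<M. real_of_int (H i j) * y i) * z j)"
    unfolding sum_distrib_left sum_distrib_right by (subst sum.swap) (simp add: mult_ac)
  also have "\<dots> = (\<Sum>j<n. - (of_bool (j = 0) * z j))" by (rule sum.cong) (auto simp: y(3))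
  also have "\<dots> = - z 0" unfolding sum_negf using n1 by (simp add: sum_of_bool_eq)
  finally have "real_of_int E * z 0 \<le> (\<Sum>i<M. y i) * z 0" by simp
  then have "real_of_int E \<le> (\<Sum>i<M. y i)" using z0 by simp
  also have "\<dots> \<le> (\<Sum>i<M. 2 ^ e)" by (rule sum_mono) (use y in auto)
  also have "\<dots> = real M * 2 ^ e" by simp
  also have "\<dots> < 2 ^ M * 2 ^ e" by (intro mult_strict_right_mono of_nat_less_two_power) simp
  finally show False by (simp add: E power_add)
qed

text \<open>For a small solution z with z_0 = 1 all b_i z = E h_i z + 1 lie between 1 and 2^ts;
  dividing z by 2^ts moves it into the box.\<close>

lemma feasible_imp_gap:
  assumes "cone_feasible M n H"
  shows "\<exists>x. (\<forall>i<M. 0 < dot n (\<lambda>j. real_of_int (B i j)) x \<and> dot n (\<lambda>j. real_of_int (B i j)) x \<le> 1 \<and>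
      1 \<le> 2 ^ ts * dot n (\<lambda>j. real_of_int (B i j)) x) \<and> (\<forall>j<n. \<bar>x j\<bar> \<le> 1)"
proof -
  obtain z where z: "\<And>i. i < M \<Longrightarrow> 0 \<le> dot n (Hr i) z" "z 0 = 1" "\<And>j. j < n \<Longrightarrow> \<bar>z j\<bar> \<le> 2 ^ e"
    using cone_small_solution[OF assms] bound_le order_trans by blast
  define x where "x j = z j / 2 ^ ts" for j
  have dx: "dot n (\<lambda>j. real_of_int (B i j)) x = dot n (\<lambda>j. real_of_int (B i j)) z / 2 ^ ts" for i
    by (simp add: x_def sum_divide_distrib)
  have lo: "1 \<le> dot n (\<lambda>j. real_of_int (B i j)) z" if "i < M" for i
    using z that by (simp add: dot_B E)
  have up: "dot n (\<lambda>j. real_of_int (B i j)) z \<le> 2 ^ ts" if i: "i < M" for i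
  proof -
    have "dot n (Hr i) z \<le> (\<Sum>j<n. 2 ^ l * 2 ^ e)"
    proof (rule sum_mono)
      fix j assume "j \<in> {..<n}"
      then have j: "j < n" by simp
      have "\<bar>H i j\<bar> \<le> 2 ^ l" using H_less[OF i j] l by linarith
      then have "\<bar>real_of_int (H i j)\<bar> \<le> 2 ^ l"
        by (metis of_int_abs of_int_le_iff of_int_numeral of_int_power)
      then have "\<bar>real_of_int (H i j) * z j\<bar> \<le> 2 ^ l * 2 ^ e"
        unfolding abs_mult using z(3)[OF j] by (intro mult_mono) auto
      then show "real_of_int (H i j) * z j \<le> 2 ^ l * 2 ^ e" by linarith
    qed
    also have "\<dots> \<le> 2 ^ n * (2 ^ l * 2 ^ e)"
      using of_nat_less_two_power[of n, where 'a=real] by (simp add: mult_right_mono)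
    finally have "real_of_int E * dot n (Hr i) z \<le> 2 ^ (e + M) * (2 ^ n * (2 ^ l * 2 ^ e))"
      unfolding E by (intro mult_mono) (use z(1)[OF i] in auto)
    also have "\<dots> = 2 ^ (e + M + n + l + e)" by (simp add: power_add)
    finally have "real_of_int E * dot n (Hr i) z \<le> 2 ^ (e + M + n + l + e)" .
    moreover have "(1::real) \<le> 2 ^ (e + M + n + l + e)" by simp
    ultimately show ?thesis unfolding dot_B[OF i] z(2) ts power_add[of 2 _ 1] power_one_right by linarith
  qed
  have "\<bar>x j\<bar> \<le> 1" if "j < n" for j
  proof -
    have "\<bar>z j\<bar> \<le> 2 ^ ts" using z(3)[OF that] power_increasing[of e ts "2::real"] by (simp add: ts)
    then show ?thesis by (simp add: x_def)
  qed
  then show ?thesis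
    using lo up by (intro exI[of _ x]) (force simp: dx)
qed

text \<open>The point with b_i x \<ge> 2^-ts forces every exponent to be at most ts, so M exponents
  cannot have the sum M ts + 1. This determines the number of rounds.\<close>

lemma scaling_contradiction:
  assumes cone: "cone_feasible M n H" and ex: "(\<Sum>i<M. ex i) = M * ts + 1"
    and cut: "\<And>x i. (\<forall>i<M. 0 < dot n (\<lambda>j. real_of_int (B i j)) x \<and> dot n (\<lambda>j. real_of_int (B i j)) x \<le> 1) \<Longrightarrow>
      (\<forall>j<n. \<bar>x j\<bar> \<le> 1) \<Longrightarrow> i < M \<Longrightarrow> 2 ^ ex i * dot n (\<lambda>j. real_of_int (B i j)) x \<le> 1"
  shows False
proof -
  obtain x where x: "\<forall>i<M. 0 < dot n (\<lambda>j. real_of_int (B i j)) x \<and> dot n (\<lambda>j. real_of_int (B i j)) x \<le> 1"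
    "\<And>i. i < M \<Longrightarrow> 1 \<le> 2 ^ ts * dot n (\<lambda>j. real_of_int (B i j)) x" "\<forall>j<n. \<bar>x j\<bar> \<le> 1"
    using feasible_imp_gap[OF cone] by blast
  have "ex i \<le> ts" if i: "i < M" for i
  proof -
    have "2 ^ ex i * dot n (\<lambda>j. real_of_int (B i j)) x \<le> 2 ^ ts * dot n (\<lambda>j. real_of_int (B i j)) x"
      using cut[OF x(1,3) i] x(2)[OF i] by linarith
    moreover have "0 < dot n (\<lambda>j. real_of_int (B i j)) x" using x(1) i by blast
    ultimately have "(2::real) ^ ex i \<le> 2 ^ ts" by (simp only: mult_le_cancel_right_pos)
    then show ?thesis by simp
  qed
  then have "(\<Sum>i<M. ex i) \<le> (\<Sum>i<M. ts)" by (intro sum_mono) auto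
  then show False using ex by simp
qed

end

section \<open>Deciding homogeneous systems\<close>

abbreviation (input) "aH \<equiv> 3 :: nat"
abbreviation (input) "vV \<equiv> 23 :: nat"
abbreviation (input) "vl \<equiv> 24 :: nat"
abbreviation (input) "vpw \<equiv> 25 :: nat"
abbreviation (input) "ve \<equiv> 26 :: nat"
abbreviation (input) "vE \<equiv> 27 :: nat"
abbreviation (input) "vc \<equiv> 28 :: nat"

text \<open>Logarithm by repeated doubling; the exponent of E and the number of rounds are computed
  from it.\<close>

definition bit_length :: com where
  "bit_length = Set vpw (Const 1) ;; Set vl (Const 0) ;;
    While (Less (Var vpw) (Var vV)) (Set vpw (Times (Const 2) (Var vpw)) ;; Set vl (Plus (Var vl) (Const 1)))"

definition perturb :: com where
  "perturb = Set vc (Plus (Times (Const 2) (Var vn)) (Var vM)) ;;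
    Sum vV vi (Times (Var vM) (Var vn)) (Times (Cell aH (Var vi)) (Cell aH (Var vi))) ;;
    Set vV (Plus (Var vc) (Times (Const 2) (Var vV))) ;;
    bit_length ;;
    Set ve (Times (Var vc) (Plus (Var vc) (Var vl))) ;;
    Set vE (Const 1) ;;
    For vi (Plus (Var ve) (Var vM)) (Set vE (Times (Const 2) (Var vE))) ;;
    For vi (Times (Var vM) (Var vn)) (Assign aB (Var vi) (Times (Var vE) (Cell aH (Var vi)))) ;;
    For vi (Var vM) (Assign aB (Times (Var vi) (Var vn)) (Plus (Cell aB (Times (Var vi) (Var vn))) (Const 1))) ;;
    Set vT (Times (Const 4) (Times (Times (Var vM) (Var vM)) (Plus (Var vM) (Var vn)))) ;;
    Set vR (Plus (Times (Var vM) (Plus (Plus (Plus (Plus (Plus (Var ve) (Var vM)) (Var vn)) (Var vl)) (Var ve)) (Const 1))) (Const 1))"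

definition solve_cone :: com where
  "solve_cone = perturb ;; core"

lemma writes_bit_length [simp]: "writes bit_length = {vpw, vl}"
  by (auto simp: bit_length_def)

lemma writes_perturb [simp]: "writes perturb = {vc, vV, vi, vpw, vl, ve, vE, aB, vT, vR}"
  by (auto simp: perturb_def)

lemma writes_core [simp]: "writes core =
    {vi, vj, vacc, aW, vrho, aN, vd, vmu, vk, aS, vidx, vFlag, aZ, aY, vp, vo}"
  by (auto simp: core_def)

lemma wp_bit_length:
  assumes V: "s vV 0 \<le> 2 ^ L" and L: "L \<le> N" "L < w"
    and post: "\<And>s' l. frame {vpw, vl} s s' \<Longrightarrow> s' vl 0 = int l \<Longrightarrow> l \<le> L \<Longrightarrow> s vV 0 \<le> 2 ^ l \<Longrightarrow> Q s'"
  shows "wp N w bit_length Q s"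
proof -
  let ?s2 = "s(vpw := (s vpw)(0 := 1), vl := (s vl)(0 := 0))"
  have w1: "(1::int) < 2 ^ w" using L one_less_power[of "2::int" w] by simp
  have "wp N w (While (Less (Var vpw) (Var vV)) (Set vpw (Times (Const 2) (Var vpw)) ;; Set vl (Plus (Var vl) (Const 1)))) Q ?s2"
  proof (rule wp_While[where I = "\<lambda>k s'. k \<le> L \<and> s' vpw 0 = 2 ^ k \<and> s' vl 0 = int k"], goal_cases)
    case (2 k s')
    have "s' vV = s vV" using 2(1) by (simp add: frame_def)
    then have "(2::int) ^ k < s vV 0" using 2(2,3) by simp
    also note V
    finally have "(2::int) ^ k < 2 ^ L" .
    then have k: "k < L" by simp
    have "(2::int) ^ Suc k < 2 ^ w" using k L by (intro power_strict_increasing) auto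
    moreover have "1 + int k < 2 ^ w"
      using k L of_nat_less_two_power[of w, where 'a=int] by linarith
    ultimately have "wp N w (Set vpw (Times (Const 2) (Var vpw)) ;; Set vl (Plus (Var vl) (Const 1)))
        (\<lambda>s'. Suc k \<le> L \<and> s' vpw 0 = 2 ^ Suc k \<and> s' vl 0 = int (Suc k)) s'"
      using 2(2) k by (intro wp_Seq wp_Assign) (auto simp: add.commute)
    then show ?case using k L by simp
  next
    case (3 k s')
    have e: "s' vV = s vV" using 3(1) by (simp add: frame_def)
    have "frame {vpw, vl} s s'" using 3(1) by (auto simp: frame_def)
    then show ?case by (rule post[of _ k]) (use 3(2,3) e in auto)
  qed simp
  then show ?thesis
    unfolding bit_length_def by (intro wp_Seq wp_Assign) (use w1 in auto)
qed

text \<open>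
  With \<open>l\<close> the bit length of the squared entries of \<open>H\<close>, these are the binary logarithms of the bounds for
  basic solutions (\<open>exp_e\<close>), the reciprocal of the gap (\<open>exp_ts\<close>), the entries of \<open>B\<close> (\<open>exp_u\<close>), the
  determinants (\<open>exp_D\<close>) and all other numbers (\<open>exp_W\<close>); \<open>num_T\<close> and \<open>num_R\<close> are the numbers of perceptron
  steps per round and of rounds.
\<close>

definition exp_e :: "nat \<Rightarrow> nat \<Rightarrow> nat \<Rightarrow> nat" where
  "exp_e M n l = (2 * n + M) * (2 * n + M + l)"

definition exp_ts :: "nat \<Rightarrow> nat \<Rightarrow> nat \<Rightarrow> nat" where
  "exp_ts M n l = exp_e M n l + M + n + l + exp_e M n l + 1"

definition num_T :: "nat \<Rightarrow> nat \<Rightarrow> nat" where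
  "num_T M n = 4 * (M * M * (M + n))"

definition num_R :: "nat \<Rightarrow> nat \<Rightarrow> nat \<Rightarrow> nat" where
  "num_R M n l = M * exp_ts M n l + 1"

definition exp_u :: "nat \<Rightarrow> nat \<Rightarrow> nat \<Rightarrow> nat" where
  "exp_u M n l = exp_e M n l + M + l"

definition exp_D :: "nat \<Rightarrow> nat \<Rightarrow> nat \<Rightarrow> nat" where
  "exp_D M n l = M * (n + 2 * exp_u M n l) +
    num_R M n l * (2 * num_R M n l + n + 2 * exp_u M n l + 2)"

definition exp_W :: "nat \<Rightarrow> nat \<Rightarrow> nat \<Rightarrow> nat" where
  "exp_W M n l = num_T M n + num_R M n l + 2 * n + 2 * exp_u M n l + exp_D M n l"

text \<open>The program works with the exponent l that it finds, whereas \<open>N\<close> and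
  \<open>w\<close> are fixed beforehand for some L \<ge> l.\<close>

lemma exp_mono:
  assumes "l \<le> L"
  shows "exp_e M n l \<le> exp_e M n L" "exp_ts M n l \<le> exp_ts M n L" "num_R M n l \<le> num_R M n L"
    "exp_u M n l \<le> exp_u M n L" "exp_D M n l \<le> exp_D M n L" "exp_W M n l \<le> exp_W M n L"
proof -
  show e: "exp_e M n l \<le> exp_e M n L" using assms by (simp add: exp_e_def)
  show ts: "exp_ts M n l \<le> exp_ts M n L" using assms e by (simp add: exp_ts_def)
  show R: "num_R M n l \<le> num_R M n L" using ts by (simp add: num_R_def)
  show u: "exp_u M n l \<le> exp_u M n L" using assms e by (simp add: exp_u_def)
  show D: "exp_D M n l \<le> exp_D M n L" unfolding exp_D_def
    by (intro add_mono mult_mono R u order_refl) auto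
  show "exp_W M n l \<le> exp_W M n L" unfolding exp_W_def
    by (intro add_mono mult_mono R u D order_refl) auto
qed

lemma nat_less_two_power_int: "int k < 2 ^ k"
  by (rule of_nat_less_two_power)

text \<open>The inequality k < 2^k turns every factor in the bounds for D and the width into a power
  of two; \<open>exp_D\<close> and \<open>exp_W\<close> add up the exponents.\<close>

lemma core_params_exp:
  assumes M1: "1 \<le> M" and n1: "1 \<le> n"
    and BU: "\<And>i j. i < M \<Longrightarrow> j < n \<Longrightarrow> \<bar>B i j\<bar> \<le> 2 ^ exp_u M n l"
    and N: "M \<le> N" "num_T M n \<le> N" "num_R M n l \<le> N" "n * n \<le> N" "N < 2 ^ w"
    and w: "exp_W M n l \<le> w"
  shows "core_params B M n (num_T M n) (num_R M n l) N w (2 ^ exp_u M n l) (2 ^ exp_D M n l)"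
proof
  let ?u = "exp_u M n l" and ?R = "num_R M n l" and ?T = "num_T M n" and ?D = "exp_D M n l"
  have nn: "int n + 1 \<le> 2 ^ n" "int ?T + 1 \<le> 2 ^ ?T" using nat_less_two_power_int[of n] nat_less_two_power_int[of ?T] by linarith+
  have u2: "((2::int) ^ ?u)\<^sup>2 = 2 ^ (2 * ?u)" by (simp add: power_mult[symmetric] mult.commute)
  have u1: "(1::int) \<le> 2 ^ (2 * ?u)" by simp
  have F1: "1 + int n * (2 ^ ?u)\<^sup>2 \<le> 2 ^ (n + 2 * ?u)"
  proof -
    have "1 + int n * 2 ^ (2 * ?u) \<le> 2 ^ (2 * ?u) + int n * 2 ^ (2 * ?u)" using u1 by linarith
    also have "\<dots> = (int n + 1) * 2 ^ (2 * ?u)" by (simp add: algebra_simps)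
    also have "\<dots> \<le> 2 ^ n * 2 ^ (2 * ?u)" by (rule mult_right_mono[OF nn(1)]) simp
    finally show ?thesis unfolding u2 by (simp add: power_add)
  qed
  have F2: "1 + 3 * 4 ^ ?R * (int n * (2 ^ ?u)\<^sup>2) \<le> 2 ^ (2 * ?R + n + 2 * ?u + 2)"
  proof -
    have 4: "(4::int) ^ ?R = 2 ^ (2 * ?R)" by (simp add: power_mult)
    have "int n * 2 ^ (2 * ?u) \<le> 2 ^ n * 2 ^ (2 * ?u)" by (rule mult_right_mono) (use nn in auto)
    then have "3 * 4 ^ ?R * (int n * 2 ^ (2 * ?u)) \<le> 3 * 2 ^ (2 * ?R) * (2 ^ n * 2 ^ (2 * ?u))"
      unfolding 4 by (intro mult_left_mono) auto
    also have "\<dots> = 3 * 2 ^ (2 * ?R + n + 2 * ?u)" by (simp add: power_add)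
    finally have "3 * 4 ^ ?R * (int n * 2 ^ (2 * ?u)) \<le> 3 * 2 ^ (2 * ?R + n + 2 * ?u)" .
    moreover have "(1::int) \<le> 2 ^ (2 * ?R + n + 2 * ?u)" by simp
    moreover have "(2::int) ^ (2 * ?R + n + 2 * ?u + 2) = 4 * 2 ^ (2 * ?R + n + 2 * ?u)" by simp
    ultimately show ?thesis unfolding u2 by linarith
  qed
  have "(1 + int n * (2 ^ ?u)\<^sup>2) ^ M * (1 + 3 * 4 ^ ?R * (int n * (2 ^ ?u)\<^sup>2)) ^ ?R \<le>
      (2 ^ (n + 2 * ?u)) ^ M * (2 ^ (2 * ?R + n + 2 * ?u + 2)) ^ ?R"
    by (intro mult_mono power_mono F1 F2) auto
  also have "\<dots> = 2 ^ ?D"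
    by (simp only: exp_D_def power_mult[symmetric] power_add[symmetric] mult.commute)
  finally show "(1 + int n * (2 ^ ?u)\<^sup>2) ^ M * (1 + 3 * 4 ^ ?R * (int n * (2 ^ ?u)\<^sup>2)) ^ ?R \<le> 2 ^ ?D" .
  have nlt: "int n * 2 ^ ?u < 2 ^ n * 2 ^ ?u" using nat_less_two_power_int[of n] by simp
  have "(int ?T + 1) * (2 ^ ?R * (int n * 2 ^ ?u * 2 ^ ?D)) * (int n * 2 ^ ?u) \<le>
      2 ^ ?T * (2 ^ ?R * (2 ^ n * 2 ^ ?u * 2 ^ ?D)) * (int n * 2 ^ ?u)"
    by (intro mult_mono nn) (use nlt in auto)
  also have "\<dots> < 2 ^ ?T * (2 ^ ?R * (2 ^ n * 2 ^ ?u * 2 ^ ?D)) * (2 ^ n * 2 ^ ?u)"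
    by (rule mult_strict_left_mono[OF nlt]) simp
  also have "\<dots> = 2 ^ exp_W M n l"
    unfolding power_add[symmetric] by (rule arg_cong[of _ _ "power 2"]) (simp add: exp_W_def)
  also have "\<dots> \<le> 2 ^ w" using w by (intro power_increasing) auto
  finally show "(int ?T + 1) * (2 ^ ?R * (int n * 2 ^ ?u * 2 ^ ?D)) * (int n * 2 ^ ?u) < 2 ^ w" .
  show "4 * M\<^sup>2 * (M + n) \<le> num_T M n" by (simp add: num_T_def power2_eq_square mult_ac)
  show "\<And>i j. i < M \<Longrightarrow> j < n \<Longrightarrow> \<bar>B i j\<bar> \<le> 2 ^ exp_u M n l" by (rule BU)
qed (use M1 n1 N in auto)

lemma wp_solve_cone:
  assumes M: "s vM 0 = int M" "1 \<le> M" and n: "s vn 0 = int n" "1 \<le> n"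
    and H: "\<And>i j. i < M \<Longrightarrow> j < n \<Longrightarrow> entry n (s aH) i j = H i j"
    and row0: "\<And>j. j < n \<Longrightarrow> H 0 j = of_bool (j = 0)"
    and VL0: "int (2 * n + M) + 2 * (\<Sum>i<M. \<Sum>j<n. (H i j)\<^sup>2) \<le> 2 ^ L"
    and zero: "\<And>y. s aB y = 0" "\<And>y. s aN y = 0" "\<And>y. s aS y = 0" "s vFlag 0 = 0"
    and N: "num_T M n \<le> N" "num_R M n L \<le> N" "n * n \<le> N" "M * n \<le> N" "L \<le> N" "exp_e M n L + M \<le> N"
      "2 * n + M \<le> N"
    and w: "exp_W M n L \<le> w" "N < w"
    and post: "\<And>s'. frame (writes solve_cone) s s' \<Longrightarrow> s' vFlag 0 = of_bool (cone_feasible M n H) \<Longrightarrow> Q s'"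
  shows "wp N w solve_cone Q s"
proof -
  define c where "c = 2 * n + M"
  define Vv where "Vv = int c + 2 * (\<Sum>i<M. \<Sum>j<n. (H i j)\<^sup>2)"
  interpret cone_problem M n H c Vv
    by standard (use M n row0 in \<open>auto simp: c_def Vv_def\<close>)
  have Nw: "N < 2 ^ w" using w(2) less_exp[of w] by (rule less_trans)
  have iN: "int x < 2 ^ w" if "x \<le> N" for x
    using that w(2) nat_less_two_power_int[of w] by linarith
  have Lw: "(2::int) ^ L < 2 ^ w" using N w by (intro power_strict_increasing) auto
  have w1: "(1::int) < 2 ^ w" using Lw one_le_power[of "2::int" L] by linarith
  have flat: "(\<Sum>x<M * n. (s aH (int x))\<^sup>2) = (\<Sum>i<M. \<Sum>j<n. (H i j)\<^sup>2)"
  proof -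
    have "(\<Sum>i<M. \<Sum>j<n. (H i j)\<^sup>2) = (\<Sum>i<M. \<Sum>x = i * n..<i * n + n. (s aH (int x))\<^sup>2)"
    proof (rule sum.cong[OF refl])
      fix i assume "i \<in> {..<M}"
      then have "(\<Sum>j<n. (H i j)\<^sup>2) = (\<Sum>j<n. (s aH (int (i * n + j)))\<^sup>2)"
        using H[of i] by (intro sum.cong) (auto simp: entry_def)
      also have "\<dots> = (\<Sum>x = i * n..<i * n + n. (s aH (int x))\<^sup>2)"
        using sum.shift_bounds_nat_ivl[of "\<lambda>x. (s aH (int x))\<^sup>2" 0 "i * n" n]
        by (simp add: lessThan_atLeast0 add.commute)
      finally show "(\<Sum>j<n. (H i j)\<^sup>2) = (\<Sum>x = i * n..<i * n + n. (s aH (int x))\<^sup>2)" .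
    qed
    also have "\<dots> = (\<Sum>x<M * n. (s aH (int x))\<^sup>2)" by (rule sum.nat_group)
    finally show ?thesis by simp
  qed
  show ?thesis
    unfolding solve_cone_def perturb_def
  proof (rule wp_Seq, rule wp_Seq, rule wp_Assign, goal_cases)
    case 1
    show ?case using M n iN[OF N(7)] by simp
  next
    case 2
    let ?s1 = "s(vc := (s vc)(aval (Const 0) s := aval (Plus (Times (Const 2) (Var vn)) (Var vM)) s))"
    show ?case
    proof (rule wp_Seq, rule wp_Sum[where n = "M * n" and f = "\<lambda>x. (s aH (int x))\<^sup>2"], goal_cases)
      case (1 s')
      then show ?case using M n by (simp add: frame_def)
    next
      case (2 x s')
      then show ?case by (simp add: frame_def power2_eq_square)
    next
      case (6 k)
      have "\<bar>\<Sum>x<k. (s aH (int x))\<^sup>2\<bar> = (\<Sum>x<k. (s aH (int x))\<^sup>2)" by (simp add: sum_nonneg)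
      also have "\<dots> \<le> (\<Sum>x<M * n. (s aH (int x))\<^sup>2)" by (rule sum_mono2) (use 6 in auto)
      also have "\<dots> \<le> 2 ^ L" using VL0 sq_nonneg unfolding flat by linarith
      finally show ?case using Lw by linarith
    next
      case (7 s2)
      have e2: "s2 vn = s vn" "s2 vM = s vM" "s2 vc 0 = int c" "s2 aH = s aH"
        using 7(1) M n by (auto simp: frame_def c_def)
      have V2: "s2 vc 0 + 2 * s2 vV 0 = Vv" using 7(2) e2 by (simp add: flat Vv_def)
      have VL: "Vv \<le> 2 ^ L" using VL0 by (simp add: Vv_def c_def)
      show ?case
      proof (rule wp_Seq, rule wp_Assign, goal_cases)
        case 1
        have "Vv < 2 ^ w" using VL Lw by linarith
        then show ?case using V2 V1 by simp
      next
        case 2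
        let ?s3 = "s2(vV := (s2 vV)(aval (Const 0) s2 := aval (Plus (Var vc) (Times (Const 2) (Var vV))) s2))"
        show ?case
        proof (rule wp_Seq, rule wp_bit_length[where L = L], goal_cases)
          case 1
          then show ?case using V2 VL by simp
        next
          case (4 s4 l)
          define e where "e = exp_e M n l"
          have lV: "Vv \<le> 2 ^ l" using 4(4) V2 by simp
          have e4: "s4 vn 0 = int n" "s4 vM 0 = int M" "s4 vc 0 = int c" "s4 aH = s aH"
            using 4(1) M n e2 by (auto simp: frame_def)
          have fr4: "frame (writes perturb) s s4"
            using 4(1) 7(1) by (auto simp: frame_def)
          have eN: "e + M \<le> N" "num_R M n l \<le> N" using N exp_mono[OF 4(3), of M n] unfolding e_def by linarith+
          have e_eq: "int c * (int c + int l) = int e" by (simp add: e_def exp_e_def c_def)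
          let ?s5 = "s4(ve := (s4 ve)(0 := int e), vE := (s4 vE)(0 := 1))"
          have "wp N w (For vi (Plus (Var ve) (Var vM)) (Set vE (Times (Const 2) (Var vE))) ;;
            For vi (Times (Var vM) (Var vn)) (Assign aB (Var vi) (Times (Var vE) (Cell aH (Var vi)))) ;;
            For vi (Var vM) (Assign aB (Times (Var vi) (Var vn)) (Plus (Cell aB (Times (Var vi) (Var vn))) (Const 1))) ;;
            Set vT (Times (Const 4) (Times (Times (Var vM) (Var vM)) (Plus (Var vM) (Var vn)))) ;;
            Set vR (Plus (Times (Var vM) (Plus (Plus (Plus (Plus (Plus (Var ve) (Var vM)) (Var vn)) (Var vl)) (Var ve)) (Const 1))) (Const 1)))
            (wp N w core Q) ?s5"
          proof (rule wp_Seq, rule wp_For[where n = "e + M" and I = "\<lambda>k s'. s' vE 0 = 2 ^ k"], goal_cases)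
            case (1 s')
            then show ?case using e4 by (simp add: frame_def)
          next
            case (6 k s')
            have "exp_e M n l + M \<le> exp_W M n l" by (simp add: exp_W_def exp_u_def)
            then have "Suc k \<le> w" using 6(1) w exp_mono(6)[OF 4(3), of M n] unfolding e_def by linarith
            moreover have "Suc k \<noteq> w" using 6(1) eN w by linarith
            ultimately have "(2::int) ^ Suc k < 2 ^ w" by (intro power_strict_increasing) auto
            then show ?case using 6(4) by (intro wp_Assign) auto
          next
            case (7 s6)
            define E :: int where "E = 2 ^ (e + M)"
            have e6: "s6 vn 0 = int n" "s6 vM 0 = int M" "s6 aH = s aH" "s6 ve 0 = int e" "s6 vl 0 = int l" "s6 vE 0 = E"
              "s6 aB = s aB"
              using 7 e4 4(2) 4(1) fr4 e2 \<open>frame _ _ s2\<close> by (auto simp: frame_def E_def)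
            have fr6: "frame (writes perturb) s s6" using 7(1) fr4 by (auto simp: frame_def)
            define B where "B i j = E * H i j + of_bool (j = 0)" for i j
            interpret cone_perturbed M n H c Vv l e "exp_ts M n l" E B
              by standard (use lV in \<open>auto simp: e_def exp_e_def c_def E_def exp_ts_def B_def\<close>)
            have Eu: "E * 2 ^ l = 2 ^ exp_u M n l"
              by (simp add: E_def exp_u_def e_def power_add)
            have E1: "1 \<le> E" by (simp add: E_def)
            have HB: "\<bar>E * H i j\<bar> + 1 \<le> 2 ^ exp_u M n l" if "i < M" "j < n" for i j
            proof -
              have "\<bar>H i j\<bar> + 1 \<le> 2 ^ l" using H_less[OF that] lV by linarith
              then have "E * (\<bar>H i j\<bar> + 1) \<le> E * 2 ^ l" using E1 by (intro mult_left_mono) auto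
              then show ?thesis unfolding Eu using E1 by (simp add: abs_mult algebra_simps)
            qed
            have uw: "(2::int) ^ exp_u M n l \<le> 2 ^ w"
              using w exp_mono(6)[OF 4(3), of M n] by (intro power_increasing) (auto simp: exp_W_def)
            show ?case
            proof (rule wp_Seq, rule wp_Fill[where n = "M * n" and a = aB and g = "\<lambda>x. E * H (x div n) (x mod n)"], goal_cases)
              case (1 s')
              then show ?case using e6 by (simp add: frame_def)
            next
              case (6 x s')
              have lt: "x div n < M" "x mod n < n"
                using 6(1) n by (auto simp: less_mult_imp_div_less)
              have "entry n (s aH) (x div n) (x mod n) = s aH (int x)"
                unfolding entry_def by (metis div_mult_mod_eq of_nat_add of_nat_mult)
              then have "s' aH (int x) = H (x div n) (x mod n)"
                using H[OF lt] 6(2) e6 by (simp add: frame_def)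
              moreover have "s' vE 0 = E" using 6(2) e6 by (simp add: frame_def)
              moreover have "\<bar>E * H (x div n) (x mod n)\<bar> < 2 ^ w" using HB[OF lt] uw by linarith
              ultimately show ?case using 6(3) by (intro wp_Assign) auto
            next
              case (7 s7)
              have e7: "s7 vn 0 = int n" "s7 vM 0 = int M" "s7 ve 0 = int e" "s7 vl 0 = int l"
                using 7(1) e6 by (auto simp: frame_def)
              have B7: "entry n (s7 aB) i j = E * H i j" if "i < M" "j < n" for i j
                using entry_Fill[OF 7(2) that] that by simp
              show ?case
              proof (rule wp_Seq, rule wp_For[where n = M and
                  I = "\<lambda>k s'. \<forall>i<M. \<forall>j<n. entry n (s' aB) i j = E * H i j + of_bool (j = 0 \<and> i < k)"], goal_cases)
                case (1 s')
                then show ?case using e7 by (simp add: frame_def)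
              next
                case 5
                show ?case using B7 by simp
              next
                case (6 i s')
                have n': "s' vn 0 = int n" using 6(2) e7 by (simp add: frame_def)
                have "entry n (s' aB) i 0 = E * H i 0"
                  using 6(1,4) n by simp
                then have old: "s' aB (int i * int n) = E * H i 0" by (simp add: entry_def)
                \<comment> \<open>\<open>HB\<close> gives only a weak inequality with 2^exp_u; it
                  becomes strict because w is at least \<open>exp_W\<close>, which exceeds
                  \<open>exp_u\<close>.\<close>
                have "\<bar>E * H i 0 + 1\<bar> < 2 ^ w"
                proof (rule ccontr)
                  assume "\<not> ?thesis"
                  then have "\<bar>E * H i 0\<bar> + 1 = 2 ^ w" "\<bar>E * H i 0\<bar> + 1 = 2 ^ exp_u M n l"
                    using HB[of i 0] 6(1) n uw by linarith+
                  then have "w = exp_u M n l" by simp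
                  then show False using w exp_mono(6)[OF 4(3), of M n] n by (simp add: exp_W_def)
                qed
                moreover have "int i' * int n + int j = int i * int n \<longleftrightarrow> i' = i \<and> j = 0" if "j < n" for i' j
                  using idx_eq_iff[of j n 0 i' i] that n by simp
                ultimately show ?case
                  using 6(3,4) n' old by (intro wp_Assign) (auto simp: entry_def less_Suc_eq)
              next
                case (7 s8)
                have e8: "s8 vn 0 = int n" "s8 vM 0 = int M" "s8 ve 0 = int e" "s8 vl 0 = int l"
                  using 7(1) e7 by (auto simp: frame_def)
                have B8: "entry n (s8 aB) i j = B i j" if "i < M" "j < n" for i j
                  using 7(3) that by (simp add: B_def)
                have fr8: "frame (writes perturb) s s8"
                  using 7(1) \<open>frame _ s6 s7\<close> fr6 by (auto simp: frame_def)
                have BU: "\<bar>B i j\<bar> \<le> 2 ^ exp_u M n l" if "i < M" "j < n" for i j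
                proof -
                  have "\<bar>of_bool (j = 0) :: int\<bar> \<le> 1" by simp
                  then show ?thesis using HB[OF that] unfolding B_def by linarith
                qed
                interpret core_params B M n "num_T M n" "num_R M n l" N w "2 ^ exp_u M n l" "2 ^ exp_D M n l"
                  by (rule core_params_exp[OF M(2) n(2) BU]) (use N eN w exp_mono(6)[OF 4(3), of M n] Nw in auto)
                let ?s9 = "s8(vT := (s8 vT)(0 := int (num_T M n)), vR := (s8 vR)(0 := int (num_R M n l)))"
                have "static ?s9" using e8 B8 by (simp add: static_def)
                then have "wp N w core Q ?s9"
                proof (rule wp_core, goal_cases)
                  case (4 s')
                  \<comment> \<open>A set flag comes with a solution of the perturbed system, which
                    exists only for a feasible cone; an unset one comes with exponents of sum M ts +
                    1, which the gap excludes for a feasible cone.\<close>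
                  have "s' vFlag 0 = of_bool (cone_feasible M n H)"
                  proof (cases "cone_feasible M n H")
                    case True
                    have False if ex: "(\<Sum>i<M. ex i) = num_R M n l"
                      "\<forall>x. box x \<longrightarrow> (\<forall>i<M. 2 ^ ex i * dot n (\<lambda>j. real_of_int (B i j)) x \<le> 1)" for ex
                    proof (rule scaling_contradiction[OF True])
                      show "(\<Sum>i<M. ex i) = M * exp_ts M n l + 1" using ex(1) by (simp only: num_R_def)
                    qed (use ex(2) in \<open>unfold box_def, blast\<close>)
                    then have "s' vFlag 0 = 1" using 4(2) by blast
                    then show ?thesis using True by simp
                  next
                    case False
                    then have "\<not> feas" using perturbed_feasible_imp unfolding feas_def by blast
                    then have "s' vFlag 0 = 0" using 4(2) by blast
                    then show ?thesis using False by simp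
                  qed
                  moreover have "frame (writes solve_cone) s s'"
                    using 4(1) fr8 by (auto simp: frame_def solve_cone_def)
                  ultimately show ?case by (intro post)
                qed (use fr8 zero in \<open>auto simp: frame_def cell_def\<close>)
                moreover have "4 * (int M * int M * (int M + int n)) = int (num_T M n)" by (simp add: num_T_def)
                moreover have "int M * (int e + int M + int n + int l + int e + 1) + 1 = int (num_R M n l)"
                  by (simp add: num_R_def exp_ts_def e_def algebra_simps)
                ultimately show ?case
                  using iN[OF N(1)] iN[OF eN(2)]
                  by - (rule wp_Seq, rule wp_Assign, simp add: e8, rule wp_Assign, simp_all add: e8)
              qed (use N Nw in auto)
            qed (use N Nw in auto)
          qed (use eN Nw in auto)
          note rest = this
          have v: "aval (Times (Var vc) (Plus (Var vc) (Var vl))) s4 = int e" using e_eq e4 4(2) by simp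
          show ?case
          proof (rule wp_Seq, rule wp_Assign, goal_cases)
            case 1
            show ?case unfolding v using iN[of e] eN by simp
          next
            case 2
            show ?case unfolding v
            proof (rule wp_Seq, rule wp_Assign, goal_cases)
              case 1
              show ?case using w1 by simp
            next
              case 2
              show ?case using rest by simp
            qed
          qed
        qed (use N w in auto)
      qed
    qed (use N Nw in auto)
  qed
qed

section \<open>Duality for the inverse problem\<close>

locale inverse_lp =
  fixes m n k g :: nat and a C D :: "nat \<Rightarrow> nat \<Rightarrow> real" and b c d y :: "nat \<Rightarrow> real"
begin

definition cost :: "(nat \<Rightarrow> real) \<Rightarrow> nat \<Rightarrow> real" where
  "cost x j = dot k (C j) x + c j"

definition param :: "(nat \<Rightarrow> real) \<Rightarrow> bool" where
  "param x \<longleftrightarrow> (\<forall>i<g. dot k (D i) x \<le> d i)"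

definition lp_feasible :: "(nat \<Rightarrow> real) \<Rightarrow> bool" where
  "lp_feasible z \<longleftrightarrow> (\<forall>i<m. dot n (a i) z \<le> b i)"

definition lp_optimal :: "(nat \<Rightarrow> real) \<Rightarrow> (nat \<Rightarrow> real) \<Rightarrow> bool" where
  "lp_optimal x z \<longleftrightarrow> lp_feasible z \<and> (\<forall>u. lp_feasible u \<longrightarrow> dot n (cost x) z \<le> dot n (cost x) u)"

text \<open>Slack rows are replaced by zero rows, so sums with multipliers may range over all
  rows.\<close>

definition tight :: "nat \<Rightarrow> nat \<Rightarrow> real" where
  "tight i j = (if dot n (a i) y = b i then a i j else 0)"

text \<open>The multipliers \<open>\<Lambda> r\<close> certify optimality of \<open>y\<close> for the cost shifted by \<open>\<alpha> t\<close> in the \<open>r\<close>-th of the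
  \<open>2 n\<close> signed coordinate directions; \<open>\<tau>\<close> homogenises the parameter \<open>x = X / \<tau>\<close>.\<close>

definition dir :: "nat \<Rightarrow> nat \<Rightarrow> real" where
  "dir r j = (if j = r div 2 then (if even r then 1 else -1) else 0)"

definition dual_system :: "real \<Rightarrow> bool" where
  "dual_system \<alpha> \<longleftrightarrow> (\<exists>X \<tau> t \<Lambda>. 0 < t \<and> t \<le> \<tau> \<and> (\<forall>i<g. dot k (D i) X \<le> d i * \<tau>) \<and>
    (\<forall>r<2 * n. \<forall>i<m. 0 \<le> \<Lambda> r i) \<and>
    (\<forall>r<2 * n. \<forall>j<n. dot k (C j) X + c j * \<tau> + \<alpha> * t * dir r j + (\<Sum>i<m. \<Lambda> r i * tight i j) = 0))"

lemma dual_systemE: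
  assumes "dual_system \<alpha>"
  obtains X \<tau> t \<Lambda> where "0 < t" "t \<le> \<tau>" "\<And>i. i < g \<Longrightarrow> dot k (D i) X \<le> d i * \<tau>"
    "\<And>r i. r < 2 * n \<Longrightarrow> i < m \<Longrightarrow> 0 \<le> \<Lambda> r i"
    "\<And>r j. r < 2 * n \<Longrightarrow> j < n \<Longrightarrow>
      dot k (C j) X + c j * \<tau> + \<alpha> * t * dir r j + (\<Sum>i<m. \<Lambda> r i * tight i j) = 0"
proof -
  from assms[unfolded dual_system_def] obtain X \<tau> t \<Lambda> where "0 < t \<and> t \<le> \<tau> \<and> (\<forall>i<g. dot k (D i) X \<le> d i * \<tau>) \<and>
    (\<forall>r<2 * n. \<forall>i<m. 0 \<le> \<Lambda> r i) \<and>
    (\<forall>r<2 * n. \<forall>j<n. dot k (C j) X + c j * \<tau> + \<alpha> * t * dir r j + (\<Sum>i<m. \<Lambda> r i * tight i j) = 0)"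
    by (elim exE)
  then show thesis by (intro that[of t \<tau> X \<Lambda>]) blast+
qed

lemma dot_add_scaled: "dot n f (\<lambda>j. u j + e * w j) = dot n f u + e * dot n f w" for f u w :: "nat \<Rightarrow> real"
  by (simp add: algebra_simps sum.distrib sum_distrib_left)

text \<open>A direction that increases no tight row can be followed a little: tight rows stay
  satisfied, slack rows have room, and the smallest of the finitely many admissible step lengths
  works for all.\<close>

lemma feasible_direction:
  assumes y: "lp_feasible y" and w: "\<And>i. i < m \<Longrightarrow> dot n (tight i) w \<le> 0"
  shows "\<exists>e>0. lp_feasible (\<lambda>j. y j + e * w j)"
proof -
  have "\<exists>e0>0. \<forall>e. 0 < e \<and> e \<le> e0 \<longrightarrow> (\<forall>i<p. dot n (a i) (\<lambda>j. y j + e * w j) \<le> b i)" if "p \<le> m" for p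
    using that
  proof (induction p)
    case 0
    show ?case by (rule exI[of _ 1]) simp
  next
    case (Suc p)
    then obtain e0 where e0: "e0 > 0" "\<And>e i. 0 < e \<Longrightarrow> e \<le> e0 \<Longrightarrow> i < p \<Longrightarrow> dot n (a i) (\<lambda>j. y j + e * w j) \<le> b i"
      by auto
    let ?ay = "dot n (a p) y" and ?aw = "dot n (a p) w"
    have le: "?ay \<le> b p" using y Suc.prems by (simp add: lp_feasible_def)
    \<comment> \<open>The slack of the row divided by its rate of change; adding 1 keeps the
      denominator positive.\<close>
    define e1 where "e1 = (if ?ay = b p then 1 else (b p - ?ay) / (\<bar>?aw\<bar> + 1))"
    have "e1 > 0" using le by (auto simp: e1_def)
    moreover have "?ay + e * ?aw \<le> b p" if e: "0 < e" "e \<le> e1" for e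
    proof (cases "?ay = b p")
      case True
      then have "tight p = a p" by (auto simp: tight_def)
      then have "?aw \<le> 0" using w[of p] Suc.prems by simp
      then show ?thesis using e True by (simp add: mult_nonneg_nonpos)
    next
      case False
      have "e * ?aw \<le> e * (\<bar>?aw\<bar> + 1)" using e by (intro mult_left_mono) auto
      also have "\<dots> \<le> e1 * (\<bar>?aw\<bar> + 1)" using e by (intro mult_right_mono) auto
      also have "\<dots> = b p - ?ay" using False by (simp add: e1_def)
      finally show ?thesis by simp
    qed
    ultimately show ?case using e0
      by (intro exI[of _ "min e0 e1"]) (auto simp: less_Suc_eq dot_add_scaled)
  qed
  from this[of m] obtain e0 where "e0 > 0" "\<And>e i. 0 < e \<Longrightarrow> e \<le> e0 \<Longrightarrow> i < m \<Longrightarrow> dot n (a i) (\<lambda>j. y j + e * w j) \<le> b i"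
    by auto
  then show ?thesis unfolding lp_feasible_def by (intro exI[of _ e0]) auto
qed

text \<open>At an optimum no feasible direction decreases the cost, which is the hypothesis of
  Farkas' lemma for the negated cost and the tight rows.\<close>

lemma optimal_multipliers:
  assumes opt: "lp_optimal x y"
  shows "\<exists>l. (\<forall>i<m. 0 \<le> l i) \<and> (\<forall>j<n. cost x j + (\<Sum>i<m. l i * tight i j) = 0)"
proof -
  have "\<exists>l. (\<forall>i<m. 0 \<le> l i) \<and> (\<forall>j<n. - cost x j = (\<Sum>i<m. l i * tight i j))"
  proof (rule farkas)
    fix w assume w: "\<And>i. i < m \<Longrightarrow> (\<Sum>j<n. tight i j * w j) \<le> 0"
    from opt have y: "lp_feasible y" by (simp add: lp_optimal_def)
    from feasible_direction[OF y w] obtain e where e: "e > 0" "lp_feasible (\<lambda>j. y j + e * w j)" by blast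
    then have "dot n (cost x) y \<le> dot n (cost x) (\<lambda>j. y j + e * w j)" using opt by (simp add: lp_optimal_def)
    then have "0 \<le> e * dot n (cost x) w" unfolding dot_add_scaled by simp
    then have "0 \<le> dot n (cost x) w" using e by (simp add: zero_le_mult_iff)
    then show "(\<Sum>j<n. - cost x j * w j) \<le> 0" by (simp add: sum_negf)
  qed
  then obtain l where l: "\<forall>i<m. 0 \<le> l i" "\<And>j. j < n \<Longrightarrow> - cost x j = (\<Sum>i<m. l i * tight i j)" by blast
  have "cost x j + (\<Sum>i<m. l i * tight i j) = 0" if "j < n" for j
    unfolding l(2)[OF that, symmetric] by simp
  then show ?thesis using l(1) by blast
qed

lemma tight_dot_le:
  assumes "lp_feasible u" "i < m"
  shows "dot n (tight i) (\<lambda>j. u j - y j) \<le> 0"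
proof (cases "dot n (a i) y = b i")
  case True
  then have "tight i = a i" by (auto simp: tight_def)
  moreover have "dot n (a i) (\<lambda>j. u j - y j) = dot n (a i) u - dot n (a i) y"
    by (simp add: right_diff_distrib sum_subtractf)
  ultimately show ?thesis using True assms by (simp add: lp_feasible_def)
qed (simp add: tight_def)

text \<open>Weak duality: f is a nonpositive combination of the tight rows, none of which increases
  from y to a feasible u. It is stated for any f so as to cover the shifted costs.\<close>

lemma multiplier_bound:
  assumes "\<And>i. i < m \<Longrightarrow> 0 \<le> l i" and "\<And>j. j < n \<Longrightarrow> f j + (\<Sum>i<m. l i * tight i j) = 0"
    and u: "lp_feasible u"
  shows "0 \<le> dot n f (\<lambda>j. u j - y j)"
proof -
  have "dot n f (\<lambda>j. u j - y j) = (\<Sum>j<n. - (\<Sum>i<m. l i * tight i j) * (u j - y j))"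
  proof (rule sum.cong[OF refl])
    fix j assume "j \<in> {..<n}"
    then have "f j = - (\<Sum>i<m. l i * tight i j)" using assms(2)[of j] by (simp add: eq_neg_iff_add_eq_0)
    then show "f j * (u j - y j) = - (\<Sum>i<m. l i * tight i j) * (u j - y j)" by simp
  qed
  also have "\<dots> = - (\<Sum>i<m. l i * dot n (tight i) (\<lambda>j. u j - y j))"
    unfolding sum_distrib_left sum_distrib_right sum_negf[symmetric] minus_mult_left[symmetric]
    by (subst sum.swap) (simp add: mult_ac)
  also have "\<dots> \<ge> 0"
    using sum_nonpos[of "{..<m}" "\<lambda>i. l i * dot n (tight i) (\<lambda>j. u j - y j)"] assms(1) tight_dot_le[OF u]
    by (simp add: mult_nonneg_nonpos)
  finally show ?thesis by simp
qed

lemma param_scale: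
  assumes "0 < \<tau>" and "\<And>i. i < g \<Longrightarrow> dot k (D i) X \<le> d i * \<tau>"
  shows "param (\<lambda>l. X l / \<tau>)"
  unfolding param_def
proof (intro allI impI)
  fix i assume "i < g"
  moreover have "dot k (D i) (\<lambda>l. X l / \<tau>) = dot k (D i) X / \<tau>" by (simp add: sum_divide_distrib)
  ultimately show "dot k (D i) (\<lambda>l. X l / \<tau>) \<le> d i" using assms by (simp add: pos_divide_le_eq)
qed

lemma cost_scale:
  assumes "0 < \<tau>"
  shows "dot k (C j) X + c j * \<tau> = \<tau> * cost (\<lambda>l. X l / \<tau>) j"
proof -
  have "dot k (C j) (\<lambda>l. X l / \<tau>) = dot k (C j) X / \<tau>" by (simp add: sum_divide_distrib)
  then show ?thesis using assms by (simp add: cost_def field_simps)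
qed

text \<open>For \<alpha> = 0 the 2 n blocks of equations coincide, so the multipliers of one optimal
  solution serve all of them, with X = x and \<tau> = t = 1. For the converse a single block
  suffices; with n = 0 there is none, but then every cost is 0.\<close>

theorem optimistic_iff_dual_system:
  "(\<exists>x. param x \<and> lp_optimal x y) \<longleftrightarrow> lp_feasible y \<and> dual_system 0"
proof (intro iffI conjI)
  assume "\<exists>x. param x \<and> lp_optimal x y"
  then obtain x where x: "param x" "lp_optimal x y" by blast
  then show "lp_feasible y" by (simp add: lp_optimal_def)
  from optimal_multipliers[OF x(2)] obtain l where
    "\<And>i. i < m \<Longrightarrow> 0 \<le> l i" "\<And>j. j < n \<Longrightarrow> cost x j + (\<Sum>i<m. l i * tight i j) = 0" by blast
  then show "dual_system 0"
    unfolding dual_system_def using x(1)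
    by (intro exI[of _ x] exI[of _ 1] exI[of _ "\<lambda>_. l"]) (auto simp: param_def cost_def)
next
  assume *: "lp_feasible y \<and> dual_system 0"
  then have y: "lp_feasible y" ..
  obtain X \<tau> t \<Lambda> where t: "0 < t" "t \<le> \<tau>"
    and X: "\<And>i. i < g \<Longrightarrow> dot k (D i) X \<le> d i * \<tau>"
    and L: "\<And>r i. r < 2 * n \<Longrightarrow> i < m \<Longrightarrow> 0 \<le> \<Lambda> r i"
    "\<And>r j. r < 2 * n \<Longrightarrow> j < n \<Longrightarrow> dot k (C j) X + c j * \<tau> + 0 * t * dir r j + (\<Sum>i<m. \<Lambda> r i * tight i j) = 0"
    by (rule dual_systemE[OF conjunct2[OF *]], rule that)
  have \<tau>: "\<tau> > 0" using t by simp
  let ?x = "\<lambda>l. X l / \<tau>"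
  have "dot n (cost ?x) y \<le> dot n (cost ?x) u" if u: "lp_feasible u" for u
  proof (cases "n = 0")
    case False
    then have "0 < 2 * n" by simp
    have "0 \<le> dot n (\<lambda>j. \<tau> * cost ?x j) (\<lambda>j. u j - y j)"
      by (rule multiplier_bound[OF L(1)[OF \<open>0 < 2 * n\<close>] _ u])
        (use L(2)[OF \<open>0 < 2 * n\<close>] cost_scale[OF \<tau>] in auto)
    also have "\<dots> = \<tau> * (dot n (cost ?x) u - dot n (cost ?x) y)"
      by (simp add: right_diff_distrib sum_subtractf sum_distrib_left mult.assoc)
    finally show ?thesis using \<tau> by (simp add: zero_le_mult_iff)
  qed simp
  then show "\<exists>x. param x \<and> lp_optimal x y"
    using param_scale[OF \<tau> X] y unfolding lp_optimal_def by blast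
qed

text \<open>Farkas' lemma with the cost as an additional row of index m. A direction that increases
  neither a tight row nor the cost leads to another optimal point, hence is 0 by uniqueness; so the
  rows generate all functionals, in particular the negated coordinate direction.\<close>

lemma unique_multipliers:
  assumes opt: "lp_optimal x y" and uniq: "\<And>z j. lp_optimal x z \<Longrightarrow> j < n \<Longrightarrow> z j = y j"
  shows "\<exists>l mu. 0 \<le> mu \<and> (\<forall>i<m. 0 \<le> l i) \<and>
    (\<forall>j<n. dir r j + mu * cost x j + (\<Sum>i<m. l i * tight i j) = 0)"
proof -
  let ?v = "\<lambda>i. if i < m then tight i else cost x"
  have "\<exists>l. (\<forall>i<Suc m. 0 \<le> l i) \<and> (\<forall>j<n. - dir r j = (\<Sum>i<Suc m. l i * ?v i j))"
  proof (rule farkas)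
    fix w assume w: "\<And>i. i < Suc m \<Longrightarrow> (\<Sum>j<n. ?v i j * w j) \<le> 0"
    from opt have y: "lp_feasible y" by (simp add: lp_optimal_def)
    have wt: "dot n (tight i) w \<le> 0" if "i < m" for i using w[of i] that by simp
    have wc: "dot n (cost x) w \<le> 0" using w[of m] by simp
    from feasible_direction[OF y wt] obtain e where e: "e > 0" "lp_feasible (\<lambda>j. y j + e * w j)" by blast
    have "e * dot n (cost x) w \<le> 0" using e wc by (simp add: mult_nonneg_nonpos)
    then have "lp_optimal x (\<lambda>j. y j + e * w j)"
      using opt e unfolding lp_optimal_def dot_add_scaled by force
    then have "y j + e * w j = y j" if "j < n" for j using uniq that by blast
    then have "w j = 0" if "j < n" for j using e that by fastforce
    then show "(\<Sum>j<n. - dir r j * w j) \<le> 0" by simp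
  qed
  then obtain l where l: "\<And>i. i < Suc m \<Longrightarrow> 0 \<le> l i" "\<And>j. j < n \<Longrightarrow> - dir r j = (\<Sum>i<Suc m. l i * ?v i j)"
    by blast
  have "dir r j + l m * cost x j + (\<Sum>i<m. l i * tight i j) = 0" if "j < n" for j
    using l(2)[OF that] by simp
  then show ?thesis using l(1) by (intro exI[of _ l] exI[of _ "l m"]) auto
qed

text \<open>Forward, the multipliers for the different directions carry different multiples mu r of
  the cost and have to be brought to a common \<tau>. Backward, optimality of y for the costs
  shifted in both directions of coordinate j bounds |u_j - y_j| by a multiple of the loss of u, so a
  second optimum equals y.\<close>

theorem pessimistic_iff_dual_system:
  "(\<exists>x. param x \<and> lp_optimal x y \<and> (\<forall>z. lp_optimal x z \<longrightarrow> (\<forall>j<n. z j = y j))) \<longleftrightarrow>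
    lp_feasible y \<and> dual_system 1"
proof (intro iffI conjI)
  assume "\<exists>x. param x \<and> lp_optimal x y \<and> (\<forall>z. lp_optimal x z \<longrightarrow> (\<forall>j<n. z j = y j))"
  then obtain x where x: "param x" "lp_optimal x y" and uniq: "\<And>z j. lp_optimal x z \<Longrightarrow> j < n \<Longrightarrow> z j = y j"
    by blast
  then show "lp_feasible y" by (simp add: lp_optimal_def)
  from optimal_multipliers[OF x(2)] obtain l0 where
    l0: "\<And>i. i < m \<Longrightarrow> 0 \<le> l0 i" "\<And>j. j < n \<Longrightarrow> cost x j + (\<Sum>i<m. l0 i * tight i j) = 0" by blast
  have "\<exists>l mu. 0 \<le> mu \<and> (\<forall>i<m. 0 \<le> l i) \<and>
    (\<forall>j<n. dir r j + mu * cost x j + (\<Sum>i<m. l i * tight i j) = 0)" for r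
    by (rule unique_multipliers[OF x(2)]) (rule uniq)
  then obtain l mu where lm: "\<And>r. 0 \<le> mu r" "\<And>r i. i < m \<Longrightarrow> 0 \<le> l r i"
    "\<And>r j. j < n \<Longrightarrow> dir r j + mu r * cost x j + (\<Sum>i<m. l r i * tight i j) = 0"
    by metis
  \<comment> \<open>A common multiple of the cost for all directions; the 1 keeps it at least t =
    1.\<close>
  define \<tau> where "\<tau> = 1 + (\<Sum>r<2 * n. mu r)"
  have \<tau>: "1 \<le> \<tau>" unfolding \<tau>_def using lm(1) by (simp add: sum_nonneg)
  have mu_le: "mu r \<le> \<tau>" if "r < 2 * n" for r
    unfolding \<tau>_def using member_le_sum[of r "{..<2 * n}" mu] that lm(1) by force
  \<comment> \<open>The missing multiple \<tau> - mu r of the cost is supplied by the multipliers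
    \<open>l0\<close> of plain optimality.\<close>
  define \<Lambda> where "\<Lambda> r i = l r i + (\<tau> - mu r) * l0 i" for r i
  have L0: "0 \<le> \<Lambda> r i" if "r < 2 * n" "i < m" for r i
    unfolding \<Lambda>_def using lm(2)[OF that(2)] l0(1)[OF that(2)] mu_le[OF that(1)] by (simp add: add_nonneg_nonneg)
  have "dot k (C j) (\<lambda>i. \<tau> * x i) + c j * \<tau> = \<tau> * cost x j" for j
    by (simp add: cost_def algebra_simps sum_distrib_left)
  moreover have "\<tau> * cost x j + dir r j + (\<Sum>i<m. \<Lambda> r i * tight i j) = 0" if "j < n" for r j
  proof -
    have "(\<Sum>i<m. \<Lambda> r i * tight i j) = (\<Sum>i<m. l r i * tight i j) + (\<tau> - mu r) * (\<Sum>i<m. l0 i * tight i j)"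
      by (simp add: \<Lambda>_def distrib_right sum.distrib sum_distrib_left mult.assoc)
    moreover have "(\<Sum>i<m. l r i * tight i j) = - dir r j - mu r * cost x j" using lm(3)[OF that, of r] by linarith
    moreover have "(\<Sum>i<m. l0 i * tight i j) = - cost x j" using l0(2)[OF that] by linarith
    ultimately show ?thesis by (simp add: algebra_simps)
  qed
  moreover have "dot k (D i) (\<lambda>i. \<tau> * x i) \<le> d i * \<tau>" if "i < g" for i
  proof -
    have "dot k (D i) (\<lambda>i. \<tau> * x i) = \<tau> * dot k (D i) x" by (simp add: sum_distrib_left mult_ac)
    also have "\<dots> \<le> \<tau> * d i" using x(1) that \<tau> by (intro mult_left_mono) (auto simp: param_def)
    finally show ?thesis by (simp add: mult.commute)
  qed
  ultimately show "dual_system 1"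
    unfolding dual_system_def using L0 \<tau>
    by (intro exI[of _ "\<lambda>i. \<tau> * x i"] exI[of _ \<tau>] exI[of _ 1] exI[of _ \<Lambda>]) simp
next
  assume *: "lp_feasible y \<and> dual_system 1"
  then have y: "lp_feasible y" ..
  obtain X \<tau> t \<Lambda> where t: "0 < t" "t \<le> \<tau>"
    and X: "\<And>i. i < g \<Longrightarrow> dot k (D i) X \<le> d i * \<tau>"
    and L: "\<And>r i. r < 2 * n \<Longrightarrow> i < m \<Longrightarrow> 0 \<le> \<Lambda> r i"
    "\<And>r j. r < 2 * n \<Longrightarrow> j < n \<Longrightarrow> dot k (C j) X + c j * \<tau> + 1 * t * dir r j + (\<Sum>i<m. \<Lambda> r i * tight i j) = 0"
    by (rule dual_systemE[OF conjunct2[OF *]], rule that)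
  have \<tau>: "\<tau> > 0" using t by simp
  let ?x = "\<lambda>l. X l / \<tau>"
  have gap: "t * \<bar>u j - y j\<bar> \<le> \<tau> * (dot n (cost ?x) u - dot n (cost ?x) y)" if u: "lp_feasible u" and j: "j < n" for u j
  proof -
    have "0 \<le> \<tau> * (dot n (cost ?x) u - dot n (cost ?x) y) + t * ((if even r then 1 else -1) * (u j - y j))"
      if r: "r < 2 * n" "r div 2 = j" for r
    proof -
      have "0 \<le> dot n (\<lambda>i. \<tau> * cost ?x i + t * dir r i) (\<lambda>i. u i - y i)"
        by (rule multiplier_bound[OF L(1)[OF r(1)] _ u])
          (use L(2)[OF r(1)] cost_scale[OF \<tau>] in auto)
      also have "\<dots> = \<tau> * (dot n (cost ?x) u - dot n (cost ?x) y) + t * dot n (dir r) (\<lambda>i. u i - y i)"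
        by (simp add: algebra_simps sum.distrib sum_subtractf sum_distrib_left)
      also have "dot n (dir r) (\<lambda>i. u i - y i) = (\<Sum>i<n. of_bool (i = j) * ((if even r then 1 else -1) * (u i - y i)))"
        by (rule sum.cong) (use r in \<open>auto simp: dir_def\<close>)
      also have "\<dots> = (if even r then 1 else -1) * (u j - y j)" by (rule sum_of_bool_eq[OF j])
      finally show ?thesis .
    qed
    \<comment> \<open>The indices 2 j and 2 j + 1 are the two signs of direction j and together give
      the absolute value.\<close>
    from this[of "2 * j"] this[of "2 * j + 1"] j show ?thesis
      using t(1) by (auto simp: abs_if right_diff_distrib)
  qed
  have le: "dot n (cost ?x) y \<le> dot n (cost ?x) u" if u: "lp_feasible u" for u
  proof (cases "n = 0")
    case False
    then have "t * \<bar>u 0 - y 0\<bar> \<le> \<tau> * (dot n (cost ?x) u - dot n (cost ?x) y)" using gap[OF u, of 0] by simp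
    moreover have "0 \<le> t * \<bar>u 0 - y 0\<bar>" using t by simp
    ultimately have "0 \<le> \<tau> * (dot n (cost ?x) u - dot n (cost ?x) y)" by linarith
    then show ?thesis using \<tau> by (simp add: zero_le_mult_iff)
  qed simp
  have "u j = y j" if u: "lp_optimal ?x u" and j: "j < n" for u j
  proof -
    have uf: "lp_feasible u" and "dot n (cost ?x) u \<le> dot n (cost ?x) y"
      using u y by (auto simp: lp_optimal_def)
    then have "\<tau> * (dot n (cost ?x) u - dot n (cost ?x) y) \<le> 0" using \<tau> by (simp add: mult_nonneg_nonpos)
    then have "t * \<bar>u j - y j\<bar> \<le> 0" using gap[OF uf j] by linarith
    then show ?thesis using t(1) by (simp add: mult_le_0_iff)
  qed
  then show "\<exists>x. param x \<and> lp_optimal x y \<and> (\<forall>z. lp_optimal x z \<longrightarrow> (\<forall>j<n. z j = y j))"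
    using param_scale[OF \<tau> X] y le unfolding lp_optimal_def by blast
qed

end

section \<open>The dual system as an integer matrix\<close>

lemma sum_flatten: "(\<Sum>x<p * m. f x) = (\<Sum>r<p. \<Sum>i<m. f (r * m + i))" for f :: "nat \<Rightarrow> 'a :: comm_monoid_add"
proof -
  have "(\<Sum>i<m. f (r * m + i)) = (\<Sum>x = r * m..<r * m + m. f x)" for r
    using sum.shift_bounds_nat_ivl[of f 0 "r * m" m] by (simp add: lessThan_atLeast0 add.commute)
  then show ?thesis using sum.nat_group[of f m p] by simp
qed

text \<open>
  The matrix of \<open>dual_system\<close>.  Column \<open>0\<close> belongs to \<open>t\<close>, column \<open>1 + l\<close> to \<open>X l\<close>, column \<open>k + 1\<close> to \<open>\<tau>\<close>, and
  column \<open>k + 2 + r m + i\<close> to \<open>\<Lambda> r i\<close>.  The rows express \<open>t \<ge> 0\<close>, \<open>\<tau> \<ge> t\<close>, \<open>D X \<le> \<tau> d\<close>, \<open>\<Lambda> \<ge> 0\<close> and both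
  signs of each equation.
\<close>

definition lp_rows :: "nat \<Rightarrow> nat \<Rightarrow> nat \<Rightarrow> nat" where
  "lp_rows m n g = 2 + g + 2 * n * m + 2 * n * n * 2"

definition lp_cols :: "nat \<Rightarrow> nat \<Rightarrow> nat \<Rightarrow> nat" where
  "lp_cols m n k = k + 2 + 2 * n * m"

definition lp_entry :: "nat \<Rightarrow> nat \<Rightarrow> nat \<Rightarrow> nat \<Rightarrow> int \<Rightarrow> int \<Rightarrow>
    (nat \<Rightarrow> nat \<Rightarrow> int) \<Rightarrow> (nat \<Rightarrow> nat \<Rightarrow> int) \<Rightarrow> (nat \<Rightarrow> int) \<Rightarrow> (nat \<Rightarrow> nat \<Rightarrow> int) \<Rightarrow> (nat \<Rightarrow> int) \<Rightarrow>
    (nat \<Rightarrow> bool) \<Rightarrow> nat \<Rightarrow> nat \<Rightarrow> int" where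
  "lp_entry m n k g \<alpha> P A C c D d tg i l =
    (if i = 0 then of_bool (l = 0)
     else if i = 1 then of_bool (l = k + 1) - of_bool (l = 0)
     else if i < 2 + g then
       (if l = 0 then 0 else if l < k + 1 then - D (i - 2) (l - 1) else if l = k + 1 then d (i - 2) else 0)
     else if i < 2 + g + 2 * n * m then of_bool (l + g = k + i)
     else let s = i - (2 + g + 2 * n * m); q = s div 2; r = q div n; j = q mod n; x = l - (k + 2) in
       (1 - 2 * int (s mod 2)) *
       (if l = 0 then (if j = r div 2 then \<alpha> * P * (1 - 2 * int (r mod 2)) else 0)
        else if l < k + 1 then C j (l - 1) else if l = k + 1 then c j
        else if x div m = r \<and> tg (x mod m) then A (x mod m) j else 0))"

lemma sum_lp_cols: "(\<Sum>l<lp_cols m n k. f l) =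
    f 0 + (\<Sum>l<k. f (1 + l)) + f (k + 1) + (\<Sum>x<2 * n * m. f (k + 2 + x))" for f :: "nat \<Rightarrow> 'a :: comm_monoid_add"
proof -
  have "lp_cols m n k = 1 + k + 1 + 2 * n * m" by (simp add: lp_cols_def)
  then show ?thesis by (simp only: sum_split_offset) simp
qed

text \<open>The system is homogeneous, so multiplying A, C, c, D, d and the shift by a common P > 0
  does not change its solvability. The right-hand side b and the target enter only through the test
  \<open>tg\<close>.\<close>

locale inverse_lp_int = inverse_lp +
  fixes P \<alpha> :: int and Ai Ci Di :: "nat \<Rightarrow> nat \<Rightarrow> int" and ci di :: "nat \<Rightarrow> int" and tg :: "nat \<Rightarrow> bool"
  assumes P: "0 < P"
    and Ai: "\<And>i j. i < m \<Longrightarrow> j < n \<Longrightarrow> real_of_int (Ai i j) = P * a i j"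
    and Ci: "\<And>j l. j < n \<Longrightarrow> l < k \<Longrightarrow> real_of_int (Ci j l) = P * C j l"
    and Di: "\<And>i l. i < g \<Longrightarrow> l < k \<Longrightarrow> real_of_int (Di i l) = P * D i l"
    and ci: "\<And>j. j < n \<Longrightarrow> real_of_int (ci j) = P * c j"
    and di: "\<And>i. i < g \<Longrightarrow> real_of_int (di i) = P * d i"
    and tg: "\<And>i. i < m \<Longrightarrow> tg i \<longleftrightarrow> dot n (a i) y = b i"
begin

abbreviation "H \<equiv> lp_entry m n k g \<alpha> P Ai Ci ci Di di tg"
abbreviation "ncs \<equiv> lp_cols m n k"
abbreviation "nrs \<equiv> lp_rows m n g"

lemma row_pos: fixes z :: "nat \<Rightarrow> real" shows "dot ncs (\<lambda>l. real_of_int (H 0 l)) z = z 0"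
  unfolding sum_lp_cols by (simp add: lp_entry_def)

lemma row_scale: fixes z :: "nat \<Rightarrow> real" shows "dot ncs (\<lambda>l. real_of_int (H 1 l)) z = z (k + 1) - z 0"
  unfolding sum_lp_cols by (simp add: lp_entry_def)

lemma row_param:
  fixes z :: "nat \<Rightarrow> real"
  assumes i: "i < g"
  shows "dot ncs (\<lambda>l. real_of_int (H (2 + i) l)) z =
    real_of_int P * (d i * z (k + 1) - dot k (D i) (\<lambda>l. z (1 + l)))"
proof -
  have "(\<Sum>l<k. real_of_int (H (2 + i) (1 + l)) * z (1 + l)) = (\<Sum>l<k. - P * (D i l * z (1 + l)))"
    by (rule sum.cong) (use i in \<open>auto simp: lp_entry_def Di\<close>)
  also have "\<dots> = - P * dot k (D i) (\<lambda>l. z (1 + l))" by (simp only: sum_distrib_left)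
  finally have "(\<Sum>l<k. real_of_int (H (2 + i) (1 + l)) * z (1 + l)) = - P * dot k (D i) (\<lambda>l. z (1 + l))" .
  moreover have "(\<Sum>x<2 * n * m. real_of_int (H (2 + i) (k + 2 + x)) * z (k + 2 + x)) = 0"
    by (rule sum.neutral) (use i in \<open>auto simp: lp_entry_def\<close>)
  moreover have "H (2 + i) 0 = 0" "real_of_int (H (2 + i) (k + 1)) = P * d i"
    using i by (auto simp: lp_entry_def di)
  ultimately show ?thesis unfolding sum_lp_cols by (simp add: algebra_simps)
qed

lemma row_nonneg:
  fixes z :: "nat \<Rightarrow> real"
  assumes x: "x < 2 * n * m"
  shows "dot ncs (\<lambda>l. real_of_int (H (2 + g + x) l)) z = z (k + 2 + x)"
proof -
  have e: "H (2 + g + x) l = of_bool (l = k + 2 + x)" for l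
    using x by (auto simp: lp_entry_def)
  have "k + 2 + x < ncs" using x by (simp add: lp_cols_def)
  then show ?thesis unfolding e by (simp add: sum_of_bool_eq)
qed

text \<open>The offset (r n + j) 2 + sg enumerates the equations (r, j), each with its two
  signs.\<close>

lemma row_dual:
  fixes z :: "nat \<Rightarrow> real"
  assumes r: "r < 2 * n" and j: "j < n" and sg: "sg < 2"
  shows "dot ncs (\<lambda>l. real_of_int (H (2 + g + 2 * n * m + ((r * n + j) * 2 + sg)) l)) z =
    (1 - 2 * real sg) * (real_of_int P * (dot k (C j) (\<lambda>l. z (1 + l)) + c j * z (k + 1) + real_of_int \<alpha> * z 0 * dir r j +
      (\<Sum>i<m. z (k + 2 + (r * m + i)) * tight i j)))"
proof -
  let ?i = "2 + g + 2 * n * m + ((r * n + j) * 2 + sg)"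
  let ?s = "1 - 2 * real sg"
  have s: "((r * n + j) * 2 + sg) div 2 = r * n + j" "((r * n + j) * 2 + sg) mod 2 = sg"
    using idx_div_mod[OF sg, of "r * n + j"] by auto
  have q: "(r * n + j) div n = r" "(r * n + j) mod n = j" using j idx_div_mod by auto
  have ge: "\<not> ?i < 2 + g + 2 * n * m" "\<not> ?i < 2 + g" "?i \<noteq> 0" "?i \<noteq> 1" by simp_all
  have sub: "?i - (2 + g + 2 * n * m) = (r * n + j) * 2 + sg" by simp
  have H_eq: "H ?i l = (1 - 2 * int sg) *
       (if l = 0 then (if j = r div 2 then \<alpha> * P * (1 - 2 * int (r mod 2)) else 0)
        else if l < k + 1 then Ci j (l - 1) else if l = k + 1 then ci j
        else if (l - (k + 2)) div m = r \<and> tg ((l - (k + 2)) mod m) then Ai ((l - (k + 2)) mod m) j else 0)" for l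
    unfolding lp_entry_def Let_def sub s q using ge by simp
  have 0: "real_of_int (H ?i 0) = ?s * (P * (\<alpha> * dir r j))"
    unfolding H_eq by (auto simp: dir_def even_iff_mod_2_eq_zero)
  have 1: "(\<Sum>l<k. real_of_int (H ?i (1 + l)) * z (1 + l)) = ?s * (P * dot k (C j) (\<lambda>l. z (1 + l)))"
  proof -
    have "(\<Sum>l<k. real_of_int (H ?i (1 + l)) * z (1 + l)) = (\<Sum>l<k. ?s * (P * (C j l * z (1 + l))))"
    proof (rule sum.cong[OF refl])
      fix l assume "l \<in> {..<k}"
      then have "real_of_int (H ?i (1 + l)) = ?s * (P * C j l)" unfolding H_eq using j by (simp add: Ci)
      then show "real_of_int (H ?i (1 + l)) * z (1 + l) = ?s * (P * (C j l * z (1 + l)))"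
        by (simp only: mult.assoc)
    qed
    then show ?thesis by (simp only: sum_distrib_left)
  qed
  have 2: "real_of_int (H ?i (k + 1)) = ?s * (P * c j)" unfolding H_eq using j by (simp add: ci)
  have 3: "(\<Sum>x<2 * n * m. real_of_int (H ?i (k + 2 + x)) * z (k + 2 + x)) =
      ?s * (P * (\<Sum>i<m. z (k + 2 + (r * m + i)) * tight i j))"
  proof -
    have "(\<Sum>x<2 * n * m. real_of_int (H ?i (k + 2 + x)) * z (k + 2 + x)) =
        (\<Sum>r'<2 * n. \<Sum>i<m. real_of_int (H ?i (k + 2 + (r' * m + i))) * z (k + 2 + (r' * m + i)))"
      by (rule sum_flatten)
    also have "\<dots> = (\<Sum>r'<2 * n. of_bool (r' = r) * (\<Sum>i<m. ?s * (P * (z (k + 2 + (r' * m + i)) * tight i j))))"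
    proof (rule sum.cong[OF refl])
      fix r'
      have "real_of_int (H ?i (k + 2 + (r' * m + i))) * z (k + 2 + (r' * m + i)) =
          of_bool (r' = r) * (?s * (P * (z (k + 2 + (r' * m + i)) * tight i j)))" if "i < m" for i
        unfolding H_eq using that j idx_div_mod[of i m r'] by (auto simp: Ai tg tight_def)
      then show "(\<Sum>i<m. real_of_int (H ?i (k + 2 + (r' * m + i))) * z (k + 2 + (r' * m + i))) =
          of_bool (r' = r) * (\<Sum>i<m. ?s * (P * (z (k + 2 + (r' * m + i)) * tight i j)))"
        unfolding sum_distrib_left by (intro sum.cong) auto
    qed
    also have "\<dots> = (\<Sum>i<m. ?s * (P * (z (k + 2 + (r * m + i)) * tight i j)))" by (rule sum_of_bool_eq[OF r])
    finally show ?thesis by (simp only: sum_distrib_left)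
  qed
  show ?thesis unfolding sum_lp_cols 0 1 2 3 by (simp add: algebra_simps)
qed

text \<open>Case rule for the five blocks of rows, in the form in which the row lemmas
  apply.\<close>

lemma rows_split:
  assumes "Q (0::nat)" "Q 1" "\<And>i. i < g \<Longrightarrow> Q (2 + i)" "\<And>x. x < 2 * n * m \<Longrightarrow> Q (2 + g + x)"
    "\<And>r j sg. r < 2 * n \<Longrightarrow> j < n \<Longrightarrow> sg < 2 \<Longrightarrow> Q (2 + g + 2 * n * m + ((r * n + j) * 2 + sg))"
    and i: "i < nrs"
  shows "Q i"
proof -
  consider "i = 0" | "i = 1" | x where "i = 2 + x" "x < g" | x where "i = 2 + g + x" "x < 2 * n * m"
    | s where "i = 2 + g + 2 * n * m + s" "s < 2 * n * n * 2"
  proof -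
    have "i = 0 \<or> i = 1 \<or> (2 \<le> i \<and> i - 2 < g) \<or> (2 + g \<le> i \<and> i - (2 + g) < 2 * n * m) \<or>
      (2 + g + 2 * n * m \<le> i \<and> i - (2 + g + 2 * n * m) < 2 * n * n * 2)"
      using i unfolding lp_rows_def by linarith
    then show thesis using that(1,2) that(3)[of "i - 2"] that(4)[of "i - (2 + g)"] that(5)[of "i - (2 + g + 2 * n * m)"]
      by auto
  qed
  then show ?thesis
  proof cases
    case (5 s)
    have "s div 2 < 2 * n * n" using 5(2) by simp
    then have "s div 2 div n < 2 * n" "s div 2 mod n < n"
      by (auto simp: less_mult_imp_div_less intro!: mod_less_divisor gr0I)
    moreover have "(s div 2 div n * n + s div 2 mod n) * 2 + s mod 2 = s" by simp
    ultimately show ?thesis using assms(5)[of "s div 2 div n" "s div 2 mod n" "s mod 2"] 5(1) by simp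
  qed (use assms in auto)
qed

lemma rows_less:
  "0 < nrs" "1 < nrs" "i < g \<Longrightarrow> 2 + i < nrs" "x < 2 * n * m \<Longrightarrow> 2 + g + x < nrs"
  "r < 2 * n \<Longrightarrow> j < n \<Longrightarrow> sg < 2 \<Longrightarrow> 2 + g + 2 * n * m + ((r * n + j) * 2 + sg) < nrs"
proof -
  assume "r < 2 * n" "j < n" "sg < 2"
  then have "r * n + j < 2 * n * n"
    using int_mult_add_lt[of r "2 * n" j n] by (metis of_nat_add of_nat_less_iff of_nat_mult)
  moreover have "q * 2 + sg < p * 2" if "q < p" for p q :: nat using that \<open>sg < 2\<close> by linarith
  ultimately have "(r * n + j) * 2 + sg < 2 * n * n * 2" by blast
  then show "2 + g + 2 * n * m + ((r * n + j) * 2 + sg) < nrs" unfolding lp_rows_def by linarith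
qed (auto simp: lp_rows_def)

theorem cone_feasible_iff_dual_system: "cone_feasible nrs ncs H \<longleftrightarrow> dual_system (real_of_int \<alpha>)"
proof
  assume "cone_feasible nrs ncs H"
  then obtain z :: "nat \<Rightarrow> real" where z: "\<And>i. i < nrs \<Longrightarrow> 0 \<le> dot ncs (\<lambda>l. real_of_int (H i l)) z" "0 < z 0"
    by (auto simp: cone_feasible_def)
  have P': "0 < real_of_int P" using P by simp
  let ?eq = "\<lambda>r j. dot k (C j) (\<lambda>l. z (1 + l)) + c j * z (k + 1) + real_of_int \<alpha> * z 0 * dir r j +
    (\<Sum>i<m. z (k + 2 + (r * m + i)) * tight i j)"
  define \<Lambda> where "\<Lambda> r i = z (k + 2 + (r * m + i))" for r i
  have "z 0 \<le> z (k + 1)" using z(1)[OF rows_less(2)] unfolding row_scale by simp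
  moreover have "dot k (D i) (\<lambda>l. z (1 + l)) \<le> d i * z (k + 1)" if "i < g" for i
    using z(1)[OF rows_less(3)[OF that]] unfolding row_param[OF that] using P' by (simp add: zero_le_mult_iff)
  moreover have "0 \<le> \<Lambda> r i" if "r < 2 * n" "i < m" for r i
  proof -
    have x: "r * m + i < 2 * n * m"
      using int_mult_add_lt[OF that] by (metis of_nat_add of_nat_less_iff of_nat_mult)
    show ?thesis using z(1)[OF rows_less(4)[OF x]] unfolding row_nonneg[OF x] \<Lambda>_def .
  qed
  moreover have "?eq r j = 0" if rj: "r < 2 * n" "j < n" for r j
  proof -
    have "0 \<le> real_of_int P * ?eq r j"
      using z(1)[OF rows_less(5)[OF rj, where sg = 0]] row_dual[OF rj, where sg = 0 and z = z] by simp
    moreover have "real_of_int P * ?eq r j \<le> 0"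
      using z(1)[OF rows_less(5)[OF rj, where sg = 1]] row_dual[OF rj, where sg = 1 and z = z] by simp
    ultimately have "real_of_int P * ?eq r j = 0" by (rule antisym[rotated])
    then show ?thesis using P' by simp
  qed
  ultimately show "dual_system (real_of_int \<alpha>)"
    unfolding dual_system_def using z(2)
    by (intro exI[of _ "\<lambda>l. z (1 + l)"] exI[of _ "z (k + 1)"] exI[of _ "z 0"] exI[of _ \<Lambda>]) (unfold \<Lambda>_def, blast)
next
  assume ds: "dual_system (real_of_int \<alpha>)"
  obtain X \<tau> t \<Lambda> where t: "0 < t" "t \<le> \<tau>"
    and X: "\<And>i. i < g \<Longrightarrow> dot k (D i) X \<le> d i * \<tau>"
    and L: "\<And>r i. r < 2 * n \<Longrightarrow> i < m \<Longrightarrow> 0 \<le> \<Lambda> r i"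
    "\<And>r j. r < 2 * n \<Longrightarrow> j < n \<Longrightarrow> dot k (C j) X + c j * \<tau> + real_of_int \<alpha> * t * dir r j + (\<Sum>i<m. \<Lambda> r i * tight i j) = 0"
    by (rule dual_systemE[OF ds], rule that)
  define z where "z l = (if l = 0 then t else if l < k + 1 then X (l - 1) else if l = k + 1 then \<tau>
    else \<Lambda> ((l - (k + 2)) div m) ((l - (k + 2)) mod m))" for l
  have z0: "z 0 = t" and zk: "z (k + 1) = \<tau>" by (simp_all add: z_def)
  have zX: "dot k f (\<lambda>l. z (1 + l)) = dot k f X" for f by (rule sum.cong) (auto simp: z_def)
  have zL: "z (k + 2 + x) = \<Lambda> (x div m) (x mod m)" for x by (simp add: z_def)
  have zS: "(\<Sum>i<m. z (k + 2 + (r * m + i)) * tight i j) = (\<Sum>i<m. \<Lambda> r i * tight i j)" for r j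
  proof (rule sum.cong[OF refl])
    fix i assume "i \<in> {..<m}"
    then have "z (k + 2 + (r * m + i)) = \<Lambda> r i" unfolding zL using idx_div_mod[of i m r] by simp
    then show "z (k + 2 + (r * m + i)) * tight i j = \<Lambda> r i * tight i j" by simp
  qed
  have "0 \<le> dot ncs (\<lambda>l. real_of_int (H i l)) z" if "i < nrs" for i
    using that
  proof (rule rows_split[where Q = "\<lambda>i. 0 \<le> dot ncs (\<lambda>l. real_of_int (H i l)) z", rotated 5], goal_cases)
    case 1
    show ?case unfolding row_pos z0 using t by simp
  next
    case 2
    show ?case unfolding row_scale z0 zk using t by simp
  next
    case (3 i)
    show ?case unfolding row_param[OF 3] zX zk using X[OF 3] P by simp
  next
    case (4 x)
    have "x div m < 2 * n" "x mod m < m" using 4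
      by (auto simp: less_mult_imp_div_less intro!: mod_less_divisor gr0I)
    then show ?case unfolding row_nonneg[OF 4] zL by (rule L(1))
  next
    case (5 r j sg)
    show ?case unfolding row_dual[OF 5] zX zk z0 zS L(2)[OF 5(1,2)] by simp
  qed
  then show "cone_feasible nrs ncs H"
    unfolding cone_feasible_def using z0 t by auto
qed

end

section \<open>The decision program\<close>

abbreviation (input) "vm \<equiv> 30 :: nat"
abbreviation (input) "vq \<equiv> 31 :: nat"
abbreviation (input) "vK \<equiv> 32 :: nat"
abbreviation (input) "vg \<equiv> 33 :: nat"
abbreviation (input) "vP \<equiv> 34 :: nat"
abbreviation (input) "ob \<equiv> 35 :: nat"
abbreviation (input) "oC \<equiv> 36 :: nat"
abbreviation (input) "oc \<equiv> 37 :: nat"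
abbreviation (input) "oD \<equiv> 38 :: nat"
abbreviation (input) "od \<equiv> 39 :: nat"
abbreviation (input) "oy \<equiv> 40 :: nat"
abbreviation (input) "vcnt \<equiv> 41 :: nat"
abbreviation (input) "aT \<equiv> 42 :: nat"
abbreviation (input) "vbad \<equiv> 43 :: nat"
abbreviation (input) "vx \<equiv> 44 :: nat"
abbreviation (input) "vrow \<equiv> 45 :: nat"
abbreviation (input) "vcol \<equiv> 46 :: nat"
abbreviation (input) "vh \<equiv> 47 :: nat"
abbreviation (input) "vs \<equiv> 48 :: nat"
abbreviation (input) "vsg \<equiv> 49 :: nat"
abbreviation (input) "vqq \<equiv> 50 :: nat"
abbreviation (input) "vr \<equiv> 51 :: nat"
abbreviation (input) "vjj \<equiv> 52 :: nat"
abbreviation (input) "vy \<equiv> 53 :: nat"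
abbreviation (input) "vym \<equiv> 54 :: nat"

lemma wp_Set_Seq:
  assumes "aval e s = v" "\<bar>v\<bar> < 2 ^ w" "wp N w c Q (s(x := (s x)(0 := v)))"
  shows "wp N w (Set x e ;; c) Q s"
  by (rule wp_Seq, rule wp_Assign) (use assms in auto)

text \<open>The rational number at input position \<open>e\<close>, multiplied by the product of all denominators.\<close>

definition scaled :: "aexp \<Rightarrow> aexp" where
  "scaled e = Div (Times (Cell 0 e) (Var vP)) (Cell 0 (Plus e (Const 1)))"

definition Eq :: "aexp \<Rightarrow> aexp \<Rightarrow> bexp" where
  "Eq e1 e2 = And (Not (Less e1 e2)) (Not (Less e2 e1))"

lemma bval_Eq [simp]: "bval (Eq e1 e2) s \<longleftrightarrow> aval e1 s = aval e2 s"
  by (auto simp: Eq_def)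

text \<open>The header takes four cells and each rational number two, its numerator and its
  denominator.\<close>

definition read_offsets :: com where
  "read_offsets = Set ob (Plus (Const 4) (Times (Const 2) (Times (Var vm) (Var vq)))) ;;
    Set oC (Plus (Var ob) (Times (Const 2) (Var vm))) ;;
    Set oc (Plus (Var oC) (Times (Const 2) (Times (Var vq) (Var vK)))) ;;
    Set oD (Plus (Var oc) (Times (Const 2) (Var vq))) ;;
    Set od (Plus (Var oD) (Times (Const 2) (Times (Var vg) (Var vK)))) ;;
    Set oy (Plus (Var od) (Times (Const 2) (Var vg)))"

definition read_sizes :: com where
  "read_sizes = Set vcnt (Plus (Plus (Plus (Plus (Plus (Plus (Times (Var vm) (Var vq)) (Var vm)) (Times (Var vq) (Var vK)))
      (Var vq)) (Times (Var vg) (Var vK))) (Var vg)) (Var vq)) ;;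
    Set vn (Plus (Plus (Var vK) (Const 2)) (Times (Times (Const 2) (Var vq)) (Var vm))) ;;
    Set vM (Plus (Plus (Plus (Const 2) (Var vg)) (Times (Times (Const 2) (Var vq)) (Var vm)))
      (Times (Times (Times (Const 2) (Var vq)) (Var vq)) (Const 2)))"

text \<open>For n + g = 0 no entry of C or D is stored, so the number k in the header may be
  exponential in the input size; it is then replaced by 0. The cells 5 + 2 x are the
  denominators.\<close>

definition read_dims :: com where
  "read_dims = Set vm (Cell 0 (Const 0)) ;; Set vq (Cell 0 (Const 1)) ;; Set vg (Cell 0 (Const 3)) ;;
    If (Less (Const 0) (Plus (Var vq) (Var vg))) (Set vK (Cell 0 (Const 2))) (Set vK (Const 0)) ;;
    read_offsets ;; read_sizes ;; Set vP (Const 1) ;;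
    For vx (Var vcnt) (Set vP (Times (Var vP) (Cell 0 (Plus (Const 5) (Times (Const 2) (Var vx))))))"

text \<open>The products of scaled entries carry P^2, so the scaled b is multiplied by P once more.
  \<open>aT\<close> marks the rows with a_i y \<ge> b_i, which are the tight ones as soon as the
  target is feasible.\<close>

definition check_target :: com where
  "check_target = For vx (Var vm)
    (Sum vacc vj (Var vq) (Times (scaled (Plus (Const 4) (Times (Const 2) (Plus (Times (Var vx) (Var vq)) (Var vj)))))
        (scaled (Plus (Var oy) (Times (Const 2) (Var vj))))) ;;
     If (Less (Times (scaled (Plus (Var ob) (Times (Const 2) (Var vx)))) (Var vP)) (Var vacc)) (Set vbad (Const 1)) Skip ;;
     If (Less (Var vacc) (Times (scaled (Plus (Var ob) (Times (Const 2) (Var vx)))) (Var vP)))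
       Skip (Assign aT (Var vx) (Const 1)))"

definition dual_value :: "int \<Rightarrow> com" where
  "dual_value \<alpha> = If (Less (Var vcol) (Const 1))
      (If (Eq (Var vjj) (Div (Var vr) (Const 2)))
        (Set vh (Times (Times (Const \<alpha>) (Var vP))
          (Minus (Const 1) (Times (Const 2) (Minus (Var vr) (Times (Div (Var vr) (Const 2)) (Const 2)))))))
        (Set vh (Const 0)))
    (If (Less (Var vcol) (Plus (Var vK) (Const 1)))
      (Set vh (scaled (Plus (Var oC) (Times (Const 2) (Plus (Times (Var vjj) (Var vK)) (Minus (Var vcol) (Const 1)))))))
    (If (Eq (Var vcol) (Plus (Var vK) (Const 1)))
      (Set vh (scaled (Plus (Var oc) (Times (Const 2) (Var vjj)))))
      (Set vy (Minus (Var vcol) (Plus (Var vK) (Const 2))) ;;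
       Set vym (Minus (Var vy) (Times (Div (Var vy) (Var vm)) (Var vm))) ;;
       If (And (Eq (Div (Var vy) (Var vm)) (Var vr)) (Less (Const 0) (Cell aT (Var vym))))
        (Set vh (scaled (Plus (Const 4) (Times (Const 2) (Plus (Times (Var vym) (Var vq)) (Var vjj))))))
        (Set vh (Const 0)))))"

definition dual_entry :: "int \<Rightarrow> com" where
  "dual_entry \<alpha> =
    Set vs (Minus (Var vrow) (Plus (Plus (Const 2) (Var vg)) (Times (Times (Const 2) (Var vq)) (Var vm)))) ;;
    Set vqq (Div (Var vs) (Const 2)) ;;
    Set vsg (Minus (Var vs) (Times (Var vqq) (Const 2))) ;;
    Set vr (Div (Var vqq) (Var vq)) ;;
    Set vjj (Minus (Var vqq) (Times (Var vr) (Var vq))) ;;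
    dual_value \<alpha> ;;
    Set vh (Times (Minus (Const 1) (Times (Const 2) (Var vsg))) (Var vh))"

definition lp_entry_com :: "int \<Rightarrow> com" where
  "lp_entry_com \<alpha> =
    If (Less (Var vrow) (Const 1))
      (If (Less (Var vcol) (Const 1)) (Set vh (Const 1)) (Set vh (Const 0)))
    (If (Less (Var vrow) (Const 2))
      (If (Less (Var vcol) (Const 1)) (Set vh (Const (-1)))
        (If (Eq (Var vcol) (Plus (Var vK) (Const 1))) (Set vh (Const 1)) (Set vh (Const 0))))
    (If (Less (Var vrow) (Plus (Const 2) (Var vg)))
      (If (Less (Var vcol) (Const 1)) (Set vh (Const 0))
        (If (Less (Var vcol) (Plus (Var vK) (Const 1)))
          (Set vh (Minus (Const 0) (scaled (Plus (Var oD) (Times (Const 2)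
            (Plus (Times (Minus (Var vrow) (Const 2)) (Var vK)) (Minus (Var vcol) (Const 1))))))))
          (If (Eq (Var vcol) (Plus (Var vK) (Const 1)))
            (Set vh (scaled (Plus (Var od) (Times (Const 2) (Minus (Var vrow) (Const 2))))))
            (Set vh (Const 0)))))
    (If (Less (Var vrow) (Plus (Plus (Const 2) (Var vg)) (Times (Times (Const 2) (Var vq)) (Var vm))))
      (If (Eq (Plus (Var vcol) (Var vg)) (Plus (Var vK) (Var vrow))) (Set vh (Const 1)) (Set vh (Const 0)))
      (dual_entry \<alpha>))))"

definition fill_lp :: "int \<Rightarrow> com" where
  "fill_lp \<alpha> = For vx (Times (Var vM) (Var vn))
    (Set vrow (Div (Var vx) (Var vn)) ;; Set vcol (Minus (Var vx) (Times (Var vrow) (Var vn))) ;;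
     lp_entry_com \<alpha> ;; Assign aH (Var vx) (Var vh))"

text \<open>The scenarios differ only in \<alpha>: 0 for the optimistic and 1 for the pessimistic
  one. \<open>vbad\<close> overrides the answer for the cone when the target is infeasible.\<close>

definition decide :: "int \<Rightarrow> com" where
  "decide \<alpha> = read_dims ;; check_target ;; fill_lp \<alpha> ;; solve_cone ;;
    If (Less (Const 0) (Var vbad)) (Set vFlag (Const 0)) Skip"

lemma writes_read_dims [simp]: "writes read_dims =
    {vm, vq, vg, vK, ob, oC, oc, oD, od, oy, vcnt, vn, vM, vP, vx}"
  by (auto simp: read_dims_def read_offsets_def read_sizes_def)

lemma writes_check_target [simp]: "writes check_target = {vx, vj, vacc, vbad, aT}"
  by (auto simp: check_target_def)

lemma writes_lp_entry_com [simp]: "writes (lp_entry_com \<alpha>) = {vh, vs, vqq, vsg, vr, vjj, vy, vym}"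
  by (auto simp: lp_entry_com_def dual_entry_def dual_value_def)

lemma writes_fill_lp [simp]: "writes (fill_lp \<alpha>) = {vx, vrow, vcol, aH, vh, vs, vqq, vsg, vr, vjj, vy, vym}"
  by (auto simp: fill_lp_def)

lemma writes_solve_cone [simp]: "writes solve_cone =
    {vc, vV, vi, vpw, vl, ve, vE, aB, vT, vR, vj, vacc, aW, vrho, aN, vd, vmu, vk, aS, vidx, vFlag, aZ, aY, vp, vo}"
  by (auto simp: solve_cone_def)

text \<open>2^z bounds every input number and the product of the denominators, so scaled data are at
  most 2^(2 z) and their inner products with the target at most 2^(n + 4 z). \<open>L\<close> is
  large enough for the quantity V of the assembled matrix to be at most 2^L.\<close>

locale lp_input =
  fixes inp :: "int \<Rightarrow> int" and m n k K g z cnt N w L :: nat and \<alpha> :: int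
  assumes header: "inp 0 = int m" "inp 1 = int n" "inp 2 = int k" "inp 3 = int g"
    and K: "K = (if 0 < n + g then k else 0)"
    and cnt: "cnt = m * n + m + n * K + n + g * K + g + n"
    and inp: "\<And>p. \<bar>inp p\<bar> \<le> 2 ^ z"
    and prods: "\<And>t. t \<le> cnt \<Longrightarrow> \<bar>\<Prod>x<t. inp (5 + 2 * int x)\<bar> \<le> 2 ^ z"
    and \<alpha>: "\<bar>\<alpha>\<bar> \<le> 1"
    and L: "3 * lp_cols m n K + 2 * lp_rows m n g + 4 * z + 2 \<le> L"
    and N: "4 + 2 * cnt \<le> N" "lp_rows m n g * lp_cols m n K \<le> N"
      "num_T (lp_rows m n g) (lp_cols m n K) \<le> N" "num_R (lp_rows m n g) (lp_cols m n K) L \<le> N"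
      "lp_cols m n K * lp_cols m n K \<le> N" "L \<le> N"
      "exp_e (lp_rows m n g) (lp_cols m n K) L + lp_rows m n g \<le> N"
    and w: "exp_W (lp_rows m n g) (lp_cols m n K) L \<le> w" "N < w" "n + 4 * z < w"
begin

definition PP :: int where "PP = (\<Prod>x<cnt. inp (5 + 2 * int x))"

definition scv :: "int \<Rightarrow> int" where "scv p = inp p * PP div inp (p + 1)"

definition As :: "nat \<Rightarrow> nat \<Rightarrow> int" where "As i j = scv (4 + 2 * (int i * int n + int j))"
definition pb :: int where "pb = 4 + 2 * (int m * int n)"
definition bs :: "nat \<Rightarrow> int" where "bs i = scv (pb + 2 * int i)"
definition pC :: int where "pC = pb + 2 * int m"
definition Cs :: "nat \<Rightarrow> nat \<Rightarrow> int" where "Cs j l = scv (pC + 2 * (int j * int K + int l))"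
definition pc :: int where "pc = pC + 2 * (int n * int K)"
definition cs :: "nat \<Rightarrow> int" where "cs j = scv (pc + 2 * int j)"
definition pD :: int where "pD = pc + 2 * int n"
definition Ds :: "nat \<Rightarrow> nat \<Rightarrow> int" where "Ds i l = scv (pD + 2 * (int i * int K + int l))"
definition pd :: int where "pd = pD + 2 * (int g * int K)"
definition ds :: "nat \<Rightarrow> int" where "ds i = scv (pd + 2 * int i)"
definition py :: int where "py = pd + 2 * int g"
definition ys :: "nat \<Rightarrow> int" where "ys j = scv (py + 2 * int j)"

lemmas pos_defs = pb_def pC_def pc_def pD_def pd_def py_def

definition act :: "nat \<Rightarrow> bool" where "act i \<longleftrightarrow> bs i * PP \<le> dot n (As i) ys"

definition bad :: bool where "bad \<longleftrightarrow> (\<exists>i<m. bs i * PP < dot n (As i) ys)"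

abbreviation "nr \<equiv> lp_rows m n g"
abbreviation "nc \<equiv> lp_cols m n K"
abbreviation "E \<equiv> lp_entry m n K g \<alpha> PP As Cs cs Ds ds act"

definition dims :: "state \<Rightarrow> bool" where
  "dims s \<longleftrightarrow> s 0 = inp \<and> s vm 0 = int m \<and> s vq 0 = int n \<and> s vg 0 = int g \<and> s vK 0 = int K \<and>
    s ob 0 = pb \<and> s oC 0 = pC \<and> s oc 0 = pc \<and> s oD 0 = pD \<and> s od 0 = pd \<and> s oy 0 = py \<and>
    s vn 0 = int nc \<and> s vM 0 = int nr \<and> s vP 0 = PP"

lemma dims_frame: "dims s \<Longrightarrow> frame X s s' \<Longrightarrow>
    {0, vm, vq, vg, vK, ob, oC, oc, oD, od, oy, vn, vM, vP} \<inter> X = {} \<Longrightarrow> dims s'"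
  by (auto simp: dims_def frame_def)

lemma PP_le: "\<bar>PP\<bar> \<le> 2 ^ z"
  unfolding PP_def by (rule prods) simp

lemma scv_le: "\<bar>scv p\<bar> \<le> 2 ^ (2 * z)"
proof -
  have "\<bar>scv p\<bar> \<le> \<bar>inp p\<bar> * \<bar>PP\<bar>" unfolding scv_def abs_mult[symmetric] by (rule abs_div_le)
  also have "\<dots> \<le> 2 ^ z * 2 ^ z" using inp PP_le by (intro mult_mono) auto
  finally show ?thesis by (simp add: mult_2 power_add)
qed

lemma aval_scaled: "dims s \<Longrightarrow> aval (scaled e) s = scv (aval e s)"
  by (simp add: scaled_def dims_def scv_def)

lemma iN: "x \<le> N \<Longrightarrow> int x < 2 ^ w"
  using w(2) nat_less_two_power_int[of w] by linarith

lemma small: "2 ^ (2 * z) < (2 :: int) ^ w" "(1 :: int) < 2 ^ w" "(2 :: int) ^ z < 2 ^ w"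
proof -
  show "2 ^ (2 * z) < (2 :: int) ^ w" using w(3) by (intro power_strict_increasing) auto
  show "(2 :: int) ^ z < 2 ^ w" using w(3) by (intro power_strict_increasing) auto
  show "(1 :: int) < 2 ^ w" using iN[of 1] N(1) by simp
qed

lemma Nw: "N < 2 ^ w"
  using w(2) less_exp[of w] by (rule less_trans)

lemma nc_pos: "1 \<le> nc" and nr_pos: "1 \<le> nr"
  by (auto simp: lp_cols_def lp_rows_def)

lemma nrc_le: "nr \<le> N" "nc \<le> N"
proof -
  have "nr * 1 \<le> nr * nc" "1 * nc \<le> nr * nc" using nc_pos nr_pos by (intro mult_mono; simp)+
  then show "nr \<le> N" "nc \<le> N" using N(2) by linarith+
qed

lemma le_cnt: "m \<le> cnt" "n \<le> cnt" "g \<le> cnt"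
  by (simp_all add: cnt)

section \<open>Correctness of the decision program\<close>

lemma wp_read_dims:
  assumes s: "s 0 = inp"
    and post: "\<And>s'. frame (writes read_dims) s s' \<Longrightarrow> dims s' \<Longrightarrow> Q s'"
  shows "wp N w read_dims Q s"
proof -
  have le: "m \<le> N" "n \<le> N" "g \<le> N" "K \<le> N" "4 + 2 * (m * n) + 2 * m + 2 * (n * K) + 2 * n + 2 * (g * K) + 2 * g \<le> N"
    "cnt \<le> N"
  proof -
    have "4 + 2 * (m * n) + 2 * m + 2 * (n * K) + 2 * n + 2 * (g * K) + 2 * g \<le> 4 + 2 * cnt" unfolding cnt by simp
    then show "4 + 2 * (m * n) + 2 * m + 2 * (n * K) + 2 * n + 2 * (g * K) + 2 * g \<le> N" using N(1) by linarith
    show "cnt \<le> N" using N(1) by linarith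
    \<comment> \<open>This is the point of \<open>K\<close>: either a row of C or D with K entries
      is stored, or K is 0.\<close>
    have "K \<le> cnt"
    proof (cases "0 < n + g")
      case True
      then have "1 * K \<le> (n + g) * K" by (intro mult_right_mono) auto
      then show ?thesis unfolding cnt by (simp add: algebra_simps)
    qed (simp add: K)
    then show "K \<le> N" using N(1) by linarith
    show "m \<le> N" "n \<le> N" "g \<le> N" using N(1) le_cnt by linarith+
  qed
  have big: "4 + 2 * (int m * int n) + 2 * int m + 2 * (int n * int K) + 2 * int n + 2 * (int g * int K) + 2 * int g < 2 ^ w"
    using iN[OF le(5)] by simp
  have nn: "0 \<le> int m * int n" "0 \<le> int n * int K" "0 \<le> int g * int K" by simp_all
  have pw: "pb < 2 ^ w" "pC < 2 ^ w" "pc < 2 ^ w" "pD < 2 ^ w" "pd < 2 ^ w" "py < 2 ^ w"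
    and p0: "0 \<le> pb" "0 \<le> pC" "0 \<le> pc" "0 \<le> pD" "0 \<le> pd" "0 \<le> py"
    unfolding pos_defs using big nn by linarith+
  have cntw: "int m * int n + int m + int n * int K + int n + int g * int K + int g + int n = int cnt"
    by (simp add: cnt)
  have ncw: "int K + 2 + 2 * int n * int m = int nc" by (simp add: lp_cols_def)
  have nrw: "2 + int g + 2 * int n * int m + 2 * int n * int n * 2 = int nr" by (simp add: lp_rows_def)
  let ?s2 = "s(vm := (s vm)(0 := int m), vq := (s vq)(0 := int n), vg := (s vg)(0 := int g), vK := (s vK)(0 := int K))"
  let ?s3 = "?s2(ob := (s ob)(0 := pb), oC := (s oC)(0 := pC), oc := (s oc)(0 := pc), oD := (s oD)(0 := pD),
    od := (s od)(0 := pd), oy := (s oy)(0 := py))"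
  let ?s3' = "?s3(vcnt := (s vcnt)(0 := int cnt), vn := (s vn)(0 := int nc), vM := (s vM)(0 := int nr))"
  let ?s4 = "?s3'(vP := (s vP)(0 := 1))"
  let ?den = "For vx (Var vcnt) (Set vP (Times (Var vP) (Cell 0 (Plus (Const 5) (Times (Const 2) (Var vx))))))"
  have 4: "wp N w ?den Q ?s4"
  proof (rule wp_For[where n = cnt and I = "\<lambda>t s'. s' vP 0 = (\<Prod>x<t. inp (5 + 2 * int x))"], goal_cases)
    case (1 s')
    then show ?case by (simp add: frame_def)
  next
    case (6 t s')
    have "s' 0 = inp" using 6(2) s by (simp add: frame_def)
    moreover have "\<bar>\<Prod>x<Suc t. inp (5 + 2 * int x)\<bar> < 2 ^ w" using prods[of "Suc t"] 6(1) small(3) by linarith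
    ultimately show ?case using 6(3,4) by (intro wp_Assign) auto
  next
    case (7 s')
    have "dims s'" unfolding dims_def using 7 s by (simp add: frame_def PP_def)
    moreover have "frame (writes read_dims) s s'" using 7(1) by (auto simp: frame_def)
    ultimately show ?case by (intro post)
  qed (use le Nw in auto)
  have 3: "wp N w (read_sizes ;; Set vP (Const 1) ;; ?den) Q ?s3"
  proof (rule wp_Seq)
    have "wp N w (Set vP (Const 1) ;; ?den) Q ?s3'"
      by (rule wp_Set_Seq[where v = 1]) (use 4 small in simp_all)
    then show "wp N w read_sizes (wp N w (Set vP (Const 1) ;; ?den) Q) ?s3"
      unfolding read_sizes_def
      by - (rule wp_Set_Seq[where v = "int cnt"], simp add: cntw[symmetric], use iN[OF le(6)] in simp,
        rule wp_Set_Seq[where v = "int nc"], simp add: ncw[symmetric], use iN[OF nrc_le(2)] in simp,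
        rule wp_Assign, use iN[OF nrc_le(1)] nrw in simp, use nrw in simp)
  qed
  have 2: "wp N w (read_offsets ;; read_sizes ;; Set vP (Const 1) ;; ?den) Q ?s2"
  proof (rule wp_Seq)
    show "wp N w read_offsets (wp N w (read_sizes ;; Set vP (Const 1) ;; ?den) Q) ?s2"
      unfolding read_offsets_def
      by (rule wp_Set_Seq[where v = pb], simp add: pb_def, use pw p0 in simp,
        rule wp_Set_Seq[where v = pC], simp add: pC_def, use pw p0 in simp,
        rule wp_Set_Seq[where v = pc], simp add: pc_def, use pw p0 in simp,
        rule wp_Set_Seq[where v = pD], simp add: pD_def, use pw p0 in simp,
        rule wp_Set_Seq[where v = pd], simp add: pd_def, use pw p0 in simp,
        rule wp_Assign, use pw p0 in \<open>simp add: py_def\<close>)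
        (use 3 in \<open>simp add: py_def\<close>)
  qed
  have kk: "0 < int n + int g \<Longrightarrow> inp 2 = int K" "\<not> 0 < int n + int g \<Longrightarrow> K = 0"
    by (auto simp: header(3) K)
  have mw: "int m < 2 ^ w" "int n < 2 ^ w" "int g < 2 ^ w" "int K < 2 ^ w" using iN le by auto
  show ?thesis
    unfolding read_dims_def
    by (rule wp_Set_Seq[where v = "int m"], simp add: s header, use mw in simp,
        rule wp_Set_Seq[where v = "int n"], simp add: s header, use mw in simp,
        rule wp_Set_Seq[where v = "int g"], simp add: s header, use mw in simp,
        rule wp_Seq, rule wp_If; rule wp_Assign)
      (use mw 2 kk in \<open>auto simp: s\<close>)
qed

lemma wp_check_target:
  assumes dm: "dims s" and zero: "s vbad 0 = 0" "\<And>y. s aT y = 0"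
    and post: "\<And>s'. frame (writes check_target) s s' \<Longrightarrow> s' vbad 0 = of_bool bad \<Longrightarrow>
      (\<And>i. i < m \<Longrightarrow> s' aT (int i) = of_bool (act i)) \<Longrightarrow> Q s'"
  shows "wp N w check_target Q s"
proof -
  have mN: "m \<le> N" "n \<le> N" using N(1) le_cnt by linarith+
  show ?thesis
    unfolding check_target_def
  proof (rule wp_For[where n = m and I = "\<lambda>t s'. s' vbad 0 = of_bool (\<exists>i<t. bs i * PP < dot n (As i) ys) \<and>
      (\<forall>i. s' aT (int i) = of_bool (i < t \<and> act i))"], goal_cases)
    case (1 s')
    then show ?case using dm by (simp add: frame_def dims_def)
  next
    case 5
    show ?case using zero by simp
  next
    case (6 i s')
    have dm': "dims s'" by (rule dims_frame[OF dm 6(2)]) auto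
    show ?case
    proof (rule wp_Seq, rule wp_Sum[where n = n and f = "\<lambda>j. As i j * ys j"], goal_cases)
      case (1 s'')
      then show ?case using dm' by (simp add: frame_def dims_def)
    next
      case (2 j s'')
      have dm'': "dims s''" by (rule dims_frame[OF dm' 2(2)]) auto
      have "s'' vx 0 = int i" using 2(2) 6(3) by (simp add: frame_def)
      then show ?case using dm'' 2(3) by (simp add: aval_scaled As_def ys_def) (simp add: dims_def)
    next
      case (6 t)
      have "\<bar>\<Sum>j<t. As i j * ys j\<bar> \<le> int n * (2 ^ (2 * z) * 2 ^ (2 * z))"
        by (rule abs_sum_prod_le) (use 6 scv_le in \<open>auto simp: As_def ys_def\<close>)
      also have "\<dots> \<le> 2 ^ n * (2 ^ (2 * z) * 2 ^ (2 * z))"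
        using nat_less_two_power_int[of n] by (intro mult_right_mono) auto
      also have "\<dots> = 2 ^ (n + 4 * z)" unfolding power_add[symmetric] by (rule arg_cong[of _ _ "power 2"]) simp
      also have "\<dots> < 2 ^ w" using w(3) by (intro power_strict_increasing) auto
      finally show ?case .
    next
      case (7 s'')
      have dm'': "dims s''" by (rule dims_frame[OF dm' 7(1)]) auto
      have x: "s'' vx 0 = int i" and bad': "s'' vbad = s' vbad" "s'' aT = s' aT" using 7(1) 6(3) by (auto simp: frame_def)
      let ?b = "Times (scaled (Plus (Var ob) (Times (Const 2) (Var vx)))) (Var vP)"
      have b: "aval ?b s'' = bs i * PP"
        using dm'' x by (simp add: aval_scaled bs_def) (simp add: dims_def)
      let ?post = "\<lambda>s''. (s''(vx := (s'' vx)(0 := 1 + int i))) vbad 0 = of_bool (\<exists>l<Suc i. bs l * PP < dot n (As l) ys) \<and>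
        (\<forall>l. (s''(vx := (s'' vx)(0 := 1 + int i))) aT (int l) = of_bool (l < Suc i \<and> act l))"
      \<comment> \<open>The state after the first test, whichever branch was taken, so that the
        second test is treated only once.\<close>
      define s3 where "s3 = (if bs i * PP < dot n (As i) ys then s''(vbad := (s'' vbad)(0 := 1)) else s'')"
      have dm3: "dims s3" and x3: "s3 vx 0 = int i" "s3 vacc 0 = dot n (As i) ys" "s3 aT = s' aT"
        using dm'' x 7(2) bad' by (auto simp: s3_def dims_def)
      have b3: "aval ?b s3 = bs i * PP"
        using dm3 x3 by (simp add: aval_scaled bs_def) (simp add: dims_def)
      have bad3: "s3 vbad 0 = of_bool (\<exists>l<Suc i. bs l * PP < dot n (As l) ys)"
        using 6(4) bad' by (auto simp: s3_def less_Suc_eq)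
      let ?tight = "If (Less (Var vacc) ?b) Skip (Assign aT (Var vx) (Const 1))"
      show ?case
      proof (rule wp_Seq)
        have rest: "wp N w ?tight
           ?post s3"
        proof (rule wp_If)
          assume "bval (Less (Var vacc) ?b) s3"
          then have "\<not> act i" unfolding bval.simps b3 using x3 by (simp add: act_def)
          then show "wp N w Skip ?post s3"
            using bad3 x3 6(4) by (intro wp_Skip) (auto simp: less_Suc_eq)
        next
          assume "\<not> bval (Less (Var vacc) ?b) s3"
          then have "act i" unfolding bval.simps b3 using x3 by (simp add: act_def)
          then show "wp N w (Assign aT (Var vx) (Const 1)) ?post s3"
            using bad3 x3 6(4) small by (intro wp_Assign) (auto simp: less_Suc_eq)
        qed
        show "wp N w (If (Less ?b (Var vacc)) (Set vbad (Const 1)) Skip)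
          (wp N w ?tight
           ?post) s''"
        proof (rule wp_If, goal_cases)
          case 1
          then have "s3 = s''(vbad := (s'' vbad)(0 := 1))" unfolding bval.simps b using 7(2) by (simp add: s3_def)
          then show ?case using rest small by (intro wp_Assign) auto
        next
          case 2
          then have "s3 = s''" unfolding bval.simps b using 7(2) by (simp add: s3_def)
          then show ?case using rest by (intro wp_Skip) auto
        qed
      qed
    qed (use mN Nw in auto)
  next
    case (7 s')
    have "frame (writes check_target) s s'" using 7(1) by (auto simp: frame_def)
    then show ?case by (rule post) (use 7(3) in \<open>auto simp: bad_def\<close>)
  qed (use mN Nw in auto)
qed

lemma PP_le': "\<bar>\<alpha> * PP * (1 - 2 * int (r mod 2))\<bar> \<le> 2 ^ (2 * z)"
proof -
  have "\<bar>1 - 2 * int (r mod 2)\<bar> = 1" by (cases "even r") (auto simp: odd_iff_mod_2_eq_one)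
  then have "\<bar>\<alpha> * PP * (1 - 2 * int (r mod 2))\<bar> = \<bar>\<alpha>\<bar> * \<bar>PP\<bar>" by (simp add: abs_mult)
  also have "\<dots> \<le> 1 * 2 ^ z" using \<alpha> PP_le by (intro mult_mono) auto
  also have "\<dots> \<le> 2 ^ (2 * z)" by (simp add: power_increasing)
  finally show ?thesis .
qed

text \<open>An entry of an equation row before the sign of the row is applied, as computed by
  \<open>dual_value\<close>.\<close>

definition dual_val :: "nat \<Rightarrow> nat \<Rightarrow> nat \<Rightarrow> int" where
  "dual_val r j l = (if l = 0 then (if j = r div 2 then \<alpha> * PP * (1 - 2 * int (r mod 2)) else 0)
    else if l < K + 1 then Cs j (l - 1) else if l = K + 1 then cs j
    else if (l - (K + 2)) div m = r \<and> act ((l - (K + 2)) mod m) then As ((l - (K + 2)) mod m) j else 0)"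

lemma dual_val_le: "\<bar>dual_val r j l\<bar> \<le> 2 ^ (2 * z)"
  using PP_le'[of r] scv_le by (simp add: dual_val_def Cs_def cs_def As_def)

lemma E_dual:
  assumes "\<not> i < 2 + g + 2 * n * m" "s = i - (2 + g + 2 * n * m)"
  shows "E i l = (1 - 2 * int (s mod 2)) * dual_val (s div 2 div n) (s div 2 mod n) l"
  using assms(1) unfolding lp_entry_def dual_val_def Let_def assms(2) by simp

lemma E_le: "\<bar>E i l\<bar> \<le> 2 ^ (2 * z)"
proof (cases "i < 2 + g + 2 * n * m")
  case True
  have one: "(1::int) \<le> 2 ^ (2 * z)" by simp
  show ?thesis using True scv_le one unfolding lp_entry_def Ds_def ds_def by auto
next
  case False
  define s where "s = i - (2 + g + 2 * n * m)"
  have "\<bar>1 - 2 * int (s mod 2)\<bar> = 1" by (cases "even s") (auto simp: odd_iff_mod_2_eq_one)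
  then show ?thesis unfolding E_dual[OF False s_def] abs_mult using dual_val_le by simp
qed

lemma E_less: "\<bar>E i l\<bar> < 2 ^ w"
  using E_le[of i l] small(1) by linarith

lemma int_sub_div: "int x - int (x div y) * int y = int (x mod y)"
  by (metis add_diff_cancel_left' div_mult_mod_eq of_nat_add of_nat_mult)

lemma wp_dual_entry:
  assumes dm: "dims s" and i: "s vrow 0 = int i" "i < nr" "\<not> i < 2 + g + 2 * n * m"
    and l: "s vcol 0 = int l" "l < nc" and act: "\<And>i. i < m \<Longrightarrow> s aT (int i) = of_bool (act i)"
    and post: "\<And>s'. frame {vh, vs, vqq, vsg, vr, vjj, vy, vym} s s' \<Longrightarrow> s' vh 0 = E i l \<Longrightarrow> Q s'"
  shows "wp N w (dual_entry \<alpha>) Q s"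
proof -
  define t where "t = i - (2 + g + 2 * n * m)"
  define q where "q = t div 2"
  define r where "r = q div n"
  define j where "j = q mod n"
  have ti: "int i - (2 + int g + 2 * int n * int m) = int t" using i(3) by (simp add: t_def of_nat_diff)
  have "t \<le> i" "q \<le> t" "r \<le> q" "j \<le> q" "t mod 2 \<le> t" by (auto simp: t_def q_def r_def j_def)
  then have bnd: "int t < 2 ^ w" "int q < 2 ^ w" "int (t mod 2) < 2 ^ w" "int r < 2 ^ w" "int j < 2 ^ w"
    using iN i(2) nrc_le(1) by (meson le_trans less_imp_le)+
  have E_eq: "E i l = (1 - 2 * int (t mod 2)) * dual_val r j l"
    using E_dual[OF i(3) t_def] by (simp add: q_def r_def j_def)
  let ?s5 = "s(vs := (s vs)(0 := int t), vqq := (s vqq)(0 := int q), vsg := (s vsg)(0 := int (t mod 2)),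
    vr := (s vr)(0 := int r), vjj := (s vjj)(0 := int j))"
  have dm5: "dims ?s5" using dm by (simp add: dims_def)
  have c5: "?s5 vcol 0 = int l" "?s5 vr 0 = int r" "?s5 vjj 0 = int j" "?s5 vK 0 = int K" "?s5 vP 0 = PP"
    "?s5 oC 0 = pC" "?s5 oc 0 = pc" "?s5 vm 0 = int m" "?s5 vq 0 = int n" "?s5 vsg 0 = int (t mod 2)"
    using l dm by (auto simp: dims_def)
  let ?P = "\<lambda>s'. frame {vh, vy, vym} ?s5 s' \<and> s' vh 0 = dual_val r j l"
  have dv: "\<bar>dual_val r j l\<bar> < 2 ^ w" using dual_val_le[of r j l] small(1) by linarith
  have set_vh: "wp N w (Set vh e) ?P s'" if "frame {vh, vy, vym} ?s5 s'" "aval e s' = dual_val r j l" for e s'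
    using that dv by (intro wp_Assign) (auto simp: frame_def)
  have inner: "wp N w (dual_value \<alpha>) ?P ?s5"
    unfolding dual_value_def
  proof (rule wp_If, goal_cases)
    case 1
    then have l0: "l = 0" using c5 by simp
    have rd: "int r div 2 = int (r div 2)" by (simp add: zdiv_int)
    have rm: "int r - int (r div 2) * 2 = int (r mod 2)" using int_sub_div[of r 2] by simp
    show ?case
    proof (rule wp_If, goal_cases)
      case 1
      then have "j = r div 2" unfolding bval_Eq aval.simps c5 rd by simp
      then show ?case
        by (intro set_vh) (simp, unfold aval.simps c5 rd rm, simp add: dual_val_def l0)
    next
      case 2
      then have "j \<noteq> r div 2" unfolding bval_Eq aval.simps c5 rd by simp
      then show ?case by (intro set_vh) (auto simp: dual_val_def l0)
    qed
  next
    case 2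
    then have l1: "1 \<le> l" using c5 by simp
    show ?case
    proof (rule wp_If, goal_cases)
      case 1
      then have "l < K + 1" using c5 by simp
      then show ?case using l1
        by (intro set_vh, simp, unfold aval_scaled[OF dm5] aval.simps c5)
          (simp add: dual_val_def Cs_def of_nat_diff)
    next
      case 2
      then have l2: "\<not> l < K + 1" using c5 by simp
      show ?case
      proof (rule wp_If, goal_cases)
        case 1
        then have "l = K + 1" using c5 by simp
        then show ?case
          by (intro set_vh, simp, unfold aval_scaled[OF dm5] aval.simps c5)
            (simp add: dual_val_def cs_def)
      next
        case 2
        then have l3: "l \<noteq> K + 1" using c5 by auto
        define x where "x = l - (K + 2)"
        have xl: "int l - (int K + 2) = int x" using l2 l3 by (simp add: x_def of_nat_diff)
        have x_lt: "x < 2 * n * m" using l(2) l2 l3 unfolding x_def lp_cols_def by linarith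
        then have m0: "0 < m" by (cases m) auto
        have "x mod m \<le> x" "x \<le> l" by (auto simp: x_def)
        then have xw: "int x < 2 ^ w" "int (x mod m) < 2 ^ w"
          using iN l(2) nrc_le(2) by (meson le_trans less_imp_le)+
        have div: "int x div int m = int (x div m)" by (simp add: zdiv_int)
        let ?s7 = "?s5(vy := (?s5 vy)(0 := int x), vym := (?s5 vym)(0 := int (x mod m)))"
        have dm7: "dims ?s7" using dm5 by (simp add: dims_def)
        have c7: "?s7 vy 0 = int x" "?s7 vym 0 = int (x mod m)" "?s7 vr 0 = int r" "?s7 vjj 0 = int j" "?s7 vm 0 = int m"
          "?s7 vq 0 = int n" "?s7 aT (int (x mod m)) = of_bool (act (x mod m))"
          using c5 act[of "x mod m"] m0 by auto
        have fr7: "frame {vh, vy, vym} ?s5 ?s7" by (auto simp: frame_def)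
        let ?last = "If (And (Eq (Div (Var vy) (Var vm)) (Var vr)) (Less (Const 0) (Cell aT (Var vym))))
          (Set vh (scaled (Plus (Const 4) (Times (Const 2) (Plus (Times (Var vym) (Var vq)) (Var vjj))))))
          (Set vh (Const 0))"
        have "wp N w ?last ?P ?s7"
        proof (rule wp_If, goal_cases)
          case 1
          then have "x div m = r" "act (x mod m)" unfolding bval.simps bval_Eq aval.simps c7 div by (auto split: if_splits)
          then show ?case using l1 l2 l3
            by (intro set_vh[OF fr7], unfold aval_scaled[OF dm7] aval.simps c7)
              (simp add: dual_val_def x_def As_def)
        next
          case 2
          then have "\<not> (x div m = r \<and> act (x mod m))" unfolding bval.simps bval_Eq aval.simps c7 div by auto
          then show ?case using l1 l2 l3
            by (intro set_vh[OF fr7]) (auto simp: dual_val_def x_def)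
        qed
        note rest = this
        have "wp N w (Set vym (Minus (Var vy) (Times (Div (Var vy) (Var vm)) (Var vm))) ;; ?last) ?P (?s5(vy := (?s5 vy)(0 := int x)))"
          by (rule wp_Set_Seq[where v = "int (x mod m)"]) (use rest xw c5 div int_sub_div[of x m] in simp_all)
        note rest = this
        show ?case
          by (rule wp_Set_Seq[where v = "int x"]) (use rest xw c5 xl in simp_all)
      qed
    qed
  qed
  have last: "wp N w (dual_value \<alpha> ;; Set vh (Times (Minus (Const 1) (Times (Const 2) (Var vsg))) (Var vh))) Q ?s5"
  proof (rule wp_Seq, rule wp_mono[OF inner])
    fix s' assume P: "?P s'"
    then have "s' vsg 0 = int (t mod 2)" using c5 by (simp add: frame_def)
    then have val: "aval (Times (Minus (Const 1) (Times (Const 2) (Var vsg))) (Var vh)) s' = E i l"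
      using P by (simp add: E_eq)
    have fr: "frame {vh, vs, vqq, vsg, vr, vjj, vy, vym} s s'"
      by (rule frame_trans[OF _ conjunct1[OF P], of "{vs, vqq, vsg, vr, vjj}"]) (auto simp: frame_def)
    show "wp N w (Set vh (Times (Minus (Const 1) (Times (Const 2) (Var vsg))) (Var vh))) Q s'"
    proof (rule wp_Assign)
      show "\<bar>aval (Times (Minus (Const 1) (Times (Const 2) (Var vsg))) (Var vh)) s'\<bar> < 2 ^ w"
        unfolding val by (rule E_less)
      show "Q (s'(vh := (s' vh)(aval (Const 0) s' := aval (Times (Minus (Const 1) (Times (Const 2) (Var vsg))) (Var vh)) s')))"
        unfolding val by (rule post) (auto intro: frame_upd[OF fr])
    qed
  qed
  have q2: "int t div 2 = int q" "int t - int q * 2 = int (t mod 2)" "int q div int n = int r" "int q - int r * int n = int j"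
    using int_sub_div[of t 2] int_sub_div[of q n] by (simp_all add: q_def r_def j_def zdiv_int)
  have d: "s vm 0 = int m" "s vq 0 = int n" "s vg 0 = int g" using dm by (auto simp: dims_def)
  show ?thesis
    unfolding dual_entry_def
    by (rule wp_Set_Seq[where v = "int t"], simp add: d i ti, use bnd in simp,
        rule wp_Set_Seq[where v = "int q"], simp add: q2, use bnd in simp,
        rule wp_Set_Seq[where v = "int (t mod 2)"], simp add: q2, use bnd in simp,
        rule wp_Set_Seq[where v = "int r"], simp add: q2 d, use bnd in simp,
        rule wp_Set_Seq[where v = "int j"], simp add: q2 d, use bnd in simp)
      (use last in simp)
qed

lemma wp_lp_entry_com:
  assumes dm: "dims s" and i: "s vrow 0 = int i" "i < nr"
    and l: "s vcol 0 = int l" "l < nc" and act: "\<And>i. i < m \<Longrightarrow> s aT (int i) = of_bool (act i)"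
    and post: "\<And>s'. frame {vh, vs, vqq, vsg, vr, vjj, vy, vym} s s' \<Longrightarrow> s' vh 0 = E i l \<Longrightarrow> Q s'"
  shows "wp N w (lp_entry_com \<alpha>) Q s"
proof -
  have d: "s vm 0 = int m" "s vq 0 = int n" "s vg 0 = int g" "s vK 0 = int K" "s oD 0 = pD" "s od 0 = pd"
    using dm by (auto simp: dims_def)
  have set_vh: "wp N w (Set vh e) Q s" if "aval e s = E i l" for e
    using that E_less[of i l] by (intro wp_Assign) (auto intro!: post simp: frame_def)
  show ?thesis
    unfolding lp_entry_com_def
  proof (rule wp_If, goal_cases)
    case 1
    then have "i = 0" using i by simp
    then show ?case by (intro wp_If set_vh) (auto simp: l lp_entry_def)
  next
    case 2
    then have i1: "i \<noteq> 0" using i by simp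
    show ?case
    proof (rule wp_If, goal_cases)
      case 1
      then have "i = 1" using i i1 by simp
      then show ?case by (intro wp_If set_vh) (auto simp: l d lp_entry_def)
    next
      case 2
      then have i2: "\<not> i < 2" using i by simp
      show ?case
      proof (rule wp_If, goal_cases)
        case 1
        then have i3: "i < 2 + g" using i d by simp
        show ?case
        proof (rule wp_If, goal_cases)
          case 1
          then have "l = 0" using l by simp
          then show ?case using i2 i3 by (intro set_vh) (simp add: lp_entry_def)
        next
          case 2
          then have l0: "l \<noteq> 0" using l by simp
          show ?case
          proof (rule wp_If, goal_cases)
            case 1
            then have "l < K + 1" using l d by simp
            then show ?case using i2 i3 l0
              by (intro set_vh) (simp add: aval_scaled[OF dm] lp_entry_def Ds_def l i d of_nat_diff)
          next
            case 2
            then have l1: "\<not> l < K + 1" using l d by simp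
            show ?case
            proof (rule wp_If, goal_cases)
              case 1
              then have "l = K + 1" using l d by simp
              then show ?case using i2 i3
                by (intro set_vh) (simp add: aval_scaled[OF dm] lp_entry_def ds_def l i d of_nat_diff)
            next
              case 2
              then have "l \<noteq> K + 1" using l d by auto
              then show ?case using i2 i3 l0 l1 by (intro set_vh) (simp add: lp_entry_def)
            qed
          qed
        qed
      next
        case 2
        then have i3: "\<not> i < 2 + g" using i d by simp
        show ?case
        proof (rule wp_If, goal_cases)
          case 1
          then have "int i < int (2 + g + 2 * n * m)" using i d by simp
          then have i4: "i < 2 + g + 2 * n * m" by (simp only: of_nat_less_iff)
          have E: "E i l = of_bool (l + g = K + i)" unfolding lp_entry_def using i1 i2 i3 i4 by simp
          have "int l + int g = int K + int i \<longleftrightarrow> l + g = K + i" by linarith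
          then show ?case by (intro wp_If set_vh) (auto simp: E l i d)
        next
          case 2
          then have "\<not> int i < int (2 + g + 2 * n * m)" using i d by simp
          then have i4: "\<not> i < 2 + g + 2 * n * m" by (simp only: of_nat_less_iff not_False_eq_True)
          show ?case by (rule wp_dual_entry[OF dm i i4 l act post])
        qed
      qed
    qed
  qed
qed

lemma wp_fill_lp:
  assumes dm: "dims s" and act: "\<And>i. i < m \<Longrightarrow> s aT (int i) = of_bool (act i)"
    and post: "\<And>s'. frame (writes (fill_lp \<alpha>)) s s' \<Longrightarrow>
      (\<And>i l. i < nr \<Longrightarrow> l < nc \<Longrightarrow> entry nc (s' aH) i l = E i l) \<Longrightarrow> Q s'"
  shows "wp N w (fill_lp \<alpha>) Q s"
  unfolding fill_lp_def
proof (rule wp_Fill[where n = "nr * nc" and a = aH and g = "\<lambda>x. E (x div nc) (x mod nc)"], goal_cases)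
  case (1 s')
  then show ?case using dm by (simp add: frame_def dims_def)
next
  case (6 x s')
  have dm': "dims s'" by (rule dims_frame[OF dm 6(2)]) auto
  have v: "s' vn 0 = int nc" using dm' by (simp add: dims_def)
  have lt: "x div nc < nr" "x mod nc < nc"
    using 6(1) nc_pos by (auto simp: less_mult_imp_div_less)
  have w': "int (x div nc) < 2 ^ w" "int (x mod nc) < 2 ^ w"
    using iN lt nrc_le by (meson le_trans less_imp_le)+
  let ?s2 = "s'(vrow := (s' vrow)(0 := int (x div nc)), vcol := (s' vcol)(0 := int (x mod nc)))"
  have dm2: "dims ?s2" using dm' by (simp add: dims_def)
  have act2: "?s2 aT (int i) = of_bool (act i)" if "i < m" for i
    using act[OF that] 6(2) by (simp add: frame_def)
  have "wp N w (lp_entry_com \<alpha> ;; Assign aH (Var vx) (Var vh)) (\<lambda>s''. s'' aH = (s' aH)(int x := E (x div nc) (x mod nc))) ?s2"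
  proof (rule wp_Seq, rule wp_lp_entry_com[OF dm2 _ lt(1) _ lt(2) act2])
    fix s3 assume f: "frame {vh, vs, vqq, vsg, vr, vjj, vy, vym} ?s2 s3" and h: "s3 vh 0 = E (x div nc) (x mod nc)"
    have "s3 aH = s' aH" "s3 vx 0 = int x" using f 6(3) by (auto simp: frame_def)
    then show "wp N w (Assign aH (Var vx) (Var vh)) (\<lambda>s''. s'' aH = (s' aH)(int x := E (x div nc) (x mod nc))) s3"
      using h E_less by (intro wp_Assign) auto
  qed auto
  note rest = this
  have d1: "int x div int nc = int (x div nc)" by (simp add: zdiv_int)
  show ?case
    by (rule wp_Set_Seq[where v = "int (x div nc)"], simp add: v 6(3) d1, use w' in simp,
        rule wp_Set_Seq[where v = "int (x mod nc)"], simp add: v 6(3) int_sub_div, use w' in simp)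
      (use rest in simp)
next
  case (7 s')
  have "frame (writes (fill_lp \<alpha>)) s s'" using 7(1) by (auto simp: frame_def)
  then show ?case by (rule post) (use entry_Fill[OF 7(2)] idx_div_mod in auto)
qed (use N Nw in auto)

text \<open>Each of the two summands is at most 2^(L - 1).\<close>

lemma sq_sum_le: "int (2 * nc + nr) + 2 * (\<Sum>i<nr. \<Sum>l<nc. (E i l)\<^sup>2) \<le> 2 ^ L"
proof -
  have "(\<Sum>i<nr. \<Sum>l<nc. (E i l)\<^sup>2) \<le> (\<Sum>i<nr. \<Sum>l<nc. 2 ^ (4 * z))"
  proof (intro sum_mono)
    fix i l
    have "(E i l)\<^sup>2 = \<bar>E i l\<bar>\<^sup>2" by simp
    also have "\<dots> \<le> (2 ^ (2 * z))\<^sup>2" by (rule power_mono[OF E_le]) simp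
    finally show "(E i l)\<^sup>2 \<le> 2 ^ (4 * z)" by (simp add: power_mult[symmetric] mult.commute)
  qed
  also have "\<dots> = int nr * (int nc * 2 ^ (4 * z))" by simp
  also have "\<dots> \<le> 2 ^ nr * (2 ^ nc * 2 ^ (4 * z))"
    using nat_less_two_power_int[of nr] nat_less_two_power_int[of nc]
    by (intro mult_mono mult_right_mono) auto
  also have "\<dots> = 2 ^ (nr + nc + 4 * z)" by (simp add: power_add mult_ac)
  finally have 1: "2 * (\<Sum>i<nr. \<Sum>l<nc. (E i l)\<^sup>2) \<le> 2 ^ Suc (nr + nc + 4 * z)" by simp
  have "(2::int) ^ Suc (nr + nc + 4 * z) \<le> 2 ^ (L - 1)" by (rule power_increasing) (use L in auto)
  moreover have "int (2 * nc + nr) \<le> 2 ^ (2 * nc + nr)" using nat_less_two_power_int[of "2 * nc + nr"] by linarith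
  moreover have "(2::int) ^ (2 * nc + nr) \<le> 2 ^ (L - 1)" by (rule power_increasing) (use L in auto)
  moreover have "(2::int) ^ L = 2 ^ (L - 1) + 2 ^ (L - 1)"
    using L by (cases L) auto
  ultimately show ?thesis using 1 by linarith
qed

lemma wp_decide:
  assumes s: "s 0 = inp" and zero: "\<And>a y. a \<noteq> 0 \<Longrightarrow> s a y = 0"
    and post: "\<And>s'. s' vFlag 0 = of_bool (\<not> bad \<and> cone_feasible nr nc E) \<Longrightarrow> Q s'"
  shows "wp N w (decide \<alpha>) Q s"
  unfolding decide_def
proof (rule wp_Seq, rule wp_read_dims[of s, OF s], rule wp_Seq)
  fix s1 assume f1: "frame (writes read_dims) s s1" and d1: "dims s1"
  show "wp N w check_target (wp N w (fill_lp \<alpha> ;; solve_cone ;;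
    If (Less (Const 0) (Var vbad)) (Set vFlag (Const 0)) Skip) Q) s1"
  proof (rule wp_check_target[OF d1])
    show "s1 vbad 0 = 0" "\<And>y. s1 aT y = 0" using f1 zero by (simp_all add: frame_def)
    fix s2 assume f2: "frame (writes check_target) s1 s2" and b2: "s2 vbad 0 = of_bool bad"
      and act2: "\<And>i. i < m \<Longrightarrow> s2 aT (int i) = of_bool (act i)"
    have d2: "dims s2" by (rule dims_frame[OF d1 f2]) auto
    show "wp N w (fill_lp \<alpha> ;; solve_cone ;; If (Less (Const 0) (Var vbad)) (Set vFlag (Const 0)) Skip) Q s2"
    proof (rule wp_Seq, rule wp_fill_lp[OF d2 act2], assumption)
      fix s3 assume f3: "frame (writes (fill_lp \<alpha>)) s2 s3"
        and E3: "\<And>i l. i < nr \<Longrightarrow> l < nc \<Longrightarrow> entry nc (s3 aH) i l = E i l"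
      have d3: "dims s3" by (rule dims_frame[OF d2 f3]) auto
      have z3: "s3 aB y = 0" "s3 aN y = 0" "s3 aS y = 0" "s3 vFlag y = 0" for y
        using f1 f2 f3 zero by (simp_all add: frame_def)
      show "wp N w (solve_cone ;; If (Less (Const 0) (Var vbad)) (Set vFlag (Const 0)) Skip) Q s3"
      proof (rule wp_Seq, rule wp_solve_cone[where M = nr and n = nc and H = E and L = L])
        fix s4 assume f4: "frame (writes solve_cone) s3 s4" and r4: "s4 vFlag 0 = of_bool (cone_feasible nr nc E)"
        have "s4 vbad 0 = of_bool bad" using f4 f3 b2 by (simp add: frame_def)
        then show "wp N w (If (Less (Const 0) (Var vbad)) (Set vFlag (Const 0)) Skip) Q s4"
          using r4 small(2) by (intro wp_If wp_Assign wp_Skip) (auto intro!: post)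
      next
        show "E 0 j = of_bool (j = 0)" for j by (simp add: lp_entry_def)
        show "2 * nc + nr \<le> N" using L N by linarith
      qed (use d3 E3 z3 N w sq_sum_le nc_pos nr_pos in \<open>auto simp: dims_def\<close>)
    qed
  qed
qed

end

section \<open>Instances and their encoding\<close>

lemma length_concat_uniform: "\<forall>l\<in>set ls. length l = n \<Longrightarrow> length (concat ls) = length ls * n"
  by (induction ls) auto

lemma nth_concat_uniform:
  "\<forall>l\<in>set ls. length l = n \<Longrightarrow> i < length ls \<Longrightarrow> j < n \<Longrightarrow> concat ls ! (i * n + j) = ls ! i ! j"
proof (induction ls arbitrary: i)
  case (Cons l ls)
  show ?case
  proof (cases i)
    case 0
    then show ?thesis using Cons.prems by (simp add: nth_append)
  next
    case (Suc i')
    then have "concat ls ! (i' * n + j) = ls ! i' ! j" using Cons by simp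
    moreover have "length l = n" using Cons.prems by simp
    ultimately show ?thesis using Suc by (simp add: nth_append)
  qed
qed simp

lemma length_mat_list: "A \<in> carrier_mat m n \<Longrightarrow> length (concat (mat_to_list A)) = m * n"
  by (subst length_concat_uniform[of _ n]) (auto simp: mat_to_list_def)

lemma nth_mat_list:
  "A \<in> carrier_mat m n \<Longrightarrow> i < m \<Longrightarrow> j < n \<Longrightarrow> concat (mat_to_list A) ! (i * n + j) = A $$ (i, j)"
  by (subst nth_concat_uniform[of _ n]) (auto simp: mat_to_list_def)

lemma list_of_vec_carrier:
  "v \<in> carrier_vec n \<Longrightarrow> length (list_of_vec v) = n"
  "v \<in> carrier_vec n \<Longrightarrow> i < n \<Longrightarrow> list_of_vec v ! i = v $ i"
  by (auto simp: list_of_vec_index)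

lemma length_encode_rats: "length (concat (map encode_rat rs)) = 2 * length rs"
  by (induction rs) (auto simp: encode_rat_def)

lemma nth_encode_rats:
  "t < length rs \<Longrightarrow> concat (map encode_rat rs) ! (2 * t) = fst (quotient_of (rs ! t))"
  "t < length rs \<Longrightarrow> concat (map encode_rat rs) ! (2 * t + 1) = snd (quotient_of (rs ! t))"
proof -
  assume t: "t < length rs"
  have u: "\<forall>l\<in>set (map encode_rat rs). length l = 2" by (auto simp: encode_rat_def)
  show "concat (map encode_rat rs) ! (2 * t) = fst (quotient_of (rs ! t))"
    using nth_concat_uniform[OF u, of t 0] t by (simp add: encode_rat_def mult.commute)
  show "concat (map encode_rat rs) ! (2 * t + 1) = snd (quotient_of (rs ! t))"
    using nth_concat_uniform[OF u, of t 1] t by (simp add: encode_rat_def mult.commute)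
qed

text \<open>All data in one list, so that the number with index t sits in the cells 4 + 2 t and 5 +
  2 t whatever block it belongs to.\<close>

definition rat_list :: "instance_data \<Rightarrow> rat list" where
  "rat_list I = concat (mat_to_list (matA I)) @ list_of_vec (vecb I) @ concat (mat_to_list (matC I)) @
    list_of_vec (vecc I) @ concat (mat_to_list (matD I)) @ list_of_vec (vecd I) @ list_of_vec (target I)"

lemma encode_rat_list: "encode I =
    [int (dim_row (matA I)), int (dim_col (matA I)), int (dim_col (matD I)), int (dim_row (matD I))] @
    concat (map encode_rat (rat_list I))"
  by (simp add: encode_def rat_list_def encode_mat_def encode_vec_def)

lemma int_size_pos: "1 \<le> int_size x"
  by (simp add: int_size_def)

lemma abs_le_int_size: "\<bar>x\<bar> \<le> 2 ^ int_size x"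
proof -
  obtain k where "int_size x = Suc k" "\<bar>x\<bar> < 2 ^ k" by (rule int_size_ex)
  then show ?thesis by simp
qed

lemma input_size_sum: "input_size xs = (\<Sum>p<length xs. int_size (xs ! p))"
  by (simp add: input_size_def sum_list_sum_nth lessThan_atLeast0)

lemma length_le_input_size: "length xs \<le> input_size xs"
proof -
  have "(\<Sum>p<length xs. 1) \<le> (\<Sum>p<length xs. int_size (xs ! p))"
    by (rule sum_mono) (rule int_size_pos)
  then show ?thesis by (simp add: input_size_sum)
qed

lemma init_state_0: "init_state xs 0 p = (if 0 \<le> p \<and> p < int (length xs) then xs ! nat p else 0)"
  by (simp add: init_state_def)

lemma abs_init_le: "\<bar>init_state xs 0 p\<bar> \<le> 2 ^ input_size xs"
proof (cases "0 \<le> p \<and> p < int (length xs)")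
  case True
  then have "nat p < length xs" by (simp add: nat_less_iff)
  then have "int_size (xs ! nat p) \<le> input_size xs"
    unfolding input_size_def by (intro member_le_sum_list) auto
  then have "(2::int) ^ int_size (xs ! nat p) \<le> 2 ^ input_size xs" by (intro power_increasing) auto
  with abs_le_int_size have "\<bar>xs ! nat p\<bar> \<le> 2 ^ input_size xs" by (rule order_trans)
  then show ?thesis using True unfolding init_state_0 by simp
qed (auto simp: init_state_0)

text \<open>The factors come from distinct input cells, so their lengths add up to at most the input
  size. The hypothesis says that the last factor, in cell 5 + 2 (t - 1), still lies inside the
  input.\<close>

lemma abs_prod_init_le:
  assumes "5 + 2 * t \<le> length xs + 1"
  shows "\<bar>\<Prod>x<t. init_state xs 0 (5 + 2 * int x)\<bar> \<le> 2 ^ input_size xs"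
proof -
  have "\<bar>\<Prod>x<t. init_state xs 0 (5 + 2 * int x)\<bar> \<le> (\<Prod>x<t. 2 ^ int_size (xs ! (5 + 2 * x)))"
    unfolding abs_prod
  proof (rule prod_mono)
    fix x assume "x \<in> {..<t}"
    then have "init_state xs 0 (5 + 2 * int x) = xs ! (5 + 2 * x)"
      using assms by (simp add: init_state_0 nat_add_distrib nat_mult_distrib)
    then show "0 \<le> \<bar>init_state xs 0 (5 + 2 * int x)\<bar> \<and>
        \<bar>init_state xs 0 (5 + 2 * int x)\<bar> \<le> 2 ^ int_size (xs ! (5 + 2 * x))"
      using abs_le_int_size by simp
  qed
  also have "\<dots> = 2 ^ (\<Sum>x<t. int_size (xs ! (5 + 2 * x)))" by (simp add: power_sum)
  also have "\<dots> \<le> 2 ^ input_size xs"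
  proof (rule power_increasing)
    have "(\<Sum>x<t. int_size (xs ! (5 + 2 * x))) = (\<Sum>p\<in>(\<lambda>x. 5 + 2 * x) ` {..<t}. int_size (xs ! p))"
      by (subst sum.reindex) (auto simp: inj_on_def)
    also have "\<dots> \<le> (\<Sum>p<length xs. int_size (xs ! p))"
      by (rule sum_mono2) (use assms in auto)
    finally show "(\<Sum>x<t. int_size (xs ! (5 + 2 * x))) \<le> input_size xs" by (simp add: input_size_sum)
  qed simp
  finally show ?thesis .
qed

text \<open>The number of rows for m = n = g = z; it also dominates the number of columns for m = n
  = k = z.\<close>

definition dim_bound :: "nat \<Rightarrow> nat" where
  "dim_bound z = 2 + z + 2 * z * z + 2 * z * z * 2"

definition L_bound :: "nat \<Rightarrow> nat" where
  "L_bound z = 5 * dim_bound z + 4 * z + 2"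

definition N_bound :: "nat \<Rightarrow> nat" where
  "N_bound z = 4 + 2 * z + dim_bound z * dim_bound z + num_T (dim_bound z) (dim_bound z) +
    num_R (dim_bound z) (dim_bound z) (L_bound z) + L_bound z +
    exp_e (dim_bound z) (dim_bound z) (L_bound z) + dim_bound z"

definition w_bound :: "nat \<Rightarrow> nat" where
  "w_bound z = exp_W (dim_bound z) (dim_bound z) (L_bound z) + N_bound z + 5 * z + 1"

lemma poly_bounded_bounds: "poly_bounded N_bound" "poly_bounded w_bound"
proof -
  have d: "poly_bounded dim_bound" unfolding dim_bound_def[abs_def] by (intro poly_bounded_intros)
  have L: "poly_bounded L_bound" unfolding L_bound_def[abs_def] by (intro poly_bounded_intros d)
  have e: "poly_bounded (\<lambda>z. exp_e (dim_bound z) (dim_bound z) (L_bound z))"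
    unfolding exp_e_def by (intro poly_bounded_intros d L)
  have T: "poly_bounded (\<lambda>z. num_T (dim_bound z) (dim_bound z))"
    unfolding num_T_def by (intro poly_bounded_intros d L)
  have R: "poly_bounded (\<lambda>z. num_R (dim_bound z) (dim_bound z) (L_bound z))"
    unfolding num_R_def exp_ts_def by (intro poly_bounded_intros d L e)
  show N: "poly_bounded N_bound"
    unfolding N_bound_def[abs_def] by (intro poly_bounded_intros d L e T R)
  have u: "poly_bounded (\<lambda>z. exp_u (dim_bound z) (dim_bound z) (L_bound z))"
    unfolding exp_u_def by (intro poly_bounded_intros d L e)
  have D: "poly_bounded (\<lambda>z. exp_D (dim_bound z) (dim_bound z) (L_bound z))"
    unfolding exp_D_def by (intro poly_bounded_intros d L e u R)
  show "poly_bounded w_bound"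
    unfolding w_bound_def[abs_def] exp_W_def by (intro poly_bounded_intros d L e u R D T N)
qed

lemma exp_mono_dims:
  assumes "M \<le> d" "n \<le> d"
  shows "num_T M n \<le> num_T d d" "exp_e M n l \<le> exp_e d d l" "num_R M n l \<le> num_R d d l"
    "exp_W M n l \<le> exp_W d d l"
proof -
  show T: "num_T M n \<le> num_T d d" unfolding num_T_def using assms by (intro mult_mono add_mono) auto
  show e: "exp_e M n l \<le> exp_e d d l" unfolding exp_e_def using assms by (intro mult_mono add_mono) auto
  have ts: "exp_ts M n l \<le> exp_ts d d l" unfolding exp_ts_def using assms e by (intro add_mono) auto
  show R: "num_R M n l \<le> num_R d d l" unfolding num_R_def using assms ts by (intro mult_mono add_mono) auto
  have u: "exp_u M n l \<le> exp_u d d l" unfolding exp_u_def using assms e by (intro add_mono) auto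
  have D: "exp_D M n l \<le> exp_D d d l" unfolding exp_D_def using assms R u by (intro mult_mono add_mono) auto
  show "exp_W M n l \<le> exp_W d d l" unfolding exp_W_def using assms T R u D by (intro mult_mono add_mono) auto
qed

lemma index_less:
  fixes p q r m n g x :: nat
  shows "x < p \<Longrightarrow> x < p + m + q + n + r + g + n" "x < m \<Longrightarrow> p + x < p + m + q + n + r + g + n"
    "x < q \<Longrightarrow> p + m + x < p + m + q + n + r + g + n" "x < n \<Longrightarrow> p + m + q + x < p + m + q + n + r + g + n"
    "x < r \<Longrightarrow> p + m + q + n + x < p + m + q + n + r + g + n"
    "x < g \<Longrightarrow> p + m + q + n + r + x < p + m + q + n + r + g + n"
    "x < n \<Longrightarrow> p + m + q + n + r + g + x < p + m + q + n + r + g + n"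
  by linarith+

locale lp_instance =
  fixes I :: instance_data and m n k g :: nat
  assumes dims: "matA I \<in> carrier_mat m n" "vecb I \<in> carrier_vec m" "matC I \<in> carrier_mat n k"
    "vecc I \<in> carrier_vec n" "matD I \<in> carrier_mat g k" "vecd I \<in> carrier_vec g" "target I \<in> carrier_vec n"
begin

definition "K = (if 0 < n + g then k else 0)"
definition "cnt = m * n + m + n * K + n + g * K + g + n"
abbreviation "z \<equiv> input_size (encode I)"
abbreviation "inp \<equiv> init_state (encode I) 0"

definition a :: "nat \<Rightarrow> nat \<Rightarrow> real" where "a i j = of_rat (matA I $$ (i, j))"
definition b :: "nat \<Rightarrow> real" where "b i = of_rat (vecb I $ i)"
definition C :: "nat \<Rightarrow> nat \<Rightarrow> real" where "C j l = of_rat (matC I $$ (j, l))"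
definition c :: "nat \<Rightarrow> real" where "c j = of_rat (vecc I $ j)"
definition D :: "nat \<Rightarrow> nat \<Rightarrow> real" where "D i l = of_rat (matD I $$ (i, l))"
definition d :: "nat \<Rightarrow> real" where "d i = of_rat (vecd I $ i)"
definition y :: "nat \<Rightarrow> real" where "y j = of_rat (target I $ j)"

lemma K_mult: "n * K = n * k" "g * K = g * k"
  by (auto simp: K_def)

lemma K_eq: "j < n \<Longrightarrow> K = k" "i < g \<Longrightarrow> K = k" for i j :: nat
  by (auto simp: K_def)

lemma length_rat_list: "length (rat_list I) = cnt"
  unfolding rat_list_def cnt_def K_mult
  using dims by (simp add: length_mat_list[OF dims(1)] length_mat_list[OF dims(3)] length_mat_list[OF dims(5)])

lemma length_encode: "length (encode I) = 4 + 2 * cnt"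
  unfolding encode_rat_list by (simp add: length_encode_rats length_rat_list)

lemma header: "inp 0 = int m" "inp 1 = int n" "inp 2 = int k" "inp 3 = int g"
  using dims by (auto simp: init_state_0 encode_rat_list)

lemma inp_rat:
  assumes "t < cnt"
  shows "inp (4 + 2 * int t) = fst (quotient_of (rat_list I ! t))" "inp (5 + 2 * int t) = snd (quotient_of (rat_list I ! t))"
proof -
  have t: "t < length (rat_list I)" using assms by (simp add: length_rat_list)
  have "nat (4 + 2 * int t) = 4 + 2 * t" "nat (5 + 2 * int t) = 4 + (2 * t + 1)" by simp_all
  then have "inp (4 + 2 * int t) = concat (map encode_rat (rat_list I)) ! (2 * t)"
    "inp (5 + 2 * int t) = concat (map encode_rat (rat_list I)) ! (2 * t + 1)"
    using assms unfolding init_state_0 length_encode by (simp_all add: encode_rat_list)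
  then show "inp (4 + 2 * int t) = fst (quotient_of (rat_list I ! t))" "inp (5 + 2 * int t) = snd (quotient_of (rat_list I ! t))"
    using nth_encode_rats[OF t] by simp_all
qed

lemma nth_rat_list:
  "i < m \<Longrightarrow> j < n \<Longrightarrow> rat_list I ! (i * n + j) = matA I $$ (i, j)"
  "i < m \<Longrightarrow> rat_list I ! (m * n + i) = vecb I $ i"
  "j < n \<Longrightarrow> l < k \<Longrightarrow> rat_list I ! (m * n + m + (j * k + l)) = matC I $$ (j, l)"
  "j < n \<Longrightarrow> rat_list I ! (m * n + m + n * k + j) = vecc I $ j"
  "i < g \<Longrightarrow> l < k \<Longrightarrow> rat_list I ! (m * n + m + n * k + n + (i * k + l)) = matD I $$ (i, l)"
  "i < g \<Longrightarrow> rat_list I ! (m * n + m + n * k + n + g * k + i) = vecd I $ i"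
  "j < n \<Longrightarrow> rat_list I ! (m * n + m + n * k + n + g * k + g + j) = target I $ j"
proof -
  have app: "(xs @ ys) ! (length xs + t) = ys ! t" "t < length xs \<Longrightarrow> (xs @ ys) ! t = xs ! t" for xs ys :: "rat list" and t
    by (simp_all add: nth_append)
  have lt: "i * n' + j < m' * n'" if "i < m'" "j < n'" for i j m' n' :: nat
    using int_mult_add_lt[OF that] by (metis of_nat_add of_nat_less_iff of_nat_mult)
  note len = length_mat_list[OF dims(1)] length_mat_list[OF dims(3)] length_mat_list[OF dims(5)]
      list_of_vec_carrier(1)[OF dims(2)] list_of_vec_carrier(1)[OF dims(4)] list_of_vec_carrier(1)[OF dims(6)]
      list_of_vec_carrier(1)[OF dims(7)]
  note dimv = carrier_vecD[OF dims(2)] carrier_vecD[OF dims(4)] carrier_vecD[OF dims(6)] carrier_vecD[OF dims(7)]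
  note app1 = app(1)[of "concat (mat_to_list (matA I))", unfolded len]
  note app2 = app(1)[of "list_of_vec (vecb I)", unfolded len]
  note app3 = app(1)[of "concat (mat_to_list (matC I))", unfolded len]
  note app4 = app(1)[of "list_of_vec (vecc I)", unfolded len]
  note app5 = app(1)[of "concat (mat_to_list (matD I))", unfolded len]
  note app6 = app(1)[of "list_of_vec (vecd I)", unfolded len]
  show "rat_list I ! (i * n + j) = matA I $$ (i, j)" if "i < m" "j < n"
    unfolding rat_list_def using lt[OF that] nth_mat_list[OF dims(1) that] by (simp add: app(2) len dimv)
  show "rat_list I ! (m * n + i) = vecb I $ i" if "i < m"
    unfolding rat_list_def app1 using that list_of_vec_carrier(2)[OF dims(2)] by (simp add: app(2) len dimv)
  show "rat_list I ! (m * n + m + (j * k + l)) = matC I $$ (j, l)" if "j < n" "l < k"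
    unfolding rat_list_def add.assoc app1 app2
    using lt[OF that] nth_mat_list[OF dims(3) that] by (simp add: app(2) len dimv)
  show "rat_list I ! (m * n + m + n * k + j) = vecc I $ j" if "j < n"
    unfolding rat_list_def add.assoc app1 app2 app3
    using that list_of_vec_carrier(2)[OF dims(4)] by (simp add: app(2) len dimv)
  show "rat_list I ! (m * n + m + n * k + n + (i * k + l)) = matD I $$ (i, l)" if "i < g" "l < k"
    unfolding rat_list_def add.assoc app1 app2 app3 app4
    using lt[OF that] nth_mat_list[OF dims(5) that] by (simp add: app(2) len dimv)
  show "rat_list I ! (m * n + m + n * k + n + g * k + i) = vecd I $ i" if "i < g"
    unfolding rat_list_def add.assoc app1 app2 app3 app4 app5
    using that list_of_vec_carrier(2)[OF dims(6)] by (simp add: app(2) len dimv)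
  show "rat_list I ! (m * n + m + n * k + n + g * k + g + j) = target I $ j" if "j < n"
    unfolding rat_list_def add.assoc app1 app2 app3 app4 app5 app6
    using that list_of_vec_carrier(2)[OF dims(7)] by simp
qed

lemma lp_input:
  assumes "\<bar>\<alpha>\<bar> \<le> 1"
  shows "lp_input inp m n k K g z cnt (N_bound z) (w_bound z) (L_bound z) \<alpha>"
proof -
  have cz: "4 + 2 * cnt \<le> z" using length_le_input_size[of "encode I"] length_encode by simp
  have "m \<le> cnt" "n \<le> cnt" "g \<le> cnt" by (simp_all add: cnt_def)
  moreover have "K \<le> cnt"
  proof (cases "0 < n + g")
    case True
    then have "1 * K \<le> (n + g) * K" by (intro mult_right_mono) auto
    then show ?thesis unfolding cnt_def by (simp add: algebra_simps)
  next
    case False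
    then have "K = 0" unfolding K_def by simp
    then show ?thesis by simp
  qed
  ultimately have le: "m \<le> z" "n \<le> z" "g \<le> z" "K \<le> z" using cz by linarith+
  have nr: "lp_rows m n g \<le> dim_bound z"
    unfolding lp_rows_def dim_bound_def using le by (intro add_mono mult_mono) auto
  have "lp_cols m n K \<le> z + 2 + 2 * z * z"
    unfolding lp_cols_def using le by (intro add_mono mult_mono) auto
  then have nc: "lp_cols m n K \<le> dim_bound z" by (simp add: dim_bound_def)
  note mono = exp_mono_dims(1)[OF nr nc] exp_mono_dims(2-4)[OF nr nc, of "L_bound z"]
  have prods: "lp_rows m n g * lp_cols m n K \<le> dim_bound z * dim_bound z"
    "lp_cols m n K * lp_cols m n K \<le> dim_bound z * dim_bound z"
    using nr nc by (intro mult_mono; simp)+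
  show ?thesis
  proof
    show "\<bar>\<Prod>x<t. inp (5 + 2 * int x)\<bar> \<le> 2 ^ z" if "t \<le> cnt" for t
      by (rule abs_prod_init_le) (use that length_encode in simp)
    show "3 * lp_cols m n K + 2 * lp_rows m n g + 4 * z + 2 \<le> L_bound z"
      using nr nc by (simp add: L_bound_def)
    show "num_R (lp_rows m n g) (lp_cols m n K) (L_bound z) \<le> N_bound z"
      using mono unfolding N_bound_def by linarith
    show "num_T (lp_rows m n g) (lp_cols m n K) \<le> N_bound z" using mono unfolding N_bound_def by linarith
    show "exp_e (lp_rows m n g) (lp_cols m n K) (L_bound z) + lp_rows m n g \<le> N_bound z"
      using mono nr unfolding N_bound_def by linarith
    show "lp_rows m n g * lp_cols m n K \<le> N_bound z" "lp_cols m n K * lp_cols m n K \<le> N_bound z"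
      using prods unfolding N_bound_def by linarith+
    show "4 + 2 * cnt \<le> N_bound z" "L_bound z \<le> N_bound z" using cz unfolding N_bound_def by linarith+
    show "exp_W (lp_rows m n g) (lp_cols m n K) (L_bound z) \<le> w_bound z" using mono unfolding w_bound_def by linarith
    show "N_bound z < w_bound z" "n + 4 * z < w_bound z" using le unfolding w_bound_def by linarith+
  qed (use header assms abs_init_le in \<open>auto simp: K_def cnt_def\<close>)
qed

sublocale inv: inverse_lp m n k g a C D b c d y .

section \<open>From vectors to index functions\<close>

lemma polyhedron_iff:
  assumes "A \<in> carrier_mat p q" "r \<in> carrier_vec p"
  shows "x \<in> polyhedron (real_mat A) (real_vec r) \<longleftrightarrow>
    x \<in> carrier_vec q \<and> (\<forall>i<p. dot q (\<lambda>j. of_rat (A $$ (i, j))) (($) x) \<le> of_rat (r $ i))"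
proof -
  have "(real_mat A *\<^sub>v x) $ i = dot q (\<lambda>j. of_rat (A $$ (i, j))) (($) x)"
    if "x \<in> carrier_vec q" "i < p" for i
    using that assms by (auto simp: scalar_prod_def lessThan_atLeast0)
  then show ?thesis
    using assms by (auto simp: polyhedron_def less_eq_vec_def)
qed

lemma param_set_iff: "x \<in> param_set I \<longleftrightarrow> x \<in> carrier_vec k \<and> inv.param (($) x)"
  unfolding param_set_def polyhedron_iff[OF dims(5,6)] inv.param_def unfolding D_def[abs_def] d_def ..

lemma feasible_iff: "v \<in> polyhedron (real_mat (matA I)) (real_vec (vecb I)) \<longleftrightarrow>
    v \<in> carrier_vec n \<and> inv.lp_feasible (($) v)"
  unfolding polyhedron_iff[OF dims(1,2)] inv.lp_feasible_def unfolding a_def[abs_def] b_def ..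

lemma cost_iff:
  assumes "x \<in> carrier_vec k" "v \<in> carrier_vec n"
  shows "(real_mat (matC I) *\<^sub>v x + real_vec (vecc I)) \<bullet> v = dot n (inv.cost (($) x)) (($) v)"
  using assms dims
  by (auto simp: scalar_prod_def lessThan_atLeast0 inv.cost_def C_def c_def intro!: sum.cong)

lemma dot_vec: "dot q f (($) (vec q u)) = dot q f u" for f u :: "nat \<Rightarrow> real"
  by (rule sum.cong) auto

lemma feasible_vec: "inv.lp_feasible (($) (vec n u)) \<longleftrightarrow> inv.lp_feasible u"
  unfolding inv.lp_feasible_def dot_vec ..

lemma lp_solutions_iff:
  assumes x: "x \<in> carrier_vec k"
  shows "v \<in> lp_solutions I x \<longleftrightarrow> v \<in> carrier_vec n \<and> inv.lp_optimal (($) x) (($) v)"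
proof -
  have "(\<forall>u\<in>polyhedron (real_mat (matA I)) (real_vec (vecb I)).
        (real_mat (matC I) *\<^sub>v x + real_vec (vecc I)) \<bullet> v \<le> (real_mat (matC I) *\<^sub>v x + real_vec (vecc I)) \<bullet> u) \<longleftrightarrow>
      (\<forall>u. inv.lp_feasible u \<longrightarrow> dot n (inv.cost (($) x)) (($) v) \<le> dot n (inv.cost (($) x)) u)"
    if v: "v \<in> carrier_vec n"
  proof (intro iffI allI ballI impI)
    fix u
    assume *: "\<forall>u\<in>polyhedron (real_mat (matA I)) (real_vec (vecb I)).
        (real_mat (matC I) *\<^sub>v x + real_vec (vecc I)) \<bullet> v \<le> (real_mat (matC I) *\<^sub>v x + real_vec (vecc I)) \<bullet> u"
      and u: "inv.lp_feasible u"
    have "vec n u \<in> polyhedron (real_mat (matA I)) (real_vec (vecb I))"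
      unfolding feasible_iff feasible_vec using u by simp
    with * have "(real_mat (matC I) *\<^sub>v x + real_vec (vecc I)) \<bullet> v \<le> (real_mat (matC I) *\<^sub>v x + real_vec (vecc I)) \<bullet> vec n u"
      by blast
    then show "dot n (inv.cost (($) x)) (($) v) \<le> dot n (inv.cost (($) x)) u"
      unfolding cost_iff[OF x v] cost_iff[OF x vec_carrier] dot_vec .
  next
    fix u
    assume *: "\<forall>u. inv.lp_feasible u \<longrightarrow> dot n (inv.cost (($) x)) (($) v) \<le> dot n (inv.cost (($) x)) u"
      and u: "u \<in> polyhedron (real_mat (matA I)) (real_vec (vecb I))"
    then show "(real_mat (matC I) *\<^sub>v x + real_vec (vecc I)) \<bullet> v \<le> (real_mat (matC I) *\<^sub>v x + real_vec (vecc I)) \<bullet> u"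
      unfolding feasible_iff using cost_iff[OF x] v by auto
  qed
  then show ?thesis
    unfolding lp_solutions_def lp_argmin_def inv.lp_optimal_def using feasible_iff by auto
qed

lemma target_y: "j < n \<Longrightarrow> real_vec (target I) $ j = y j" "real_vec (target I) \<in> carrier_vec n"
  using dims(7) by (auto simp: y_def)

lemma param_vec: "inv.param (($) (vec k x)) \<longleftrightarrow> inv.param x"
  unfolding inv.param_def dot_vec ..

text \<open>A vector determines an index function only inside its dimension, so optimality must not
  depend on values elsewhere.\<close>

lemma optimal_cong:
  assumes "\<And>l. l < k \<Longrightarrow> x l = x' l" "\<And>j. j < n \<Longrightarrow> u j = u' j"
  shows "inv.lp_optimal x u \<longleftrightarrow> inv.lp_optimal x' u'"
proof -
  have "inv.cost x = inv.cost x'" unfolding inv.cost_def[abs_def] using assms(1) by simp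
  moreover have "dot n f u = dot n f u'" for f :: "nat \<Rightarrow> real" using assms(2) by (intro sum.cong) auto
  ultimately show ?thesis unfolding inv.lp_optimal_def inv.lp_feasible_def by simp
qed

lemma optimistic_iff: "optimistic I \<longleftrightarrow> (\<exists>x. inv.param x \<and> inv.lp_optimal x y)"
proof
  assume "optimistic I"
  then obtain x where "x \<in> param_set I" "real_vec (target I) \<in> lp_solutions I x" by (auto simp: optimistic_def)
  moreover from this have "inv.lp_optimal (($) x) (($) (real_vec (target I)))"
    using param_set_iff lp_solutions_iff by blast
  then have "inv.lp_optimal (($) x) y" using optimal_cong[of "($) x" "($) x" "($) (real_vec (target I))" y] target_y by simp
  ultimately show "\<exists>x. inv.param x \<and> inv.lp_optimal x y" using param_set_iff by blast
next
  assume "\<exists>x. inv.param x \<and> inv.lp_optimal x y"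
  then obtain x where x: "inv.param x" "inv.lp_optimal x y" by blast
  have "inv.lp_optimal (($) (vec k x)) (($) (real_vec (target I)))"
    using optimal_cong[of "($) (vec k x)" x "($) (real_vec (target I))" y] target_y x(2) by simp
  then have "real_vec (target I) \<in> lp_solutions I (vec k x)" using lp_solutions_iff target_y(2) vec_carrier by blast
  moreover have "vec k x \<in> param_set I" using x(1) param_set_iff param_vec vec_carrier by blast
  ultimately show "optimistic I" by (auto simp: optimistic_def)
qed

lemma pessimistic_iff: "pessimistic I \<longleftrightarrow>
    (\<exists>x. inv.param x \<and> inv.lp_optimal x y \<and> (\<forall>u. inv.lp_optimal x u \<longrightarrow> (\<forall>j<n. u j = y j)))"
proof
  assume "pessimistic I"
  then obtain x where x: "x \<in> param_set I" and sol: "lp_solutions I x = {real_vec (target I)}"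
    by (auto simp: pessimistic_def)
  have xk: "x \<in> carrier_vec k" "inv.param (($) x)" using x param_set_iff by blast+
  have "real_vec (target I) \<in> lp_solutions I x" using sol by simp
  then have "inv.lp_optimal (($) x) (($) (real_vec (target I)))" using lp_solutions_iff[OF xk(1)] by blast
  then have "inv.lp_optimal (($) x) y" using optimal_cong[of "($) x" "($) x" "($) (real_vec (target I))" y] target_y by simp
  moreover have "u j = y j" if u: "inv.lp_optimal (($) x) u" and j: "j < n" for u j
  proof -
    have "inv.lp_optimal (($) x) (($) (vec n u))"
      using optimal_cong[of "($) x" "($) x" "($) (vec n u)" u] u by simp
    then have "vec n u \<in> lp_solutions I x" using lp_solutions_iff[OF xk(1)] vec_carrier by blast
    then have "vec n u = real_vec (target I)" using sol by simp
    then have "vec n u $ j = real_vec (target I) $ j" by simp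
    then show ?thesis using j target_y(1)[OF j] by simp
  qed
  ultimately show "\<exists>x. inv.param x \<and> inv.lp_optimal x y \<and> (\<forall>u. inv.lp_optimal x u \<longrightarrow> (\<forall>j<n. u j = y j))"
    using xk(2) by blast
next
  assume "\<exists>x. inv.param x \<and> inv.lp_optimal x y \<and> (\<forall>u. inv.lp_optimal x u \<longrightarrow> (\<forall>j<n. u j = y j))"
  then obtain x where x: "inv.param x" "inv.lp_optimal x y" and uniq: "\<And>u j. inv.lp_optimal x u \<Longrightarrow> j < n \<Longrightarrow> u j = y j"
    by blast
  have "inv.lp_optimal (($) (vec k x)) (($) (real_vec (target I)))"
    using optimal_cong[of "($) (vec k x)" x "($) (real_vec (target I))" y] target_y x(2) by simp
  then have "real_vec (target I) \<in> lp_solutions I (vec k x)" using lp_solutions_iff target_y(2) vec_carrier by blast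
  moreover have "v = real_vec (target I)" if v: "v \<in> lp_solutions I (vec k x)" for v
  proof -
    have vn: "v \<in> carrier_vec n" and "inv.lp_optimal (($) (vec k x)) (($) v)"
      using v lp_solutions_iff[OF vec_carrier] by blast+
    then have "inv.lp_optimal x (($) v)" using optimal_cong[of "($) (vec k x)" x "($) v" "($) v"] by simp
    then have "v $ j = y j" if "j < n" for j using uniq that by blast
    then show ?thesis using vn target_y by (intro eq_vecI) auto
  qed
  ultimately have "lp_solutions I (vec k x) = {real_vec (target I)}" by blast
  moreover have "vec k x \<in> param_set I" using x(1) param_set_iff param_vec vec_carrier by blast
  ultimately show "pessimistic I" by (auto simp: pessimistic_def)
qed

text \<open>If there are neither variables nor parameter constraints, then \<open>k\<close> is not bounded by the
  input size, and the program replaces it by \<open>0\<close>.\<close>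

lemma dual_system_K: "inverse_lp.dual_system m n K g a C D b c d y \<alpha> \<longleftrightarrow> inv.dual_system \<alpha>"
proof (cases "0 < n + g")
  case True
  then show ?thesis by (simp add: K_def)
next
  case False
  then show ?thesis unfolding inverse_lp.dual_system_def by simp
qed

text \<open>The product \<open>PP\<close> of all denominators is positive and divisible by each of
  them, so the scaled integers are PP times the rational data. The matrix built by the program is
  therefore that of the dual system of the instance, with \<open>K\<close> in place of k.\<close>

lemma wp_decide_instance:
  assumes \<alpha>: "\<bar>\<alpha>\<bar> \<le> 1"
  shows "wp (N_bound z) (w_bound z) (decide \<alpha>)
    (\<lambda>s. s 1 0 = of_bool (inv.lp_feasible y \<and> inv.dual_system (real_of_int \<alpha>))) (init_state (encode I))"
proof -
  interpret lp_input inp m n k K g z cnt "N_bound z" "w_bound z" "L_bound z" \<alpha> by (rule lp_input[OF \<alpha>])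
  have den: "0 < inp (5 + 2 * int t)" if "t < cnt" for t
    using inp_rat(2)[OF that] quotient_of_denom_pos' by simp
  have P0: "0 < PP" unfolding PP_def by (rule prod_pos) (use den in auto)
  \<comment> \<open>The denominator divides \<open>PP\<close>, so the division in \<open>scv\<close>
    is exact.\<close>
  have sc: "real_of_int (scv (4 + 2 * int t)) = PP * of_rat (rat_list I ! t)" if t: "t < cnt" for t
  proof -
    let ?q = "quotient_of (rat_list I ! t)"
    have "snd ?q dvd PP" unfolding PP_def inp_rat(2)[OF t, symmetric] by (rule dvd_prodI) (use t in auto)
    then obtain e where e: "PP = snd ?q * e" by (elim dvdE)
    have d0: "snd ?q \<noteq> 0" using den[OF t] inp_rat(2)[OF t] by simp
    have "4 + 2 * int t + 1 = 5 + 2 * int t" by simp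
    then have "scv (4 + 2 * int t) = fst ?q * PP div snd ?q" unfolding scv_def using inp_rat[OF t] by simp
    also have "\<dots> = fst ?q * e" using d0 unfolding e by (simp add: mult.left_commute)
    finally have "real_of_int (scv (4 + 2 * int t)) = fst ?q * e" by simp
    moreover have "rat_list I ! t = of_int (fst ?q) / of_int (snd ?q)"
      by (rule quotient_of_div) simp
    then have "real_of_rat (rat_list I ! t) = real_of_int (fst ?q) / real_of_int (snd ?q)"
      by (metis of_rat_divide of_rat_of_int_eq)
    ultimately show ?thesis using d0 unfolding e by simp
  qed
  have lt: "i * n' + j < m' * n'" if "i < m'" "j < n'" for i j m' n' :: nat
    using int_mult_add_lt[OF that] by (metis of_nat_add of_nat_less_iff of_nat_mult)
  note idx = index_less[where p = "m * n" and q = "n * K" and r = "g * K" and m = m and n = n and g = g, folded cnt_def]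
  note nth = nth_rat_list[folded K_mult]
  have As: "real_of_int (As i j) = PP * a i j" if "i < m" "j < n" for i j
    using sc[OF idx(1)[OF lt[OF that]]] nth(1)[OF that] by (simp add: As_def a_def algebra_simps)
  have bs: "real_of_int (bs i) = PP * b i" if "i < m" for i
    using sc[OF idx(2)[OF that]] nth(2)[OF that] by (simp add: bs_def b_def pb_def algebra_simps)
  have Cs: "real_of_int (Cs j l) = PP * C j l" if "j < n" "l < K" for j l
  proof -
    have "rat_list I ! (m * n + m + (j * K + l)) = matC I $$ (j, l)"
      using nth(3)[of j l] that K_eq(1)[OF that(1)] by simp
    then show ?thesis using sc[OF idx(3)[OF lt[OF that]]] by (simp add: Cs_def C_def pC_def pb_def algebra_simps)
  qed
  have cs: "real_of_int (cs j) = PP * c j" if "j < n" for j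
    using sc[OF idx(4)[OF that]] nth(4)[OF that] by (simp add: cs_def c_def pc_def pC_def pb_def algebra_simps)
  have Ds: "real_of_int (Ds i l) = PP * D i l" if "i < g" "l < K" for i l
  proof -
    have "rat_list I ! (m * n + m + n * K + n + (i * K + l)) = matD I $$ (i, l)"
      using nth(5)[of i l] that K_eq(2)[OF that(1)] by simp
    then show ?thesis using sc[OF idx(5)[OF lt[OF that]]]
      by (simp add: Ds_def D_def pD_def pc_def pC_def pb_def algebra_simps)
  qed
  have ds: "real_of_int (ds i) = PP * d i" if "i < g" for i
    using sc[OF idx(6)[OF that]] nth(6)[OF that]
    by (simp add: ds_def d_def pd_def pD_def pc_def pC_def pb_def algebra_simps)
  have ys: "real_of_int (ys j) = PP * y j" if "j < n" for j
    using sc[OF idx(7)[OF that]] nth(7)[OF that]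
    by (simp add: ys_def y_def py_def pd_def pD_def pc_def pC_def pb_def algebra_simps)
  have P2: "0 < real_of_int PP * real_of_int PP" using P0 by simp
  have lhs: "real_of_int (dot n (As i) ys) = (real_of_int PP * real_of_int PP) * dot n (a i) y" if i: "i < m" for i
  proof -
    have "real_of_int (dot n (As i) ys) = (\<Sum>j<n. (real_of_int PP * real_of_int PP) * (a i j * y j))"
      unfolding of_int_sum by (rule sum.cong) (use As[OF i] ys in \<open>auto simp: mult_ac\<close>)
    then show ?thesis by (simp only: sum_distrib_left)
  qed
  have rhs: "real_of_int (bs i * PP) = (real_of_int PP * real_of_int PP) * b i" if "i < m" for i
    using bs[OF that] by (simp add: mult_ac)
  have bad_iff: "bad \<longleftrightarrow> \<not> inv.lp_feasible y"
  proof -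
    have "bs i * PP < dot n (As i) ys \<longleftrightarrow> b i < dot n (a i) y" if "i < m" for i
    proof -
      have "bs i * PP < dot n (As i) ys \<longleftrightarrow> real_of_int (bs i * PP) < real_of_int (dot n (As i) ys)"
        by (simp only: of_int_less_iff)
      also have "\<dots> \<longleftrightarrow> b i < dot n (a i) y"
        unfolding lhs[OF that] rhs[OF that] using P2 by (simp only: mult_less_cancel_left_pos)
      finally show ?thesis .
    qed
    then show ?thesis unfolding bad_def inv.lp_feasible_def using not_le by blast
  qed
  have act_iff: "act i \<longleftrightarrow> dot n (a i) y = b i" if "\<not> bad" "i < m" for i
  proof -
    have "act i \<longleftrightarrow> real_of_int (bs i * PP) \<le> real_of_int (dot n (As i) ys)"
      unfolding act_def by (simp only: of_int_le_iff)
    also have "\<dots> \<longleftrightarrow> b i \<le> dot n (a i) y"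
      unfolding lhs[OF that(2)] rhs[OF that(2)] using P2 by (simp only: mult_le_cancel_left_pos)
    also have "\<dots> \<longleftrightarrow> dot n (a i) y = b i"
      using that bad_iff unfolding inv.lp_feasible_def by (metis order_antisym_conv order_refl)
    finally show ?thesis .
  qed
  \<comment> \<open>\<open>act\<close> means tightness only for a feasible target; for an infeasible
    one both sides are false.\<close>
  have result: "(\<not> bad \<and> cone_feasible (lp_rows m n g) (lp_cols m n K) (lp_entry m n K g \<alpha> PP As Cs cs Ds ds act)) \<longleftrightarrow>
      inv.lp_feasible y \<and> inv.dual_system (real_of_int \<alpha>)"
  proof (cases bad)
    case True
    then show ?thesis using bad_iff by simp
  next
    case False
    interpret inverse_lp_int m n K g a C D b c d y PP \<alpha> As Cs Ds cs ds act
      by standard (use P0 As Cs Ds cs ds act_iff[OF False] in auto)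
    show ?thesis
      using False bad_iff cone_feasible_iff_dual_system dual_system_K[of "real_of_int \<alpha>"] by blast
  qed
  show ?thesis
    by (rule wp_decide) (use result in \<open>auto simp: init_state_def\<close>)
qed

end

theorem theorem4:
  shows "poly_time_decidable instances encode optimistic \<and>
         poly_time_decidable instances encode pessimistic"
proof
  have le: "n \<le> w_bound n" for n by (simp add: w_bound_def)
  show "poly_time_decidable instances encode optimistic"
  proof (rule poly_time_decidableI[OF poly_bounded_bounds _ le])
    fix I assume "I \<in> instances"
    then obtain m n k g where "lp_instance I m n k g" by (auto simp: instances_def lp_instance_def)
    then interpret lp_instance I m n k g .
    have "optimistic I \<longleftrightarrow> inv.lp_feasible y \<and> inv.dual_system (real_of_int 0)"
      unfolding optimistic_iff inv.optimistic_iff_dual_system by simp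
    then show "wp (N_bound z) (w_bound z) (decide 0)
        (\<lambda>s. s 1 0 = (if optimistic I then 1 else 0)) (init_state (encode I))"
      by (intro wp_mono[OF wp_decide_instance[of 0]]) auto
  qed
  show "poly_time_decidable instances encode pessimistic"
  proof (rule poly_time_decidableI[OF poly_bounded_bounds _ le])
    fix I assume "I \<in> instances"
    then obtain m n k g where "lp_instance I m n k g" by (auto simp: instances_def lp_instance_def)
    then interpret lp_instance I m n k g .
    have "pessimistic I \<longleftrightarrow> inv.lp_feasible y \<and> inv.dual_system (real_of_int 1)"
      unfolding pessimistic_iff inv.pessimistic_iff_dual_system by simp
    then show "wp (N_bound z) (w_bound z) (decide 1)
        (\<lambda>s. s 1 0 = (if pessimistic I then 1 else 0)) (init_state (encode I))"
      by (intro wp_mono[OF wp_decide_instance[of 1]]) auto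
  qed
qed

end
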